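(* Let $G=(V,E)$ be any connected directed graph with all self-loops (i.e. $i\to i\in E$ for every $i\in V$) on $p\ge 3$ nodes. Then the off-diagonal modified Jacobian $\mathcal{J}^G_{\mathrm{off}}(S,T)$ generically has full rank, equal to $|E|$. Therefore, the corresponding third-order discrete Lyapunov model is locally identifiable from its second- and third-order cumulants.
   Context: $V=\{0,\dots,p-1\}$, $E\subseteq V\times V$; cycles are allowed, and "connected" means that the underlying undirected graph is connected. $\mathbb{R}^E$ is the set of real $p\times p$ matrices $A=(a_{ji})$ with $a_{ji}=0$ whenever $i\to j\notin E$; $\mathbb{R}^E_{\mathrm{stab}}\subseteq\mathbb{R}^E$ is the subset of Schur stable matrices (all complex eigenvalues of absolute value $<1$). Parameter space: $\Theta=\mathbb{R}^E_{\mathrm{stab}}\times\mathbb{R}_+^p\times(\mathbb{R}\setminus\{0\})^p$, with elements $\theta=(A,\Omega^{(2)},\Omega^{(3)})$, where $\mathbb{R}_+$ denotes the positive reals and the vectors are the diagonals of a diagonal matrix $\Omega^{(2)}$ and a diagonal $p\times p\times p$ tensor $\Omega^{(3)}$. Let $\varphi(\theta)=(S,T)$ be the second- and third-order cumulants given by $\mathrm{vec}(S)=(I-A\otimes A)^{-1}\mathrm{vec}(\Omega^{(2)})$ and $\mathrm{vec}(T)=(I-A\otimes A\otimes A)^{-1}\mathrm{vec}(\Omega^{(3)})$; equivalently $S=ASA^T+\Omega^{(2)}$ and $t_{ijk}=\sum_{l,m,n}a_{il}a_{jm}a_{kn}t_{lmn}+\Omega^{(3)}_{ijk}$. Modified Jacobian: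 let $E_{\beta\alpha}$ be the $p\times p$ matrix with a $1$ in position $(\beta,\alpha)$ and $0$ elsewhere. $J^G_2(S,a)$ is the matrix with rows indexed by pairs $(ij)$, $i\le j$, and columns indexed by the edges $\alpha\to\beta\in E$, whose column $\alpha\to\beta$ consists of the corresponding entries of $(E_{\beta\alpha}\otimes A+A\otimes E_{\beta\alpha})\mathrm{vec}(S)$. $J^G_3(T,a)$ is the matrix with rows indexed by triples $(ijk)$, $i\le j\le k$, and columns indexed by $E$, whose column $\alpha\to\beta$ consists of the corresponding entries of $(E_{\beta\alpha}\otimes A\otimes A+A\otimes E_{\beta\alpha}\otimes A+A\otimes A\otimes E_{\beta\alpha})\mathrm{vec}(T)$. $\mathcal{J}^G_{\mathrm{off}}(S,T)$ is obtained by stacking the rows $(ij)$ with $i\neq j$ of $J^G_2(S,a)$ and the rows $(ijk)$ with $i,j,k$ not all equal of $J^G_3(T,a)$. It is a function of $\theta\in\Theta$. "Generically" means for all $\theta$ outside a proper algebraic subset of $\Theta$. "Locally identifiable" means: there is a proper algebraic subset $Z$ of $\Theta$ such that $\varphi^{-1}(\varphi(\theta))$ is finite for all $\theta\in\Theta\setminus Z$. *)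

theory Defs
  imports "HOL-Analysis.Analysis"
begin

text \<open>
  The nodes are the elements of a finite linearly ordered type \<open>'n\<close>, so \<open>p = CARD('n)\<close>; the order
  serves only to select the rows \<open>i \<le> j\<close> and \<open>i \<le> j \<le> k\<close> of the Jacobian. A graph is its edge set,
  with \<open>(i, j) \<in> E\<close> standing for \<open>i \<rightarrow> j\<close>; the weight of this edge is the entry \<open>A $ j $ i\<close>.
\<close>

type_synonym 'n matrix = "real^'n^'n"
type_synonym 'n tensor = "real^'n^'n^'n"

definition graph_connected :: "('n \<times> 'n) set \<Rightarrow> bool" where
  "graph_connected E \<longleftrightarrow> (\<forall>i j. (i, j) \<in> (E \<union> E\<inverse>)\<^sup>*)"

definition graph_matrices :: "('n::finite \<times> 'n) set \<Rightarrow> 'n matrix set" where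
  "graph_matrices E = {A. \<forall>i j. (i, j) \<notin> E \<longrightarrow> A $ j $ i = 0}"

definition eigenvalue :: "complex^'n^'n \<Rightarrow> complex \<Rightarrow> bool" where
  "eigenvalue B z \<longleftrightarrow> (\<exists>v. v \<noteq> 0 \<and> B *v v = z *s v)"

definition schur_stable :: "'n::finite matrix \<Rightarrow> bool" where
  "schur_stable A \<longleftrightarrow> (\<forall>z. eigenvalue (map_matrix complex_of_real A) z \<longrightarrow> cmod z < 1)"

type_synonym 'n param = "'n matrix \<times> (real^'n) \<times> (real^'n)"

definition param_space :: "('n::finite \<times> 'n) set \<Rightarrow> 'n param set" where
  "param_space E =
     {A \<in> graph_matrices E. schur_stable A} \<times> {w. \<forall>i. w $ i > 0} \<times> {w. \<forall>i. w $ i \<noteq> 0}"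

definition kron :: "real^'b^'a \<Rightarrow> real^'d^'c \<Rightarrow> real^('b \<times> 'd)^('a \<times> 'c)" (infixr \<open>\<otimes>\<^sub>K\<close> 75)
  where "A \<otimes>\<^sub>K B = (\<chi> r c. A $ fst r $ fst c * B $ snd r $ snd c)"

definition vec2 :: "'n::finite matrix \<Rightarrow> real^('n \<times> 'n)" where
  "vec2 S = (\<chi> r. case r of (i, j) \<Rightarrow> S $ i $ j)"

definition unvec2 :: "real^('n::finite \<times> 'n) \<Rightarrow> 'n matrix" where
  "unvec2 v = (\<chi> i j. v $ (i, j))"

definition vec3 :: "'n::finite tensor \<Rightarrow> real^('n \<times> 'n \<times> 'n)" where
  "vec3 T = (\<chi> r. case r of (i, j, k) \<Rightarrow> T $ i $ j $ k)"

definition unvec3 :: "real^('n::finite \<times> 'n \<times> 'n) \<Rightarrow> 'n tensor" where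
  "unvec3 v = (\<chi> i j k. v $ (i, j, k))"

definition diag2 :: "real^'n \<Rightarrow> 'n matrix" where
  "diag2 w = (\<chi> i j. if i = j then w $ i else 0)"

definition diag3 :: "real^'n \<Rightarrow> 'n tensor" where
  "diag3 w = (\<chi> i j k. if i = j \<and> j = k then w $ i else 0)"

text \<open>
  On the parameter space \<open>A\<close> is Schur stable, so the matrices inverted below are invertible;
  elsewhere \<open>matrix_inv\<close> may be unspecified.
\<close>

definition cumulant2 :: "'n::finite param \<Rightarrow> 'n matrix" where
  "cumulant2 = (\<lambda>(A, w2, w3). unvec2 (matrix_inv (mat 1 - A \<otimes>\<^sub>K A) *v vec2 (diag2 w2)))"

definition cumulant3 :: "'n::finite param \<Rightarrow> 'n tensor" where
  "cumulant3 = (\<lambda>(A, w2, w3). unvec3 (matrix_inv (mat 1 - A \<otimes>\<^sub>K A \<otimes>\<^sub>K A) *v vec3 (diag3 w3)))"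

definition cumulant_map :: "'n::finite param \<Rightarrow> 'n matrix \<times> 'n tensor" where
  "cumulant_map \<theta> = (cumulant2 \<theta>, cumulant3 \<theta>)"

definition unit_matrix :: "'n::finite \<Rightarrow> 'n \<Rightarrow> 'n matrix" where
  "unit_matrix b a = (\<chi> i j. if i = b \<and> j = a then 1 else 0)"

text \<open>
  The matrices \<open>J2\<close>, \<open>J3\<close> and \<open>J_off\<close> live in ambient index types: rows range over all pairs and
  triples, columns over all pairs of nodes. Rows that are not selected and columns that are not
  edges are filled with zeros, which does not affect the rank.
\<close>

definition J2 :: "('n::{finite,linorder} \<times> 'n) set \<Rightarrow> 'n matrix \<Rightarrow> 'n matrix
    \<Rightarrow> real^('n \<times> 'n)^('n \<times> 'n)" where
  "J2 E S A = (\<chi> r e. case (r, e) of ((i, j), (a, b)) \<Rightarrow>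
     if i \<le> j \<and> (a, b) \<in> E
     then ((unit_matrix b a \<otimes>\<^sub>K A + A \<otimes>\<^sub>K unit_matrix b a) *v vec2 S) $ (i, j)
     else 0)"

definition J3 :: "('n::{finite,linorder} \<times> 'n) set \<Rightarrow> 'n tensor \<Rightarrow> 'n matrix
    \<Rightarrow> real^('n \<times> 'n)^('n \<times> 'n \<times> 'n)" where
  "J3 E T A = (\<chi> r e. case (r, e) of ((i, j, k), (a, b)) \<Rightarrow>
     if i \<le> j \<and> j \<le> k \<and> (a, b) \<in> E
     then ((unit_matrix b a \<otimes>\<^sub>K A \<otimes>\<^sub>K A + A \<otimes>\<^sub>K unit_matrix b a \<otimes>\<^sub>K A
            + A \<otimes>\<^sub>K A \<otimes>\<^sub>K unit_matrix b a) *v vec3 T) $ (i, j, k)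
     else 0)"

definition J_off :: "('n::{finite,linorder} \<times> 'n) set \<Rightarrow> 'n matrix \<Rightarrow> 'n tensor
    \<Rightarrow> 'n matrix \<Rightarrow> real^('n \<times> 'n)^(('n \<times> 'n) + ('n \<times> 'n \<times> 'n))" where
  "J_off E S T A = (\<chi> r. case r of
       Inl (i, j) \<Rightarrow> if i \<noteq> j then J2 E S A $ (i, j) else 0
     | Inr (i, j, k) \<Rightarrow> if \<not> (i = j \<and> j = k) then J3 E T A $ (i, j, k) else 0)"

text \<open>
  Polynomials on the ambient Euclidean space restrict to all polynomials in the coordinates
  \<open>a\<^sub>j\<^sub>i\<close> with \<open>i \<rightarrow> j \<in> E\<close> and the entries of the two diagonals.
\<close>

definition proper_algebraic_subset :: "'a::euclidean_space set \<Rightarrow> 'a set \<Rightarrow> bool" where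
  "proper_algebraic_subset X Z \<longleftrightarrow>
     (\<exists>F. finite F \<and> (\<forall>f\<in>F. real_polynomial_function f) \<and> Z = {x \<in> X. \<forall>f\<in>F. f x = 0})
     \<and> Z \<subset> X"

definition generically :: "'a::euclidean_space set \<Rightarrow> ('a \<Rightarrow> bool) \<Rightarrow> bool" where
  "generically X P \<longleftrightarrow> (\<exists>Z. proper_algebraic_subset X Z \<and> (\<forall>x \<in> X - Z. P x))"

definition locally_identifiable :: "('n::finite \<times> 'n) set \<Rightarrow> bool" where
  "locally_identifiable E \<longleftrightarrow>
     generically (param_space E)
       (\<lambda>\<theta>. finite {\<theta>' \<in> param_space E. cumulant_map \<theta>' = cumulant_map \<theta>})"

end

theory Submission
  imports Defs "HOL-Computational_Algebra.Fundamental_Theorem_Algebra"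
begin

text \<open>
  Full rank is a polynomial non-vanishing condition, so one parameter point suffices. The base point
  is \<open>1/2\<close> times the identity plus edges into a node \<open>i\<close> from a set \<open>P\<close> of one or two nodes: if
  some edge \<open>j \<rightarrow> i\<close> has no reverse, \<open>P = {j}\<close>; otherwise every edge has a reverse and, as
  \<open>p \<ge> 3\<close>, some node \<open>i\<close> has two neighbours, which form \<open>P\<close>. There the kernel of the Jacobian
  consists of the diagonal matrices supported outside \<open>{i} \<union> P\<close>. Now perturb by \<open>\<epsilon>\<close> times a forest
  of edges that joins every other node \<open>l\<close> to a parent closer to \<open>{i} \<union> P\<close>. At first order the rows
  that involve \<open>l\<close> and the component of its parent force the \<open>l\<close>-th diagonal entry to vanish once
  it vanishes for the parent; hence the Jacobian is injective for small \<open>\<epsilon> \<noteq> 0\<close>.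

  Since the diagonal noise terms only enter the diagonal cumulant equations, injectivity of the
  off-diagonal Jacobian implies that \<open>\<phi>\<close> has an injective derivative at that point, so suitable linear
  combinations of its components are algebraically independent, by the open mapping property. Each
  parameter coordinate is therefore a root of a polynomial whose coefficients are polynomials in the
  cumulants and generically do not all vanish, which bounds the fibres.
\<close>

section \<open>Polynomial relations and generically finite fibres\<close>

text \<open>Counting rows explains the two base points. On two nodes joined in both directions there
  are four unknowns, but only the rows (i,j), (i,i,j), (i,j,j) are off-diagonal, so rank 4 is
  impossible. Dropping one direction leaves three unknowns for three rows; a third node gives ten
  rows for at most nine unknowns. Keeping the other nodes isolated makes all cumulants explicit, at
  the price of a genuine kernel: the loop of an isolated node l only enters the rows (l,l) and
  (l,l,l), which are discarded. First order suffices in the perturbation because each new edge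
  couples one outside node to a component whose loops are already under control. A local inverse of
  the cumulant map would not give identifiability: the fibre is taken in all of \<Theta> and might
  have infinitely many points far from \<theta>. Polynomial relations that hold on the whole of
  \<Theta> control those points as well. As there may be more cumulants than parameters, the
  independent functions are obtained by composing with a linear left inverse of the
  derivative.\<close>

lemma homogeneous_system_nontrivial_solution:
  fixes c :: "'j \<Rightarrow> 'x \<Rightarrow> 'f::field"
  assumes "finite X" "finite J" "card X < card J"
  shows "\<exists>d. (\<exists>j\<in>J. d j \<noteq> 0) \<and> (\<forall>x\<in>X. (\<Sum>j\<in>J. d j * c j x) = 0)"
  using assms
proof (induction X arbitrary: J c rule: finite_induct)
  case empty
  then obtain j where "j \<in> J" by fastforce
  then show ?case by (intro exI[of _ "\<lambda>_. 1"]) auto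
next
  case (insert x X)
  show ?case
  proof (cases "\<exists>j0\<in>J. c j0 x \<noteq> 0")
    case False
    have "card X < card J" using insert by simp
    then obtain d where "\<exists>j\<in>J. d j \<noteq> 0" "\<forall>x\<in>X. (\<Sum>j\<in>J. d j * c j x) = 0"
      using insert.IH[of J c] insert.prems by blast
    then show ?thesis using False by (intro exI[of _ d]) auto
  next
    case True
    then obtain j0 where j0: "j0 \<in> J" "c j0 x \<noteq> 0" by blast
    \<comment> \<open>Row reduction with pivot \<open>c j0 x\<close>: solving equation
      \<open>x\<close> for the unknown at \<open>j0\<close> and substituting turns the other
      coefficients into \<open>c'\<close>. The eliminated unknown is recovered as
      \<open>- e\<close>.\<close>
    define c' where "c' j y = c j y - c j x / c j0 x * c j0 y" for j y
    have "card X < card (J - {j0})" using insert j0 by simp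
    then obtain d where d: "\<exists>j\<in>J - {j0}. d j \<noteq> 0"
      "\<forall>y\<in>X. (\<Sum>j\<in>J - {j0}. d j * c' j y) = 0"
      using insert.IH[of "J - {j0}" c'] insert.prems by auto
    define e where "e = (\<Sum>j\<in>J - {j0}. d j * c j x) / c j0 x"
    define d' where "d' j = (if j = j0 then - e else d j)" for j
    have split: "(\<Sum>j\<in>J. d' j * c j y) = (\<Sum>j\<in>J - {j0}. d j * c j y) - e * c j0 y" for y
    proof -
      have "(\<Sum>j\<in>J. d' j * c j y) = d' j0 * c j0 y + (\<Sum>j\<in>J - {j0}. d' j * c j y)"
        using insert.prems j0 by (simp add: sum.remove)
      also have "(\<Sum>j\<in>J - {j0}. d' j * c j y) = (\<Sum>j\<in>J - {j0}. d j * c j y)"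
        by (rule sum.cong) (auto simp: d'_def)
      finally show ?thesis by (simp add: d'_def)
    qed
    have "(\<Sum>j\<in>J. d' j * c j x) = 0" using j0 by (simp add: split e_def)
    moreover have "(\<Sum>j\<in>J. d' j * c j y) = 0" if "y \<in> X" for y
    proof -
      have "(\<Sum>j\<in>J - {j0}. d j * c' j y) = (\<Sum>j\<in>J - {j0}. d j * c j y) - e * c j0 y"
        by (simp add: c'_def e_def algebra_simps sum_subtractf sum_distrib_left sum_divide_distrib)
      then show ?thesis using d(2) that by (simp add: split)
    qed
    moreover have "\<exists>j\<in>J. d' j \<noteq> 0" using d(1) by (auto simp: d'_def)
    ultimately show ?thesis by (intro exI[of _ d']) auto
  qed
qed

section \<open>Monomials with bounded exponents and uniqueness of coefficients\<close>

definition monomial :: "'i set \<Rightarrow> ('i \<Rightarrow> nat) \<Rightarrow> ('i \<Rightarrow> real) \<Rightarrow> real" where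
  "monomial I \<alpha> y = (\<Prod>b\<in>I. y b ^ \<alpha> b)"

text \<open>Each exponent is bounded separately, not the total degree: this gives exactly
  \<open>(m + 1) ^ card I\<close> monomials and lets one variable be split off at a time.\<close>

abbreviation exponents :: "'i set \<Rightarrow> nat \<Rightarrow> ('i \<Rightarrow> nat) set" where
  "exponents I m \<equiv> (\<Pi>\<^sub>E b\<in>I. {..m})"

text \<open>Grouping the exponents by their value at \<open>b\<close> reads the combination as a
  polynomial in \<open>y b\<close> with coefficients in the other variables. This drives the
  uniqueness of coefficients and later isolates one parameter coordinate in an algebraic
  relation.\<close>

lemma monomial_combination_insert:
  assumes "finite I" "b \<notin> I"
  shows "(\<Sum>\<alpha>\<in>exponents (insert b I) m. c \<alpha> * monomial (insert b I) \<alpha> y)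
      = (\<Sum>t\<le>m. (\<Sum>\<alpha>\<in>exponents I m. c (\<alpha>(b := t)) * monomial I \<alpha> y) * y b ^ t)"
proof -
  have inj: "inj_on (\<lambda>(t, \<alpha>). \<alpha>(b := t)) ({..m} \<times> exponents I m)"
    using assms(2) by (rule inj_combinator)
  have mon: "monomial (insert b I) (\<alpha>(b := t)) y = monomial I \<alpha> y * y b ^ t" for \<alpha> t
  proof -
    have "(\<Prod>x\<in>I. y x ^ (if x = b then t else \<alpha> x)) = (\<Prod>x\<in>I. y x ^ \<alpha> x)"
      using assms(2) by (intro prod.cong) auto
    then show ?thesis using assms by (simp add: monomial_def)
  qed
  show ?thesis
    unfolding PiE_insert_eq
    by (subst sum.reindex[OF inj])
      (simp add: mon sum.cartesian_product sum_distrib_right mult.assoc case_prod_unfold)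
qed

text \<open>With the other coordinates frozen, a polynomial in one variable has infinitely many
  roots, so all its coefficients vanish; these are combinations in fewer variables.\<close>

lemma monomial_combination_vanishing_on_infinite_box:
  assumes "finite I"
    and "\<And>b. b \<in> I \<Longrightarrow> infinite (A b)"
    and "\<And>y. (\<forall>b\<in>I. y b \<in> A b) \<Longrightarrow> (\<Sum>\<alpha>\<in>exponents I m. c \<alpha> * monomial I \<alpha> y) = 0"
    and "\<alpha> \<in> exponents I m"
  shows "c \<alpha> = 0"
  using assms
proof (induction I arbitrary: c \<alpha> rule: finite_induct)
  case empty
  then show ?case by (simp add: monomial_def)
next
  case (insert b I)
  note expand = monomial_combination_insert[OF insert.hyps, where c = c and m = m]
  have IH: "(\<Sum>\<alpha>\<in>exponents I m. c (\<alpha>(b := t)) * monomial I \<alpha> y) = 0"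
    if "\<forall>x\<in>I. y x \<in> A x" "t \<le> m" for y t
  proof (rule ccontr)
    assume nz: "\<not> ?thesis"
    define C where "C t = (\<Sum>\<alpha>\<in>exponents I m. c (\<alpha>(b := t)) * monomial I \<alpha> y)" for t
    have "finite {z. (\<Sum>t\<le>m. C t * z ^ t) = 0}"
      using nz that(2) unfolding polyfun_finite_roots C_def by blast
    moreover have "A b \<subseteq> {z. (\<Sum>t\<le>m. C t * z ^ t) = 0}"
    proof
      fix z assume z: "z \<in> A b"
      define y' where "y' = y(b := z)"
      have "monomial I \<alpha> y' = monomial I \<alpha> y" for \<alpha>
        using insert.hyps(2) by (auto simp: monomial_def y'_def intro!: prod.cong)
      moreover have "\<forall>x\<in>insert b I. y' x \<in> A x"
        using that z by (auto simp: y'_def)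
      ultimately show "z \<in> {z. (\<Sum>t\<le>m. C t * z ^ t) = 0}"
        using insert.prems(2)[of y'] unfolding expand C_def by (simp add: y'_def)
    qed
    ultimately show False using insert.prems(1)[of b] finite_subset by blast
  qed
  have \<alpha>: "\<alpha> b \<le> m" "\<alpha>(b := undefined) \<in> exponents I m" "\<alpha> = (\<alpha>(b := undefined))(b := \<alpha> b)"
    using insert.prems(3) insert.hyps(2) by (auto simp: PiE_def extensional_def Pi_def)
  have "c ((\<alpha>(b := undefined))(b := \<alpha> b)) = 0"
    by (rule insert.IH[where c = "\<lambda>\<beta>. c (\<beta>(b := \<alpha> b))"])
      (use insert.prems(1) IH \<alpha> in auto)
  then show ?case by simp
qed

text \<open>An open set contains a box, whose sides are infinite; the coordinates outside
  \<open>I\<close> stay at those of \<open>y0\<close>.\<close>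

lemma inner_monomial_combination_vanishing_on_open:
  fixes U :: "'a::euclidean_space set"
  assumes I: "I \<subseteq> Basis" and "open U" "y0 \<in> U"
    and van: "\<And>y. y \<in> U \<Longrightarrow> (\<Sum>\<alpha>\<in>exponents I m. c \<alpha> * monomial I \<alpha> ((\<bullet>) y)) = 0"
    and "\<alpha> \<in> exponents I m"
  shows "c \<alpha> = 0"
proof -
  obtain a b where ab: "box a b \<subseteq> U" "y0 \<in> box a b" "\<forall>i\<in>Basis. a \<bullet> i < b \<bullet> i"
    using open_contains_box[OF \<open>open U\<close> \<open>y0 \<in> U\<close>] .
  have fin: "finite I" using I finite_Basis finite_subset by blast
  show ?thesis
  proof (rule monomial_combination_vanishing_on_infinite_box[OF fin])
    show "infinite {a \<bullet> i<..<b \<bullet> i}" if "i \<in> I" for i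
      using ab(3) I that by (intro infinite_Ioo) auto
    fix y assume y: "\<forall>i\<in>I. y i \<in> {a \<bullet> i<..<b \<bullet> i}"
    define z where "z = (\<Sum>i\<in>Basis. (if i \<in> I then y i else y0 \<bullet> i) *\<^sub>R i)"
    have zi: "z \<bullet> i = (if i \<in> I then y i else y0 \<bullet> i)" if "i \<in> Basis" for i
      unfolding z_def using that by (rule inner_sum_left_Basis)
    have "z \<in> box a b"
      using y ab(2) by (auto simp: box_def zi)
    moreover have "monomial I \<beta> ((\<bullet>) z) = monomial I \<beta> y" for \<beta>
      unfolding monomial_def by (rule prod.cong) (use I zi in auto)
    ultimately show "(\<Sum>\<alpha>\<in>exponents I m. c \<alpha> * monomial I \<alpha> y) = 0"
      using van[of z] ab(1) by auto
  qed fact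
qed

text \<open>The identity is required only where the coordinates outside \<open>I\<close> vanish. On
  the matrices supported on the edges this keeps the number of variables at \<open>card I\<close>,
  on which the dimension count depends.\<close>

definition degree_bounded :: "'a::euclidean_space set \<Rightarrow> nat \<Rightarrow> ('a \<Rightarrow> real) \<Rightarrow> bool" where
  "degree_bounded I m f \<longleftrightarrow> (\<exists>c. \<forall>x. (\<forall>b\<in>Basis - I. x \<bullet> b = 0) \<longrightarrow>
     f x = (\<Sum>\<alpha>\<in>exponents I m. c \<alpha> * monomial I \<alpha> ((\<bullet>) x)))"

context
  fixes I :: "'a::euclidean_space set"
  assumes I: "I \<subseteq> Basis"
begin

lemma finite_coords: "finite I"
  using I finite_Basis finite_subset by blast

lemma finite_exponents: "finite (exponents I m)"
  by (intro finite_PiE finite_coords) auto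

lemma degree_bounded_monomial:
  assumes "\<And>b. b \<in> I \<Longrightarrow> \<alpha> b \<le> m"
  shows "degree_bounded I m (\<lambda>x. monomial I \<alpha> ((\<bullet>) x))"
proof -
  have "restrict \<alpha> I \<in> exponents I m" using assms by auto
  then have "(\<Sum>\<beta>\<in>exponents I m. of_bool (\<beta> = restrict \<alpha> I) * monomial I \<beta> y)
      = monomial I (restrict \<alpha> I) y" for y
    using finite_exponents by (simp add: of_bool_def if_distrib[of "\<lambda>c. c * _"] sum.delta cong: if_cong)
  moreover have "monomial I (restrict \<alpha> I) y = monomial I \<alpha> y" for y
    by (simp add: monomial_def)
  ultimately show ?thesis unfolding degree_bounded_def
    by (intro exI[of _ "\<lambda>\<beta>. of_bool (\<beta> = restrict \<alpha> I)"]) auto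
qed

lemma degree_bounded_add:
  assumes "degree_bounded I m f" "degree_bounded I m g"
  shows "degree_bounded I m (\<lambda>x. f x + g x)"
proof -
  obtain c d where
    "\<forall>x. (\<forall>b\<in>Basis - I. x \<bullet> b = 0) \<longrightarrow> f x = (\<Sum>\<alpha>\<in>exponents I m. c \<alpha> * monomial I \<alpha> ((\<bullet>) x))"
    "\<forall>x. (\<forall>b\<in>Basis - I. x \<bullet> b = 0) \<longrightarrow> g x = (\<Sum>\<alpha>\<in>exponents I m. d \<alpha> * monomial I \<alpha> ((\<bullet>) x))"
    using assms unfolding degree_bounded_def by blast
  then show ?thesis unfolding degree_bounded_def
    by (intro exI[of _ "\<lambda>\<alpha>. c \<alpha> + d \<alpha>"]) (simp add: sum.distrib algebra_simps)
qed

lemma degree_bounded_scale: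
  assumes "degree_bounded I m f"
  shows "degree_bounded I m (\<lambda>x. a * f x)"
proof -
  obtain c where
    "\<forall>x. (\<forall>b\<in>Basis - I. x \<bullet> b = 0) \<longrightarrow> f x = (\<Sum>\<alpha>\<in>exponents I m. c \<alpha> * monomial I \<alpha> ((\<bullet>) x))"
    using assms unfolding degree_bounded_def by blast
  then show ?thesis unfolding degree_bounded_def
    by (intro exI[of _ "\<lambda>\<alpha>. a * c \<alpha>"]) (simp add: sum_distrib_left mult.assoc)
qed

lemma degree_bounded_const: "degree_bounded I m (\<lambda>x. a)"
  using degree_bounded_scale[OF degree_bounded_monomial[of "\<lambda>_. 0" m], of a]
  by (simp add: monomial_def)

lemma degree_bounded_sum:
  assumes "\<And>j. j \<in> J \<Longrightarrow> degree_bounded I m (f j)"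
  shows "degree_bounded I m (\<lambda>x. \<Sum>j\<in>J. f j x)"
  using assms
proof (induction J rule: infinite_finite_induct)
  case (insert j J)
  then show ?case using degree_bounded_add by simp
qed (simp_all add: degree_bounded_const)

lemma degree_bounded_cong:
  assumes "degree_bounded I m f" "\<And>x. (\<forall>b\<in>Basis - I. x \<bullet> b = 0) \<Longrightarrow> g x = f x"
  shows "degree_bounded I m g"
  using assms unfolding degree_bounded_def by auto

lemma degree_bounded_mult:
  assumes "degree_bounded I m f" "degree_bounded I n g"
  shows "degree_bounded I (m + n) (\<lambda>x. f x * g x)"
proof -
  obtain c d where
    f: "\<And>x. (\<forall>b\<in>Basis - I. x \<bullet> b = 0) \<Longrightarrow> f x = (\<Sum>\<alpha>\<in>exponents I m. c \<alpha> * monomial I \<alpha> ((\<bullet>) x))"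
    and g: "\<And>x. (\<forall>b\<in>Basis - I. x \<bullet> b = 0) \<Longrightarrow> g x = (\<Sum>\<alpha>\<in>exponents I n. d \<alpha> * monomial I \<alpha> ((\<bullet>) x))"
    using assms unfolding degree_bounded_def by blast
  have "degree_bounded I (m + n) (\<lambda>x. \<Sum>\<alpha>\<in>exponents I m. \<Sum>\<beta>\<in>exponents I n.
      (c \<alpha> * d \<beta>) * monomial I (\<lambda>b. \<alpha> b + \<beta> b) ((\<bullet>) x))"
    by (intro degree_bounded_sum degree_bounded_scale degree_bounded_monomial) (auto intro!: add_mono)
  then show ?thesis
  proof (rule degree_bounded_cong)
    fix x :: 'a assume x: "\<forall>b\<in>Basis - I. x \<bullet> b = 0"
    show "f x * g x = (\<Sum>\<alpha>\<in>exponents I m. \<Sum>\<beta>\<in>exponents I n.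
      (c \<alpha> * d \<beta>) * monomial I (\<lambda>b. \<alpha> b + \<beta> b) ((\<bullet>) x))"
      unfolding f[OF x] g[OF x] sum_product
      by (intro sum.cong) (auto simp: monomial_def power_add prod.distrib algebra_simps)
  qed
qed

lemma degree_bounded_mono:
  assumes "degree_bounded I m f" "m \<le> n"
  shows "degree_bounded I n f"
  using degree_bounded_mult[OF assms(1) degree_bounded_const[of "n - m" 1]] assms(2) by simp

lemma degree_bounded_power:
  assumes "degree_bounded I m f"
  shows "degree_bounded I (m * k) (\<lambda>x. f x ^ k)"
  by (induction k) (use degree_bounded_const degree_bounded_mult[OF assms] in auto)

lemma degree_bounded_prod:
  assumes "\<And>j. j \<in> J \<Longrightarrow> degree_bounded I m (f j)"
  shows "degree_bounded I (m * card J) (\<lambda>x. \<Prod>j\<in>J. f j x)"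
  using assms
proof (induction J rule: infinite_finite_induct)
  case (insert j J)
  then show ?case using degree_bounded_mult[of m "f j"] by simp
qed (simp_all add: degree_bounded_const)

lemma degree_bounded_coord:
  assumes "b \<in> I" "m \<ge> 1"
  shows "degree_bounded I m (\<lambda>x. x \<bullet> b)"
proof -
  have "monomial I (\<lambda>i. of_bool (i = b)) ((\<bullet>) x) = x \<bullet> b" for x
  proof -
    have "monomial I (\<lambda>i. of_bool (i = b)) ((\<bullet>) x) = (\<Prod>i\<in>I. if i = b then x \<bullet> i else 1)"
      unfolding monomial_def by (rule prod.cong) auto
    then show ?thesis using assms finite_coords by simp
  qed
  moreover have "degree_bounded I m (\<lambda>x. monomial I (\<lambda>i. of_bool (i = b)) ((\<bullet>) x))"
    using assms by (intro degree_bounded_monomial) auto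
  ultimately show ?thesis by simp
qed

lemma degree_bounded_polynomial:
  assumes "real_polynomial_function f"
  shows "\<exists>m. degree_bounded I m f"
  using assms
proof (induction rule: real_polynomial_function.induct)
  case (linear f)
  have "degree_bounded I 1 (\<lambda>x. \<Sum>b\<in>I. f b * (x \<bullet> b))"
    by (intro degree_bounded_sum degree_bounded_scale degree_bounded_coord) auto
  then have "degree_bounded I 1 f"
  proof (rule degree_bounded_cong)
    fix x :: 'a assume x: "\<forall>b\<in>Basis - I. x \<bullet> b = 0"
    interpret bounded_linear f by fact
    have "f x = f (\<Sum>b\<in>Basis. (x \<bullet> b) *\<^sub>R b)" by (simp add: euclidean_representation)
    also have "\<dots> = (\<Sum>b\<in>Basis. f b * (x \<bullet> b))" by (simp add: sum scaleR mult.commute)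
    also have "\<dots> = (\<Sum>b\<in>I. f b * (x \<bullet> b))"
      using I x by (intro sum.mono_neutral_right) auto
    finally show "f x = (\<Sum>b\<in>I. f b * (x \<bullet> b))" .
  qed
  then show ?case by blast
next
  case (const c)
  then show ?case using degree_bounded_const by blast
next
  case (add f g)
  then obtain m n where "degree_bounded I m f" "degree_bounded I n g" by blast
  then have "degree_bounded I (max m n) f" "degree_bounded I (max m n) g"
    using degree_bounded_mono by (meson max.cobounded1 max.cobounded2)+
  then show ?case using degree_bounded_add by blast
next
  case (mult f g)
  then show ?case using degree_bounded_mult by blast
qed

end

section \<open>Simultaneous non-zeros of polynomials near a point\<close>

lemma finite_polynomial_zeros_on_line:
  fixes f :: "'a::real_normed_vector \<Rightarrow> real"
  assumes "real_polynomial_function f" "f (x + s *\<^sub>R v) \<noteq> 0"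
  shows "finite {t. f (x + t *\<^sub>R v) = 0}"
proof -
  have "polynomial_function (\<lambda>t::real. x + t *\<^sub>R v)"
    by (intro polynomial_function_add polynomial_function_const polynomial_function_bounded_linear)
      (auto intro: bounded_linear_scaleR_left)
  then have "real_polynomial_function (\<lambda>t. f (x + t *\<^sub>R v))"
    using real_polynomial_function_compose[OF _ assms(1)] by (simp add: o_def)
  then obtain a n where an: "(\<lambda>t. f (x + t *\<^sub>R v)) = (\<lambda>t. \<Sum>i\<le>n. a i * t ^ i)"
    unfolding real_polynomial_function_iff_sum by blast
  then have eq: "f (x + t *\<^sub>R v) = (\<Sum>i\<le>n. a i * t ^ i)" for t
    by (rule fun_cong)
  have "\<exists>k\<le>n. a k \<noteq> 0"
  proof (rule ccontr)
    assume "\<not> ?thesis"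
    then have "(\<Sum>i\<le>n. a i * s ^ i) = 0" by (intro sum.neutral) auto
    then show False using assms(2) eq by simp
  qed
  then show ?thesis unfolding eq polyfun_finite_roots by blast
qed

text \<open>On the line from \<open>x\<close> to \<open>y\<close> each of the two polynomials has
  finitely many zeros, while infinitely many parameters near 0 keep the point inside the ball. So a
  non-zero of \<open>g\<close> anywhere in \<open>W\<close> can be moved next to
  \<open>x\<close>.\<close>

lemma polynomials_common_nonzero:
  fixes f g :: "'a::real_normed_vector \<Rightarrow> real"
  assumes f: "real_polynomial_function f" and g: "real_polynomial_function g"
    and W: "subspace W" and x: "x \<in> W" "x \<in> ball x0 r" "f x \<noteq> 0" and y: "y \<in> W" "g y \<noteq> 0"
  shows "\<exists>z\<in>W \<inter> ball x0 r. f z \<noteq> 0 \<and> g z \<noteq> 0"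
proof -
  define v where "v = y - x"
  have "finite {t. f (x + t *\<^sub>R v) = 0}" "finite {t. g (x + t *\<^sub>R v) = 0}"
    using finite_polynomial_zeros_on_line[OF f, of x 0 v] finite_polynomial_zeros_on_line[OF g, of x
        1 v] x y
    by (auto simp: v_def)
  then have fin: "finite ({t. f (x + t *\<^sub>R v) = 0} \<union> {t. g (x + t *\<^sub>R v) = 0})" by blast
  have "open ((\<lambda>t. x + t *\<^sub>R v) -` ball x0 r)"
    by (intro open_vimage continuous_intros open_ball)
  moreover have "0 \<in> (\<lambda>t. x + t *\<^sub>R v) -` ball x0 r" using x by simp
  ultimately have "infinite ((\<lambda>t. x + t *\<^sub>R v) -` ball x0 r)"
    by (metis empty_iff finite_imp_not_open)
  then have "\<not> (\<lambda>t. x + t *\<^sub>R v) -` ball x0 r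
      \<subseteq> {t. f (x + t *\<^sub>R v) = 0} \<union> {t. g (x + t *\<^sub>R v) = 0}"
    using fin finite_subset by blast
  then obtain t where t: "x + t *\<^sub>R v \<in> ball x0 r" "f (x + t *\<^sub>R v) \<noteq> 0" "g (x + t *\<^sub>R v) \<noteq> 0"
    unfolding subset_iff Un_iff mem_Collect_eq vimage_eq by blast
  moreover have "x + t *\<^sub>R v \<in> W"
    using W x y unfolding v_def by (intro subspace_add subspace_scale subspace_diff)
  ultimately show ?thesis by blast
qed

text \<open>Merges non-zeros found at unrelated points of \<open>W\<close> into a single point of
  the ball, the place where \<open>W\<close> is later known to lie in the parameter space.\<close>

lemma polynomial_family_common_nonzero:
  fixes h :: "'i \<Rightarrow> 'a::real_normed_vector \<Rightarrow> real"
  assumes "finite J" "\<And>j. j \<in> J \<Longrightarrow> real_polynomial_function (h j)"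
    and W: "subspace W" and ball: "x0 \<in> W" "r > 0"
    and "\<And>j. j \<in> J \<Longrightarrow> \<exists>x\<in>W. h j x \<noteq> 0"
  shows "\<exists>z\<in>W \<inter> ball x0 r. (\<Prod>j\<in>J. h j z) \<noteq> 0"
  using assms(1,2,6)
proof (induction J rule: finite_induct)
  case empty
  then show ?case using ball by (intro bexI[of _ x0]) auto
next
  case (insert j J)
  then obtain x where "x \<in> W" "x \<in> ball x0 r" "(\<Prod>j\<in>J. h j x) \<noteq> 0" by auto
  moreover obtain y where "y \<in> W" "h j y \<noteq> 0" using insert.prems by blast
  moreover have "real_polynomial_function (\<lambda>x. \<Prod>j\<in>J. h j x)"
    using insert by (intro real_polynomial_function_prod) auto
  ultimately have "\<exists>z\<in>W \<inter> ball x0 r. (\<Prod>j\<in>J. h j z) \<noteq> 0 \<and> h j z \<noteq> 0"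
    using polynomials_common_nonzero[OF _ _ W] insert.prems(1)[of j] by blast
  then show ?case using insert.hyps by auto
qed

text \<open>
  Dimension count: with all exponents at most \<open>k\<close> there are \<open>(k + 1) ^ card J\<close> monomials in the
  \<open>F j\<close>; cleared of denominators they lie in a space of dimension \<open>O(k ^ card I)\<close>.
\<close>

lemma rational_functions_algebraically_dependent:
  fixes F N :: "'j \<Rightarrow> 'a::euclidean_space \<Rightarrow> real"
  assumes I: "I \<subseteq> Basis" and X: "X \<subseteq> {x. \<forall>b\<in>Basis - I. x \<bullet> b = 0}"
    and J: "finite J" "card I < card J"
    and q: "real_polynomial_function q" "\<And>x. x \<in> X \<Longrightarrow> q x \<noteq> 0"
    and N: "\<And>j. j \<in> J \<Longrightarrow> real_polynomial_function (N j)"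
    and F: "\<And>j x. j \<in> J \<Longrightarrow> x \<in> X \<Longrightarrow> q x * F j x = N j x"
  obtains k c \<gamma> where "\<gamma> \<in> exponents J k" "c \<gamma> \<noteq> (0::real)"
    "\<And>x. x \<in> X \<Longrightarrow> (\<Sum>\<gamma>\<in>exponents J k. c \<gamma> * monomial J \<gamma> (\<lambda>j. F j x)) = 0"
proof -
  obtain r0 where r0: "degree_bounded I r0 q"
    using degree_bounded_polynomial[OF I q(1)] by blast
  have "\<exists>m. \<forall>j\<in>J. degree_bounded I (m j) (N j)"
    by (rule bchoice) (use degree_bounded_polynomial[OF I] N in blast)
  then obtain m where m: "\<And>j. j \<in> J \<Longrightarrow> degree_bounded I (m j) (N j)" by blast
  define r where "r = r0 + (\<Sum>j\<in>J. m j)"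
  have rq: "degree_bounded I r q"
    by (rule degree_bounded_mono[OF I r0]) (simp add: r_def)
  have rN: "degree_bounded I r (N j)" if "j \<in> J" for j
    by (rule degree_bounded_mono[OF I m[OF that]])
      (use that J in \<open>simp add: r_def member_le_sum trans_le_add2\<close>)
  \<comment> \<open>\<open>M + 1\<close> is at most \<open>R * (k + 1)\<close>, so there are at most
    \<open>R ^ card I * (k + 1) ^ card I\<close> monomials in the parameters. Taking
    \<open>k = R ^ card I\<close> absorbs the constant and leaves
    \<open>k * (k + 1) ^ card I < (k + 1) ^ (card I + 1)\<close>.\<close>
  define R where "R = r * card J + 1"
  define k where "k = R ^ card I"
  define M where "M = r * k * card J"
  \<comment> \<open>On \<open>X\<close> this is the monomial \<open>\<gamma>\<close> in the
    \<open>F j\<close> times \<open>q x ^ (k * card J)\<close>; the same power of \<open>q\<close>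
    clears the denominators of all monomials at once.\<close>
  define P where "P \<gamma> x = (\<Prod>j\<in>J. N j x ^ \<gamma> j * q x ^ (k - \<gamma> j))" for \<gamma> x
  have "degree_bounded I M (P \<gamma>)" if "\<gamma> \<in> exponents J k" for \<gamma>
    unfolding P_def M_def
  proof (rule degree_bounded_prod[OF I])
    fix j assume j: "j \<in> J"
    then have "\<gamma> j \<le> k" using that by (auto simp: PiE_def Pi_def)
    then have "r * \<gamma> j + r * (k - \<gamma> j) = r * k"
      by (simp add: add_mult_distrib2[symmetric])
    then show "degree_bounded I (r * k) (\<lambda>x. N j x ^ \<gamma> j * q x ^ (k - \<gamma> j))"
      using degree_bounded_mult[OF I degree_bounded_power[OF I rN[OF j], of "\<gamma> j"]
          degree_bounded_power[OF I rq, of "k - \<gamma> j"]] by simp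
  qed
  then have "\<exists>a. \<forall>\<gamma>\<in>exponents J k. \<forall>x. (\<forall>b\<in>Basis - I. x \<bullet> b = 0) \<longrightarrow>
      P \<gamma> x = (\<Sum>\<alpha>\<in>exponents I M. a \<gamma> \<alpha> * monomial I \<alpha> ((\<bullet>) x))"
    unfolding degree_bounded_def by (intro bchoice) blast
  then obtain a where a: "\<And>\<gamma> x. \<gamma> \<in> exponents J k \<Longrightarrow> (\<forall>b\<in>Basis - I. x \<bullet> b = 0) \<Longrightarrow>
      P \<gamma> x = (\<Sum>\<alpha>\<in>exponents I M. a \<gamma> \<alpha> * monomial I \<alpha> ((\<bullet>) x))" by blast
  have "M + 1 \<le> R * (k + 1)"
    by (simp add: M_def R_def algebra_simps)
  then have "(M + 1) ^ card I \<le> (R * (k + 1)) ^ card I"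
    by (intro power_mono) auto
  also have "\<dots> = k * (k + 1) ^ card I" by (simp only: power_mult_distrib k_def[symmetric])
  also have "\<dots> < (k + 1) ^ (card I + 1)" by simp
  also have "\<dots> \<le> (k + 1) ^ card J" using J by (intro power_increasing) auto
  finally have "card (exponents I M) < card (exponents J k)"
    using finite_coords[OF I] J by (simp add: card_PiE)
  then obtain d \<gamma> where d: "\<gamma> \<in> exponents J k" "d \<gamma> \<noteq> 0"
    "\<And>\<alpha>. \<alpha> \<in> exponents I M \<Longrightarrow> (\<Sum>\<gamma>\<in>exponents J k. d \<gamma> * a \<gamma> \<alpha>) = 0"
    using homogeneous_system_nontrivial_solution[of "exponents I M" "exponents J k" a]
      finite_exponents[OF I] finite_PiE[of J "\<lambda>_. {..k}"] J(1) by auto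
  show thesis
  proof (rule that[where k = k and c = d and \<gamma> = \<gamma>, OF d(1,2)])
    fix x assume x: "x \<in> X"
    have "q x ^ (k * card J) * (\<Sum>\<gamma>\<in>exponents J k. d \<gamma> * monomial J \<gamma> (\<lambda>j. F j x))
        = (\<Sum>\<gamma>\<in>exponents J k. d \<gamma> * P \<gamma> x)"
    proof -
      have "q x ^ (k * card J) * monomial J \<gamma> (\<lambda>j. F j x) = P \<gamma> x" if "\<gamma> \<in> exponents J k" for \<gamma>
      proof -
        have "q x ^ k * F j x ^ \<gamma> j = N j x ^ \<gamma> j * q x ^ (k - \<gamma> j)" if j: "j \<in> J" for j
        proof -
          have "\<gamma> j \<le> k" using \<open>\<gamma> \<in> exponents J k\<close> j by (auto simp: PiE_def Pi_def)
          then have "q x ^ k = q x ^ \<gamma> j * q x ^ (k - \<gamma> j)" by (simp add: power_add[symmetric])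
          then show ?thesis by (simp add: F[OF j x, symmetric] power_mult_distrib algebra_simps)
        qed
        then have "(\<Prod>j\<in>J. q x ^ k * F j x ^ \<gamma> j) = P \<gamma> x"
          unfolding P_def by (rule prod.cong[OF refl])
        then show ?thesis by (simp add: prod.distrib monomial_def power_mult)
      qed
      then show ?thesis by (simp add: sum_distrib_left mult.left_commute)
    qed
    also have "\<dots> = (\<Sum>\<gamma>\<in>exponents J k. \<Sum>\<alpha>\<in>exponents I M. d \<gamma> * a \<gamma> \<alpha> * monomial I \<alpha> ((\<bullet>) x))"
      using X x by (intro sum.cong refl) (subst a, auto simp: sum_distrib_left mult.assoc)
    also have "\<dots> = (\<Sum>\<alpha>\<in>exponents I M. (\<Sum>\<gamma>\<in>exponents J k. d \<gamma> * a \<gamma> \<alpha>) * monomial I \<alpha> ((\<bullet>) x))"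
      by (subst sum.swap) (simp add: sum_distrib_right)
    also have "\<dots> = 0" using d(3) by simp
    finally show "(\<Sum>\<gamma>\<in>exponents J k. d \<gamma> * monomial J \<gamma> (\<lambda>j. F j x)) = 0"
      using q(2)[OF x] by simp
  qed
qed

lemma real_polynomial_function_imp_continuous_on:
  "real_polynomial_function f \<Longrightarrow> continuous_on S f"
  using continuous_on_polymonial_function real_polynomial_function_eq by blast

section \<open>Finite fibres from an injective derivative\<close>

context
  fixes \<phi> :: "'a::euclidean_space \<Rightarrow> 'b::euclidean_space"
    and \<phi>' :: "'a \<Rightarrow> 'b" and I W X :: "'a set" and q :: "'a \<Rightarrow> real" and n :: "'b \<Rightarrow> 'a \<Rightarrow> real"
    and x0 :: 'a and r :: real
  assumes I: "I \<subseteq> Basis"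
    and W: "W = {x. \<forall>b\<in>Basis - I. x \<bullet> b = 0}"
    and X: "X \<subseteq> W" "W \<inter> ball x0 r \<subseteq> X" "x0 \<in> W" "r > 0"
    and q: "real_polynomial_function q" "\<And>x. x \<in> X \<Longrightarrow> q x \<noteq> 0"
    and n: "\<And>b. b \<in> Basis \<Longrightarrow> real_polynomial_function (n b)"
    and qn: "\<And>x b. x \<in> X \<Longrightarrow> b \<in> Basis \<Longrightarrow> q x * (\<phi> x \<bullet> b) = n b x"
    and deriv: "(\<phi> has_derivative \<phi>') (at x0)"
    and inj: "\<And>v. v \<in> W \<Longrightarrow> \<phi>' v = 0 \<Longrightarrow> v = 0"
begin

lemma subspace_W: "subspace W"
  unfolding W by (auto simp: subspace_def inner_add_left)

text \<open>
  With a linear left inverse \<open>L\<close> of \<open>\<phi>'\<close> on \<open>W\<close>, the map \<open>L \<circ> \<phi>\<close> has open image in \<open>W\<close>; to stay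
  inside one type it is padded by the identity on the orthogonal complement of \<open>W\<close>.
\<close>

lemma left_inverse_composition_not_annihilated:
  assumes L: "linear L" "\<And>v. v \<in> W \<Longrightarrow> L (\<phi>' v) = v"
    and c: "\<alpha> \<in> exponents I k" "c \<alpha> \<noteq> 0"
  shows "\<exists>x\<in>W \<inter> ball x0 r. (\<Sum>\<alpha>\<in>exponents I k. c \<alpha> * monomial I \<alpha> (\<lambda>b. L (\<phi> x) \<bullet> b)) \<noteq> 0"
proof (rule ccontr)
  assume "\<not> ?thesis"
  then have van: "(\<Sum>\<alpha>\<in>exponents I k. c \<alpha> * monomial I \<alpha> (\<lambda>b. L (\<phi> x) \<bullet> b)) = 0"
    if "x \<in> W \<inter> ball x0 r" for x using that by blast
  define \<pi> where "\<pi> z = (\<Sum>b\<in>I. (z \<bullet> b) *\<^sub>R b)" for z :: 'a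
  have blpi: "bounded_linear \<pi>"
    unfolding \<pi>_def by (intro bounded_linear_sum bounded_linear_scaleR_const bounded_linear_inner_left)
  have pi_b: "\<pi> z \<bullet> b = (if b \<in> I then z \<bullet> b else 0)" if "b \<in> Basis" for z b
  proof -
    have "\<pi> z \<bullet> b = (\<Sum>i\<in>I. if i = b then z \<bullet> i else 0)"
      unfolding \<pi>_def inner_sum_left by (rule sum.cong) (use I that in \<open>auto simp: inner_Basis\<close>)
    then show ?thesis using finite_coords[OF I] by simp
  qed
  have piW: "\<pi> z \<in> W" for z unfolding W using pi_b by auto
  have pi_id: "\<pi> z = z" if "z \<in> W" for z
    by (rule euclidean_eqI) (use that W pi_b in auto)
  define \<Psi> where "\<Psi> z = L (\<phi> (\<pi> z)) + (z - \<pi> z)" for z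
  define T where "T = \<pi> -` ball x0 r"
  have contpi: "continuous_on A \<pi>" for A
    using blpi by (simp add: linear_continuous_on)
  have "open T" unfolding T_def by (intro open_vimage open_ball contpi)
  have "x0 \<in> T" unfolding T_def using X pi_id by simp
  have piT: "\<pi> z \<in> W \<inter> ball x0 r" if "z \<in> T" for z
    using that piW by (simp add: T_def)
  have blL: "bounded_linear L" using L(1) linear_conv_bounded_linear by blast
  have phi_eq: "\<phi> x = (\<Sum>b\<in>Basis. (n b x / q x) *\<^sub>R b)" if "x \<in> X" for x
  proof -
    have "n b x / q x = \<phi> x \<bullet> b" if "b \<in> Basis" for b
      using qn[OF \<open>x \<in> X\<close> that] q(2)[OF \<open>x \<in> X\<close>] by (simp add: field_simps)
    then show ?thesis by (simp add: euclidean_representation)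
  qed
  have "continuous_on X (\<lambda>x. \<Sum>b\<in>Basis. (n b x / q x) *\<^sub>R b)"
    using q n by (intro continuous_intros) (auto intro: real_polynomial_function_imp_continuous_on)
  then have "continuous_on X \<phi>" using phi_eq by (simp cong: continuous_on_cong)
  then have "continuous_on T (\<lambda>z. \<phi> (\<pi> z))"
    by (rule continuous_on_compose2[OF _ contpi]) (use piT X in auto)
  then have cont: "continuous_on T \<Psi>"
    unfolding \<Psi>_def
    by (intro continuous_intros contpi bounded_linear.continuous_on[OF blL])
  have "(\<pi> has_derivative \<pi>) (at x0)" using blpi by (rule bounded_linear_imp_has_derivative)
  moreover have "(\<phi> has_derivative \<phi>') (at (\<pi> x0))" using deriv pi_id X by simp
  ultimately have "((\<lambda>z. \<phi> (\<pi> z)) has_derivative (\<lambda>v. \<phi>' (\<pi> v))) (at x0)"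
    using has_derivative_compose by blast
  then have "(\<Psi> has_derivative (\<lambda>v. L (\<phi>' (\<pi> v)) + (v - \<pi> v))) (at x0)"
    unfolding \<Psi>_def
    by (intro has_derivative_add has_derivative_diff has_derivative_ident
        bounded_linear.has_derivative[OF blL] bounded_linear_imp_has_derivative[OF blpi])
  then have der: "(\<Psi> has_derivative id) (at x0)"
    using L(2) piW by (simp add: id_def)
  \<comment> \<open>The derivative of \<open>\<Psi>\<close> is the identity, known at the single
    point \<open>x0\<close>; Sussmann's form of the open mapping theorem asks for that and for
    continuity on \<open>T\<close>.\<close>
  have "bounded_linear (id :: 'a \<Rightarrow> 'a)" by (simp add: id_def bounded_linear_ident)
  then have "\<Psi> x0 \<in> interior (\<Psi> ` T)"
    by (rule sussmann_open_mapping[OF \<open>open T\<close> cont \<open>x0 \<in> T\<close> der])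
      (use \<open>open T\<close> \<open>x0 \<in> T\<close> in \<open>simp_all add: interior_open\<close>)
  moreover have "(\<Sum>\<alpha>\<in>exponents I k. c \<alpha> * monomial I \<alpha> ((\<bullet>) y)) = 0"
    if "y \<in> interior (\<Psi> ` T)" for y
  proof -
    have "y \<in> \<Psi> ` T" using that interior_subset by blast
    then obtain z where z: "z \<in> T" "y = \<Psi> z" by blast
    have "y \<bullet> b = L (\<phi> (\<pi> z)) \<bullet> b" if "b \<in> I" for b
    proof -
      have "\<pi> z \<bullet> b = z \<bullet> b" using pi_b that I by auto
      then show ?thesis by (simp add: z \<Psi>_def inner_add_left inner_diff_left)
    qed
    then have "monomial I \<alpha> ((\<bullet>) y) = monomial I \<alpha> (\<lambda>b. L (\<phi> (\<pi> z)) \<bullet> b)" for \<alpha>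
      unfolding monomial_def by (intro prod.cong) auto
    then show ?thesis using van[OF piT[OF z(1)]] by simp
  qed
  ultimately have "c \<alpha> = 0"
    using inner_monomial_combination_vanishing_on_open[OF I open_interior, of "\<Psi> x0" "\<Psi> ` T" c k \<alpha>] c(1)
    by blast
  then show False using c(2) by simp
qed

text \<open>
  The junk index \<open>0 \<notin> Basis\<close> labels the coordinate \<open>x \<bullet> e\<close>, which joins the components of
  \<open>L (\<phi> x)\<close> in the algebraic relation.
\<close>

lemma coordinate_generically_finite_on_fibres:
  assumes e: "e \<in> I"
  shows "\<exists>h. real_polynomial_function h \<and> (\<exists>x\<in>W \<inter> ball x0 r. h x \<noteq> 0) \<and>
    (\<forall>x\<in>X. h x \<noteq> 0 \<longrightarrow> finite ((\<lambda>x'. x' \<bullet> e) ` {x' \<in> X. \<phi> x' = \<phi> x}))"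
proof -
  have lin: "linear \<phi>'" using deriv has_derivative_linear by blast
  have "inj_on \<phi>' W"
    using linear_inj_on_iff_eq_0[OF lin subspace_W] inj by blast
  then obtain L where L: "linear L" "\<And>v. v \<in> W \<Longrightarrow> L (\<phi>' v) = v"
    using linear_exists_left_inverse_on[OF lin subspace_W] by blast
  have fin: "finite I" using finite_coords[OF I] .
  have nz: "0 \<notin> I" using I nonzero_Basis by blast
  define F where "F j x = (if j = 0 then x \<bullet> e else L (\<phi> x) \<bullet> j)" for j x
  define N where "N j x = (if j = 0 then q x * (x \<bullet> e) else (\<Sum>i\<in>Basis. n i x * (L i \<bullet> j)))" for j x
  have Npoly: "real_polynomial_function (N j)" for j
  proof (cases "j = 0")
    case True
    have "real_polynomial_function (\<lambda>x. q x * (x \<bullet> e))"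
      by (intro real_polynomial_function.intros(4) real_polynomial_function.intros(1) q(1)
          bounded_linear_inner_left)
    moreover have "N j = (\<lambda>x. q x * (x \<bullet> e))" using True by (intro ext) (simp add: N_def)
    ultimately show ?thesis by simp
  next
    case False
    have "real_polynomial_function (\<lambda>x. \<Sum>i\<in>Basis. n i x * (L i \<bullet> j))"
      using n by (intro real_polynomial_function_sum real_polynomial_function.intros(4)
          real_polynomial_function.intros(2)) auto
    moreover have "N j = (\<lambda>x. \<Sum>i\<in>Basis. n i x * (L i \<bullet> j))"
      using False by (intro ext) (simp add: N_def)
    ultimately show ?thesis by simp
  qed
  have qF: "q x * F j x = N j x" if "x \<in> X" for x j
  proof (cases "j = 0")
    case False
    have "L (\<phi> x) = L (\<Sum>i\<in>Basis. (\<phi> x \<bullet> i) *\<^sub>R i)" by (simp add: euclidean_representation)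
    also have "\<dots> = (\<Sum>i\<in>Basis. (\<phi> x \<bullet> i) *\<^sub>R L i)"
      using L(1) by (simp add: linear_sum linear_scale)
    finally have "q x * (L (\<phi> x) \<bullet> j) = (\<Sum>i\<in>Basis. (q x * (\<phi> x \<bullet> i)) * (L i \<bullet> j))"
      by (simp add: inner_sum_left sum_distrib_left mult.assoc)
    also have "\<dots> = (\<Sum>i\<in>Basis. n i x * (L i \<bullet> j))"
      using qn[OF that] by simp
    finally show ?thesis using False by (simp add: F_def N_def)
  qed (simp add: F_def N_def)
  \<comment> \<open>These are \<open>card I + 1\<close> functions of \<open>card I\<close>
    variables, all rational with denominator \<open>q\<close>.\<close>
  obtain k c \<gamma> where c: "\<gamma> \<in> exponents (insert 0 I) k" "c \<gamma> \<noteq> (0::real)"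
    "\<And>x. x \<in> X \<Longrightarrow> (\<Sum>\<gamma>\<in>exponents (insert 0 I) k. c \<gamma> * monomial (insert 0 I) \<gamma> (\<lambda>j. F j x)) = 0"
    by (rule rational_functions_algebraically_dependent[of I X "insert 0 I" q N F])
      (use I X W fin nz q Npoly qF in auto)
  \<comment> \<open>The coefficient of \<open>(x \<bullet> e) ^ t\<close> in the relation. It
    depends on \<open>x\<close> only through \<open>\<phi> x\<close>, so all points of a fibre share
    one polynomial in the coordinate.\<close>
  define C where "C t x = (\<Sum>\<alpha>\<in>exponents I k. c (\<alpha>(0 := t)) * monomial I \<alpha> (\<lambda>b. L (\<phi> x) \<bullet> b))" for t x
  have monF: "monomial I \<alpha> (\<lambda>j. F j x) = monomial I \<alpha> (\<lambda>b. L (\<phi> x) \<bullet> b)" for \<alpha> x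
    unfolding monomial_def by (rule prod.cong) (use nz in \<open>auto simp: F_def\<close>)
  have rel: "(\<Sum>t\<le>k. C t x * (x \<bullet> e) ^ t) = 0" if "x \<in> X" for x
    using c(3)[OF that] unfolding monomial_combination_insert[OF fin nz] monF C_def
    by (simp add: F_def)
  \<comment> \<open>A power of the coordinate that carries a non-zero coefficient of the relation.
    The components of \<open>L (\<phi> x)\<close> satisfy no algebraic relation on the ball, so
    \<open>C t0\<close> is not identically zero there.\<close>
  define t0 where "t0 = \<gamma> 0"
  define \<alpha>0 where "\<alpha>0 = \<gamma>(0 := undefined)"
  have \<alpha>0: "t0 \<le> k" "\<alpha>0 \<in> exponents I k" "c (\<alpha>0(0 := t0)) \<noteq> 0"
    using c(1,2) nz unfolding t0_def \<alpha>0_def by (auto simp: PiE_def extensional_def Pi_def)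
  \<comment> \<open>On \<open>X\<close> this is \<open>C t0\<close> times
    \<open>q x ^ (k * card I)\<close>: a polynomial in the parameters with the same zeros
    there.\<close>
  define h where "h x = (\<Sum>\<alpha>\<in>exponents I k. c (\<alpha>(0 := t0)) * (\<Prod>b\<in>I. N b x ^ \<alpha> b * q x ^ (k - \<alpha> b)))"
      for x
  have hpoly: "real_polynomial_function h"
    unfolding h_def using fin Npoly q(1) finite_exponents[OF I]
    by (intro real_polynomial_function_sum real_polynomial_function_prod
        real_polynomial_function.intros(4)
        real_polynomial_function_power real_polynomial_function.intros(2)) auto
  have hC: "h x = q x ^ (k * card I) * C t0 x" if x: "x \<in> X" for x
  proof -
    have "(\<Prod>b\<in>I. N b x ^ \<alpha> b * q x ^ (k - \<alpha> b)) = q x ^ (k * card I) * monomial I \<alpha> (\<lambda>b. L (\<phi> x) \<bullet> b)"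
      if a: "\<alpha> \<in> exponents I k" for \<alpha>
    proof -
      have "N b x ^ \<alpha> b * q x ^ (k - \<alpha> b) = q x ^ k * F b x ^ \<alpha> b" if b: "b \<in> I" for b
      proof -
        have "\<alpha> b \<le> k" using a b by (auto simp: PiE_def Pi_def)
        then have "q x ^ k = q x ^ \<alpha> b * q x ^ (k - \<alpha> b)" by (simp add: power_add[symmetric])
        then show ?thesis by (simp add: qF[OF x, symmetric] power_mult_distrib algebra_simps)
      qed
      then have "(\<Prod>b\<in>I. N b x ^ \<alpha> b * q x ^ (k - \<alpha> b)) = (\<Prod>b\<in>I. q x ^ k * F b x ^ \<alpha> b)"
        by (rule prod.cong[OF refl])
      also have "\<dots> = q x ^ (k * card I) * monomial I \<alpha> (\<lambda>j. F j x)"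
        by (simp add: prod.distrib monomial_def power_mult)
      finally show ?thesis by (simp add: monF)
    qed
    then show ?thesis by (simp add: h_def C_def sum_distrib_left mult.left_commute)
  qed
  obtain z where z: "z \<in> W \<inter> ball x0 r" "C t0 z \<noteq> 0"
    using left_inverse_composition_not_annihilated[OF L \<alpha>0(2), of "\<lambda>\<alpha>. c (\<alpha>(0 := t0))"] \<alpha>0(3)
    unfolding C_def by blast
  then have "h z \<noteq> 0" using hC[of z] X(2) q(2)[of z] by auto
  then have "\<exists>x\<in>W \<inter> ball x0 r. h x \<noteq> 0" using z(1) by blast
  moreover have "finite ((\<lambda>x'. x' \<bullet> e) ` {x' \<in> X. \<phi> x' = \<phi> x})" if x: "x \<in> X" "h x \<noteq> 0" for x
  proof (rule finite_subset)
    show "(\<lambda>x'. x' \<bullet> e) ` {x' \<in> X. \<phi> x' = \<phi> x} \<subseteq> {s. (\<Sum>t\<le>k. C t x * s ^ t) = 0}"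
    proof safe
      fix x' assume "x' \<in> X" "\<phi> x' = \<phi> x"
      then show "(\<Sum>t\<le>k. C t x * (x' \<bullet> e) ^ t) = 0"
        using rel[of x'] by (simp add: C_def)
    qed
    have "C t0 x \<noteq> 0" using hC x by auto
    then show "finite {s. (\<Sum>t\<le>k. C t x * s ^ t) = 0}"
      unfolding polyfun_finite_roots using \<alpha>0(1) by blast
  qed
  ultimately show ?thesis using hpoly by blast
qed

text \<open>The product of the polynomials for the single coordinates defines the exceptional set.
  Off it each coordinate takes finitely many values on the fibre, and a point of \<open>X\<close> is
  determined by its coordinates in \<open>I\<close>.\<close>

lemma generically_finite_fibres: "generically X (\<lambda>x. finite {x' \<in> X. \<phi> x' = \<phi> x})"
proof -
  have fin: "finite I" using finite_coords[OF I] .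
  have "\<exists>h. \<forall>e\<in>I. real_polynomial_function (h e) \<and> (\<exists>x\<in>W \<inter> ball x0 r. h e x \<noteq> 0) \<and>
      (\<forall>x\<in>X. h e x \<noteq> 0 \<longrightarrow> finite ((\<lambda>x'. x' \<bullet> e) ` {x' \<in> X. \<phi> x' = \<phi> x}))"
    by (rule bchoice) (use coordinate_generically_finite_on_fibres in blast)
  then obtain h where h: "\<And>e. e \<in> I \<Longrightarrow> real_polynomial_function (h e)"
    "\<And>e. e \<in> I \<Longrightarrow> \<exists>x\<in>W \<inter> ball x0 r. h e x \<noteq> 0"
    "\<And>e x. e \<in> I \<Longrightarrow> x \<in> X \<Longrightarrow> h e x \<noteq> 0 \<Longrightarrow>
      finite ((\<lambda>x'. x' \<bullet> e) ` {x' \<in> X. \<phi> x' = \<phi> x})" by blast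
  define H where "H x = (\<Prod>e\<in>I. h e x)" for x
  have Hpoly: "real_polynomial_function H"
    unfolding H_def using fin h(1) by (intro real_polynomial_function_prod) auto
  have "\<exists>z\<in>W \<inter> ball x0 r. H z \<noteq> 0"
    unfolding H_def
    by (rule polynomial_family_common_nonzero[OF fin h(1) subspace_W]) (use X(3,4) h(2) in blast)+
  then have "\<exists>z\<in>X. H z \<noteq> 0" using X by blast
  then have "proper_algebraic_subset X {x \<in> X. H x = 0}"
    unfolding proper_algebraic_subset_def using Hpoly
    by (intro conjI exI[of _ "{H}"]) auto
  moreover have "finite {x' \<in> X. \<phi> x' = \<phi> x}" if x: "x \<in> X" "H x \<noteq> 0" for x
  proof -
    let ?S = "{x' \<in> X. \<phi> x' = \<phi> x}"
    let ?c = "\<lambda>x'. \<lambda>b\<in>I. x' \<bullet> b"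
    have "?c ` ?S \<subseteq> (\<Pi>\<^sub>E e\<in>I. (\<lambda>x'. x' \<bullet> e) ` ?S)" by auto
    moreover have "finite (\<Pi>\<^sub>E e\<in>I. (\<lambda>x'. x' \<bullet> e) ` ?S)"
      using h(3) x fin by (intro finite_PiE) (auto simp: H_def)
    ultimately have "finite (?c ` ?S)" using finite_subset by blast
    moreover have "inj_on ?c ?S"
    proof (rule inj_onI)
      fix y z assume yz: "y \<in> ?S" "z \<in> ?S" "?c y = ?c z"
      show "y = z"
      proof (rule euclidean_eqI)
        fix b :: 'a assume b: "b \<in> Basis"
        show "y \<bullet> b = z \<bullet> b"
        proof (cases "b \<in> I")
          case True
          then show ?thesis using fun_cong[OF yz(3), of b] by simp
        next
          case False
          moreover have "y \<in> W" "z \<in> W" using yz(1,2) X(1) by auto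
          ultimately show ?thesis using b by (simp add: W)
        qed
      qed
    qed
    ultimately show ?thesis by (rule finite_imageD)
  qed
  ultimately show ?thesis unfolding generically_def by blast
qed

end

section \<open>Cumulants as rational functions of the parameters\<close>

text \<open>Take a polynomial p of least degree with p(f) v = 0 and a complex root z of it. If p is
  X - z times q, then q(f) v is non-zero by minimality and is killed by f - z. It lies in
  \<open>U\<close> as a combination of iterates of \<open>v\<close>.\<close>

lemma eigenvector_in_invariant_subspace:
  fixes f :: "complex^'N \<Rightarrow> complex^'N"
  assumes f: "Vector_Spaces.linear (*s) (*s) f"
    and U: "vec.subspace U" "\<And>u. u \<in> U \<Longrightarrow> f u \<in> U" and v: "v \<in> U" "v \<noteq> 0"
  obtains w z where "w \<in> U" "w \<noteq> 0" "f w = z *s w"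
proof -
  interpret f: Vector_Spaces.linear "(*s)" "(*s)" f by fact
  define P where "P k = (f ^^ k) v" for k
  have PU: "P k \<in> U" for k by (induction k) (use U v in \<open>auto simp: P_def\<close>)
  define act where "act n p = (\<Sum>k\<le>n. coeff p k *s P k)" for n :: nat and p :: "complex poly"
  have act_mono: "act n p = act (degree p) p" if "degree p \<le> n" for n p
    unfolding act_def by (rule sum.mono_neutral_right) (use that in \<open>auto simp: coeff_eq_0\<close>)
  \<comment> \<open>\<open>CARD('N) + 1\<close> iterates in dimension \<open>CARD('N)\<close> are
    dependent; the dependence is an annihilating polynomial.\<close>
  have "\<exists>d. (\<exists>k\<in>{..CARD('N)}. d k \<noteq> 0) \<and> (\<forall>x\<in>UNIV. (\<Sum>k\<in>{..CARD('N)}. d k * P k $ x) = 0)"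
    by (rule homogeneous_system_nontrivial_solution) auto
  then obtain d where d: "\<exists>k\<le>CARD('N). d k \<noteq> 0" "\<And>x. (\<Sum>k\<le>CARD('N). d k * P k $ x) = 0"
    by auto
  define p0 where "p0 = (\<Sum>k\<le>CARD('N). monom (d k) k)"
  have coeff_p0: "coeff p0 k = (if k \<le> CARD('N) then d k else 0)" for k
    by (simp add: p0_def coeff_sum sum.delta)
  have "degree p0 \<le> CARD('N)" by (rule degree_le) (simp add: coeff_p0)
  moreover have "act (CARD('N)) p0 = 0"
    using d(2) by (simp add: act_def coeff_p0 vec_eq_iff)
  ultimately have "act (degree p0) p0 = 0" using act_mono by metis
  moreover have "p0 \<noteq> 0" using d(1) coeff_p0 by (metis coeff_0)
  ultimately have ex: "\<exists>p. p \<noteq> 0 \<and> act (degree p) p = 0" by blast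
  define p where "p = (ARG_MIN degree p. p \<noteq> 0 \<and> act (degree p) p = 0)"
  have p: "p \<noteq> 0" "act (degree p) p = 0"
    and min: "\<And>q. q \<noteq> 0 \<Longrightarrow> act (degree q) q = 0 \<Longrightarrow> degree p \<le> degree q"
    using arg_min_nat_lemma[of "\<lambda>p. p \<noteq> 0 \<and> act (degree p) p = 0" _ degree] ex
    unfolding p_def by blast+
  have "degree p \<noteq> 0"
  proof
    assume "degree p = 0"
    then have "coeff p 0 *s v = 0" using p(2) by (simp add: act_def P_def)
    moreover have "coeff p 0 \<noteq> 0" using p(1) \<open>degree p = 0\<close> leading_coeff_neq_0 by metis
    ultimately show False using v(2) by simp
  qed
  then obtain z where "poly p z = 0"
    using fundamental_theorem_of_algebra[of p] by (auto simp: constant_degree)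
  then obtain q where q: "p = [:- z, 1:] * q" by (metis dvd_def poly_eq_0_iff_dvd)
  then have "q \<noteq> 0" using p(1) by auto
  then have "degree p = degree [:- z, 1:] + degree q" unfolding q by (intro degree_mult_eq) auto
  then have dq: "degree p = Suc (degree q)" by simp
  define w where "w = act (degree q) q"
  have "w \<in> U" unfolding w_def act_def
    by (intro vec.subspace_sum vec.subspace_scale U PU)
  moreover have "w \<noteq> 0" using min[OF \<open>q \<noteq> 0\<close>] dq by (auto simp: w_def)
  moreover have "f w = z *s w"
  proof -
    have "f w = (\<Sum>k\<le>degree q. coeff q k *s P (Suc k))"
      unfolding w_def act_def by (simp add: f.sum f.scale P_def)
    also have "\<dots> = (\<Sum>k\<le>degree p. coeff (pCons 0 q) k *s P k)"
      unfolding dq by (subst sum.atMost_Suc_shift) simp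
    finally have fw: "f w = (\<Sum>k\<le>degree p. coeff (pCons 0 q) k *s P k)" .
    have "z *s w = (\<Sum>k\<le>degree p. coeff (smult z q) k *s P k)"
      using act_mono[of q "degree p"] dq
      by (simp add: w_def act_def vec.scale_sum_right)
    then have "f w - z *s w = (\<Sum>k\<le>degree p. coeff (pCons 0 q - smult z q) k *s P k)"
      unfolding fw by (simp add: sum_subtractf vec.scale_left_diff_distrib)
    also have "pCons 0 q - smult z q = p" unfolding q by simp
    finally show ?thesis using p(2) by (simp add: act_def)
  qed
  ultimately show thesis by (rule that)
qed

text \<open>Eigenspaces of one map are invariant under the maps that commute with it. Starting from
  the fixed space of the composition, which contains \<open>v\<close>, three successive eigenspaces
  lead to a joint eigenvector in that space, on which the composition acts as
  \<open>a * b * c\<close>.\<close>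

lemma commuting_eigenvalues_product:
  fixes f g h :: "complex^'N \<Rightarrow> complex^'N"
  assumes lin: "Vector_Spaces.linear (*s) (*s) f" "Vector_Spaces.linear (*s) (*s) g"
      "Vector_Spaces.linear (*s) (*s) h"
    and comm: "\<And>x. f (g x) = g (f x)" "\<And>x. f (h x) = h (f x)" "\<And>x. g (h x) = h (g x)"
    and v: "f (g (h v)) = v" "v \<noteq> 0"
  obtains a b c w where "w \<noteq> 0" "f w = a *s w" "g w = b *s w" "h w = c *s w" "a * b * c = 1"
proof -
  interpret f: Vector_Spaces.linear "(*s)" "(*s)" f by fact
  interpret g: Vector_Spaces.linear "(*s)" "(*s)" g by fact
  interpret h: Vector_Spaces.linear "(*s)" "(*s)" h by fact
  note lins = f.add g.add h.add f.scale g.scale h.scale f.zero g.zero h.zero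
  define U where "U = {x. f (g (h x)) = x}"
  have "vec.subspace U" by (simp add: vec.subspace_def U_def lins)
  then obtain w1 a where w1: "w1 \<in> U" "w1 \<noteq> 0" "f w1 = a *s w1"
  proof (rule eigenvector_in_invariant_subspace[OF lin(1), of U v])
    show "f u \<in> U" if "u \<in> U" for u
      using that comm unfolding U_def mem_Collect_eq by metis
  qed (use v in \<open>auto simp: U_def\<close>)
  define U1 where "U1 = {x \<in> U. f x = a *s x}"
  have "vec.subspace U1"
    by (simp add: vec.subspace_def U1_def U_def lins vec.scale_right_distrib vec.scale_left_commute)
  then obtain w2 b where w2: "w2 \<in> U1" "w2 \<noteq> 0" "g w2 = b *s w2"
  proof (rule eigenvector_in_invariant_subspace[OF lin(2), of U1 w1])
    show "g u \<in> U1" if "u \<in> U1" for u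
      using that comm unfolding U_def U1_def mem_Collect_eq by (metis g.scale)
  qed (use w1 in \<open>auto simp: U_def U1_def\<close>)
  define U2 where "U2 = {x \<in> U1. g x = b *s x}"
  have "vec.subspace U2"
    by (simp add: vec.subspace_def U2_def U1_def U_def lins vec.scale_right_distrib
        vec.scale_left_commute)
  then obtain w c where w: "w \<in> U2" "w \<noteq> 0" "h w = c *s w"
  proof (rule eigenvector_in_invariant_subspace[OF lin(3), of U2 w2])
    show "h u \<in> U2" if "u \<in> U2" for u
      using that comm unfolding U_def U1_def U2_def mem_Collect_eq by (metis h.scale)
  qed (use w2 in \<open>auto simp: U_def U1_def U2_def\<close>)
  have fgw: "f w = a *s w" "g w = b *s w" "f (g (h w)) = w"
    using w(1) by (simp_all add: U2_def U1_def U_def)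
  have "f (g (h w)) = (a * b * c) *s w"
    unfolding w(3) g.scale fgw(2) f.scale fgw(1) by (simp add: mult_ac)
  then have "(a * b * c) *s w = w" using fgw(3) by simp
  then have "(a * b * c - 1) *s w = 0"
    by (simp only: vec.scale_left_diff_distrib vec.scale_one diff_self)
  then have "a * b * c - 1 = 0" using w(2) vec.scale_eq_0_iff by blast
  then have "a * b * c = 1" by simp
  then show thesis using that w by (simp add: U2_def U1_def)
qed

text \<open>Entry \<open>(i, j)\<close> of the product of \<open>A\<close>, \<open>S\<close> and the
  transpose of \<open>B\<close>; \<open>contract3\<close> is the analogous action of three matrices
  on the indices of a tensor. With the matrices as separate arguments, partial derivatives are again
  contractions.\<close>

definition contract2 :: "'n::finite matrix \<Rightarrow> 'n matrix \<Rightarrow> 'n matrix \<Rightarrow> 'n \<Rightarrow> 'n \<Rightarrow> real" where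
  "contract2 A B S i j = (\<Sum>l\<in>UNIV. \<Sum>m\<in>UNIV. A $ i $ l * B $ j $ m * S $ l $ m)"

definition contract3 ::
  "'n::finite matrix \<Rightarrow> 'n matrix \<Rightarrow> 'n matrix \<Rightarrow> 'n tensor \<Rightarrow> 'n \<Rightarrow> 'n \<Rightarrow> 'n \<Rightarrow> real" where
  "contract3 A B C T i j k =
     (\<Sum>l\<in>UNIV. \<Sum>m\<in>UNIV. \<Sum>q\<in>UNIV. A $ i $ l * B $ j $ m * C $ k $ q * T $ l $ m $ q)"

lemma sum_UNIV_pair: "(\<Sum>x\<in>UNIV. f x) = (\<Sum>a\<in>UNIV. \<Sum>b\<in>UNIV. f (a, b))"
  by (simp add: sum.cartesian_product UNIV_Times_UNIV[symmetric] del: UNIV_Times_UNIV)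

lemma kron_vec2: "((A \<otimes>\<^sub>K B) *v vec2 S) $ (i, j) = contract2 A B S i j"
  by (simp add: matrix_vector_mult_def kron_def vec2_def contract2_def sum_UNIV_pair)

lemma kron_vec3: "((A \<otimes>\<^sub>K B \<otimes>\<^sub>K C) *v vec3 T) $ (i, j, k) = contract3 A B C T i j k"
  by (simp add: matrix_vector_mult_def kron_def vec3_def contract3_def sum_UNIV_pair mult.assoc)

lemma vec2_unvec2 [simp]: "vec2 (unvec2 v) = v"
  by (simp add: vec2_def unvec2_def vec_eq_iff)

lemma vec3_unvec3 [simp]: "vec3 (unvec3 v) = v"
  by (simp add: vec3_def unvec3_def vec_eq_iff)

text \<open>Acting with \<open>A\<close> on one index at a time gives three commuting maps whose
  composition fixes the complexified tensor. In a joint eigenvector, a non-zero slice along one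
  index is an eigenvector of \<open>A\<close>, so all three eigenvalues have modulus below 1,
  against product 1.\<close>

lemma contract3_fixed_point_zero:
  fixes A :: "'n::finite matrix"
  assumes stable: "schur_stable A" and T: "\<And>i j k. T $ i $ j $ k = contract3 A A A T i j k"
  shows "T = 0"
proof (rule ccontr)
  assume "T \<noteq> 0"
  let ?c = complex_of_real
  define f :: "complex^('n \<times> 'n \<times> 'n) \<Rightarrow> complex^('n \<times> 'n \<times> 'n)"
    where "f x = (\<chi> r. \<Sum>l\<in>UNIV. ?c (A $ fst r $ l) * x $ (l, snd r))" for x
  define g :: "complex^('n \<times> 'n \<times> 'n) \<Rightarrow> complex^('n \<times> 'n \<times> 'n)"
    where "g x = (\<chi> r. \<Sum>l\<in>UNIV. ?c (A $ fst (snd r) $ l) * x $ (fst r, l, snd (snd r)))" for x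
  define h :: "complex^('n \<times> 'n \<times> 'n) \<Rightarrow> complex^('n \<times> 'n \<times> 'n)"
    where "h x = (\<chi> r. \<Sum>l\<in>UNIV. ?c (A $ snd (snd r) $ l) * x $ (fst r, fst (snd r), l))" for x
  define v :: "complex^('n \<times> 'n \<times> 'n)" where "v = (\<chi> r. ?c (T $ fst r $ fst (snd r) $ snd (snd r)))"
  have lin: "Vector_Spaces.linear (*s) (*s) f" "Vector_Spaces.linear (*s) (*s) g"
      "Vector_Spaces.linear (*s) (*s) h"
    by (unfold_locales; simp add: f_def g_def h_def vec_eq_iff algebra_simps sum.distrib
        sum_distrib_left)+
  have comm: "f (g x) = g (f x)" "f (h x) = h (f x)" "g (h x) = h (g x)" for x
    by (simp_all add: f_def g_def h_def vec_eq_iff sum_distrib_left mult.left_commute,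
        (subst sum.swap, simp add: mult.left_commute)+)
  have "f (g (h v)) $ (i, j, k) = ?c (contract3 A A A T i j k)" for i j k
    by (simp add: f_def g_def h_def v_def contract3_def sum_distrib_left mult.assoc)
  then have "f (g (h v)) = v" using T by (simp add: vec_eq_iff v_def)
  moreover have "v \<noteq> 0" using \<open>T \<noteq> 0\<close> by (auto simp: v_def vec_eq_iff)
  ultimately obtain a b c w where w: "w \<noteq> 0" "f w = a *s w" "g w = b *s w" "h w = c *s w"
    and abc: "a * b * c = 1"
    using commuting_eigenvalues_product[OF lin comm] by metis
  obtain i j k where ijk: "w $ (i, j, k) \<noteq> 0" using w(1) by (auto simp: vec_eq_iff)
  have "eigenvalue (map_matrix ?c A) a" unfolding eigenvalue_def
    by (rule exI[of _ "\<chi> l. w $ (l, j, k)"])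
      (use ijk w(2) in \<open>auto simp: vec_eq_iff f_def matrix_vector_mult_def map_matrix_def\<close>)
  moreover have "eigenvalue (map_matrix ?c A) b" unfolding eigenvalue_def
    by (rule exI[of _ "\<chi> l. w $ (i, l, k)"])
      (use ijk w(3) in \<open>auto simp: vec_eq_iff g_def matrix_vector_mult_def map_matrix_def\<close>)
  moreover have "eigenvalue (map_matrix ?c A) c" unfolding eigenvalue_def
    by (rule exI[of _ "\<chi> l. w $ (i, j, l)"])
      (use ijk w(4) in \<open>auto simp: vec_eq_iff h_def matrix_vector_mult_def map_matrix_def\<close>)
  ultimately have "cmod a < 1" "cmod b < 1" "cmod c < 1"
    using stable unfolding schur_stable_def by blast+
  then have "cmod a * cmod b < 1" "cmod c < 1" 
    by (meson mult_le_one norm_ge_zero order_le_less_trans mult_left_le less_imp_le)+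
  then have "(cmod a * cmod b) * cmod c < 1"
    by (meson mult_left_le norm_ge_zero order_le_less_trans less_imp_le mult_nonneg_nonneg)
  moreover have "cmod a * cmod b * cmod c = 1" using abc by (metis norm_mult norm_one)
  ultimately show False by simp
qed

lemma contract2_fixed_point_zero:
  fixes A :: "'n::finite matrix"
  assumes stable: "schur_stable A" and S: "\<And>i j. S $ i $ j = contract2 A A S i j"
  shows "S = 0"
proof (rule ccontr)
  assume "S \<noteq> 0"
  let ?c = complex_of_real
  define f :: "complex^('n \<times> 'n) \<Rightarrow> complex^('n \<times> 'n)"
    where "f x = (\<chi> r. \<Sum>l\<in>UNIV. ?c (A $ fst r $ l) * x $ (l, snd r))" for x
  define g :: "complex^('n \<times> 'n) \<Rightarrow> complex^('n \<times> 'n)"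
    where "g x = (\<chi> r. \<Sum>l\<in>UNIV. ?c (A $ snd r $ l) * x $ (fst r, l))" for x
  define v :: "complex^('n \<times> 'n)" where "v = (\<chi> r. ?c (S $ fst r $ snd r))"
  have lin: "Vector_Spaces.linear (*s) (*s) f" "Vector_Spaces.linear (*s) (*s) g"
    by (unfold_locales; simp add: f_def g_def vec_eq_iff algebra_simps sum.distrib sum_distrib_left)+
  have comm: "f (g x) = g (f x)" for x
    by (simp add: f_def g_def vec_eq_iff sum_distrib_left mult.left_commute)
      (subst sum.swap, simp add: mult.left_commute)
  have "f (g v) $ (i, j) = ?c (contract2 A A S i j)" for i j
    by (simp add: f_def g_def v_def contract2_def sum_distrib_left mult.assoc)
  \<comment> \<open>The result on three maps is reused with the identity as third map; its
    eigenvalue can only be 1.\<close>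
  then have "f (g (id v)) = v" using S by (simp add: vec_eq_iff v_def)
  moreover have "v \<noteq> 0" using \<open>S \<noteq> 0\<close> by (auto simp: v_def vec_eq_iff)
  ultimately obtain a b c w where w: "w \<noteq> 0" "f w = a *s w" "g w = b *s w" "id w = c *s w"
    and abc: "a * b * c = 1"
    using commuting_eigenvalues_product[OF lin vec.linear_id[folded id_def], of v] comm by (metis
        id_apply)
  obtain i j where ij: "w $ (i, j) \<noteq> 0" using w(1) by (auto simp: vec_eq_iff)
  have "(c - 1) *s w = 0" using w(4) by (simp add: vec.scale_left_diff_distrib)
  then have "c = 1" using w(1) by (simp only: vec.scale_eq_0_iff) simp
  then have "a * b = 1" using abc by simp
  have "eigenvalue (map_matrix ?c A) a" unfolding eigenvalue_def
    by (rule exI[of _ "\<chi> l. w $ (l, j)"])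
      (use ij w(2) in \<open>auto simp: vec_eq_iff f_def matrix_vector_mult_def map_matrix_def\<close>)
  moreover have "eigenvalue (map_matrix ?c A) b" unfolding eigenvalue_def
    by (rule exI[of _ "\<chi> l. w $ (i, l)"])
      (use ij w(3) in \<open>auto simp: vec_eq_iff g_def matrix_vector_mult_def map_matrix_def\<close>)
  ultimately have "cmod a < 1" "cmod b < 1"
    using stable unfolding schur_stable_def by blast+
  then have "cmod a * cmod b < 1"
    by (meson mult_left_le norm_ge_zero order_le_less_trans less_imp_le)
  moreover have "cmod a * cmod b = 1" using \<open>a * b = 1\<close> by (metis norm_mult norm_one)
  ultimately show False by simp
qed

section \<open>Invertibility on the parameter space and Cramer's rule\<close>

lemma det_mat1_minus_nonzero:
  fixes M :: "real^'N^'N"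
  assumes "\<And>v. M *v v = v \<Longrightarrow> v = 0"
  shows "det (mat 1 - M) \<noteq> 0"
proof -
  have "v = 0" if "(mat 1 - M) *v v = 0" for v
    using assms that by (simp add: matrix_vector_mult_diff_rdistrib)
  then have "\<exists>B. B ** (mat 1 - M) = mat 1" using matrix_left_invertible_ker by blast
  then show ?thesis using invertible_det_nz invertible_left_inverse by blast
qed

abbreviation det2 :: "'n::finite matrix \<Rightarrow> real" where
  "det2 A \<equiv> det (mat 1 - A \<otimes>\<^sub>K A)"

abbreviation det3 :: "'n::finite matrix \<Rightarrow> real" where
  "det3 A \<equiv> det (mat 1 - A \<otimes>\<^sub>K A \<otimes>\<^sub>K A)"

lemma vec2_nth [simp]: "vec2 S $ (i, j) = S $ i $ j"
  by (simp add: vec2_def)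

lemma vec3_nth [simp]: "vec3 T $ (i, j, k) = T $ i $ j $ k"
  by (simp add: vec3_def)

lemma unvec2_nth: "unvec2 v $ i $ j = v $ (i, j)"
  by (simp add: unvec2_def)

lemma unvec3_nth: "unvec3 v $ i $ j $ k = v $ (i, j, k)"
  by (simp add: unvec3_def)

lemma vec2_zero [simp]: "vec2 0 = 0"
  by (simp add: vec_eq_iff vec2_def)

lemma vec3_zero [simp]: "vec3 0 = 0"
  by (simp add: vec_eq_iff vec3_def)

lemma schur_stable_det2:
  fixes A :: "'n::finite matrix"
  shows "schur_stable A \<Longrightarrow> det2 A \<noteq> 0"
proof (rule det_mat1_minus_nonzero)
  fix v :: "real^('n \<times> 'n)"
  assume A: "schur_stable A" and v: "A \<otimes>\<^sub>K A *v v = v"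
  have "unvec2 v = 0"
    by (rule contract2_fixed_point_zero[OF A])
      (use v in \<open>simp add: kron_vec2[symmetric] unvec2_nth\<close>)
  then show "v = 0" by (metis vec2_unvec2 vec2_zero)
qed

lemma schur_stable_det3:
  fixes A :: "'n::finite matrix"
  shows "schur_stable A \<Longrightarrow> det3 A \<noteq> 0"
proof (rule det_mat1_minus_nonzero)
  fix v :: "real^('n \<times> 'n \<times> 'n)"
  assume A: "schur_stable A" and v: "A \<otimes>\<^sub>K A \<otimes>\<^sub>K A *v v = v"
  have "unvec3 v = 0"
    by (rule contract3_fixed_point_zero[OF A])
      (use v in \<open>simp add: kron_vec3[symmetric] unvec3_nth\<close>)
  then show "v = 0" by (metis vec3_unvec3 vec3_zero)
qed

text \<open>\<open>matrix_inv\<close> is a choice term, so the solution is not visibly rational;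
  Cramer's rule exhibits its entries over the denominator \<open>det M\<close>.\<close>

lemma matrix_inv_cramer:
  fixes M :: "real^'N^'N"
  assumes "det M \<noteq> 0"
  shows "M *v (matrix_inv M *v b) = b"
    and "det M * (matrix_inv M *v b) $ k = det (\<chi> i j. if j = k then b $ i else M $ i $ j)"
proof -
  have "M ** matrix_inv M = mat 1"
    using assms invertible_det_nz[of M]
      someI_ex[of "\<lambda>M'. M ** M' = mat 1 \<and> M' ** M = mat 1"]
    unfolding invertible_def matrix_inv_def by blast
  then show *: "M *v (matrix_inv M *v b) = b"
    by (simp add: matrix_vector_mul_assoc)
  then show "det M * (matrix_inv M *v b) $ k = det (\<chi> i j. if j = k then b $ i else M $ i $ j)"
    using cramer_lemma[of k M "matrix_inv M *v b", unfolded *] by (simp only: mult.commute)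
qed

lemma cumulant2_equation:
  assumes "det2 A \<noteq> 0"
  shows "cumulant2 (A, w2, w3) $ i $ j =
    contract2 A A (cumulant2 (A, w2, w3)) i j + (if i = j then w2 $ i else 0)"
proof -
  let ?S = "cumulant2 (A, w2, w3)"
  have "(mat 1 - A \<otimes>\<^sub>K A) *v vec2 ?S = vec2 (diag2 w2)"
    unfolding cumulant2_def by (simp add: matrix_inv_cramer(1)[OF assms])
  then have "vec2 ?S $ (i, j) - (A \<otimes>\<^sub>K A *v vec2 ?S) $ (i, j) = vec2 (diag2 w2) $ (i, j)"
    by (metis matrix_vector_mul_lid matrix_vector_mult_diff_rdistrib vector_minus_component)
  then show ?thesis by (simp add: kron_vec2 diag2_def)
qed

lemma cumulant3_equation:
  assumes "det3 A \<noteq> 0"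
  shows "cumulant3 (A, w2, w3) $ i $ j $ k =
    contract3 A A A (cumulant3 (A, w2, w3)) i j k + (if i = j \<and> j = k then w3 $ i else 0)"
proof -
  let ?T = "cumulant3 (A, w2, w3)"
  have "(mat 1 - A \<otimes>\<^sub>K A \<otimes>\<^sub>K A) *v vec3 ?T = vec3 (diag3 w3)"
    unfolding cumulant3_def by (simp add: matrix_inv_cramer(1)[OF assms])
  then have "vec3 ?T $ (i, j, k) - (A \<otimes>\<^sub>K A \<otimes>\<^sub>K A *v vec3 ?T) $ (i, j, k) = vec3 (diag3 w3) $ (i, j, k)"
    by (metis matrix_vector_mul_lid matrix_vector_mult_diff_rdistrib vector_minus_component)
  then show ?thesis by (simp add: kron_vec3 diag3_def)
qed

section \<open>Polynomial dependence on the parameters\<close>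

lemma real_polynomial_function_det:
  fixes M :: "'a::real_normed_vector \<Rightarrow> real^'N^'N"
  assumes "\<And>i j. real_polynomial_function (\<lambda>x. M x $ i $ j)"
  shows "real_polynomial_function (\<lambda>x. det (M x))"
  unfolding det_def
  by (intro real_polynomial_function_sum real_polynomial_function.intros(4)
      real_polynomial_function.intros(2) real_polynomial_function_prod assms) auto

definition numerator2 :: "'n::finite \<Rightarrow> 'n \<Rightarrow> 'n param \<Rightarrow> real" where
  "numerator2 i j = (\<lambda>(A, w2, w3). det (\<chi> r c. if c = (i, j) then vec2 (diag2 w2) $ r
     else (mat 1 - A \<otimes>\<^sub>K A) $ r $ c))"

definition numerator3 :: "'n::finite \<Rightarrow> 'n \<Rightarrow> 'n \<Rightarrow> 'n param \<Rightarrow> real" where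
  "numerator3 i j k = (\<lambda>(A, w2, w3). det (\<chi> r c. if c = (i, j, k) then vec3 (diag3 w3) $ r
     else (mat 1 - A \<otimes>\<^sub>K A \<otimes>\<^sub>K A) $ r $ c))"

lemma cumulant2_numerator:
  "det2 (fst \<theta>) \<noteq> 0 \<Longrightarrow> det2 (fst \<theta>) * cumulant2 \<theta> $ i $ j = numerator2 i j \<theta>"
  by (cases \<theta>) (simp add: cumulant2_def numerator2_def unvec2_def matrix_inv_cramer(2))

lemma cumulant3_numerator:
  "det3 (fst \<theta>) \<noteq> 0 \<Longrightarrow> det3 (fst \<theta>) * cumulant3 \<theta> $ i $ j $ k = numerator3 i j k \<theta>"
  by (cases \<theta>) (simp add: cumulant3_def numerator3_def unvec3_def matrix_inv_cramer(2))

lemma polynomial_param_entries [intro]: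
  "real_polynomial_function (\<lambda>\<theta> :: 'n::finite param. fst \<theta> $ i $ j)"
  "real_polynomial_function (\<lambda>\<theta> :: 'n param. fst (snd \<theta>) $ i)"
  "real_polynomial_function (\<lambda>\<theta> :: 'n param. snd (snd \<theta>) $ i)"
  by (intro real_polynomial_function.intros(1) bounded_linear_vec_nth[THEN bounded_linear_compose]
      bounded_linear_fst bounded_linear_compose[OF bounded_linear_fst bounded_linear_snd]
      bounded_linear_compose[OF bounded_linear_snd bounded_linear_snd])+

lemma polynomial_kron_entries:
  "real_polynomial_function (\<lambda>\<theta> :: 'n::finite param. (fst \<theta> \<otimes>\<^sub>K fst \<theta>) $ r $ c)"
  "real_polynomial_function (\<lambda>\<theta> :: 'n param. (fst \<theta> \<otimes>\<^sub>K fst \<theta> \<otimes>\<^sub>K fst \<theta>) $ r' $ c')"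
  unfolding kron_def by (auto intro!: real_polynomial_function.intros(4))

lemma polynomial_det_entries:
  "real_polynomial_function (\<lambda>\<theta> :: 'n::finite param. (mat 1 - fst \<theta> \<otimes>\<^sub>K fst \<theta>) $ r $ c)"
  "real_polynomial_function (\<lambda>\<theta> :: 'n param. (mat 1 - fst \<theta> \<otimes>\<^sub>K fst \<theta> \<otimes>\<^sub>K fst \<theta>) $ r' $ c')"
  unfolding vector_minus_component
  by (intro real_polynomial_function_diff real_polynomial_function.intros(2) polynomial_kron_entries)+

lemma polynomial_det2: "real_polynomial_function (\<lambda>\<theta> :: 'n::finite param. det2 (fst \<theta>))"
  by (intro real_polynomial_function_det polynomial_det_entries)

lemma polynomial_det3: "real_polynomial_function (\<lambda>\<theta> :: 'n::finite param. det3 (fst \<theta>))"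
  by (intro real_polynomial_function_det polynomial_det_entries)

lemma polynomial_numerator2:
  fixes i j :: "'n::finite"
  shows "real_polynomial_function (numerator2 i j)"
proof -
  have "real_polynomial_function (\<lambda>\<theta> :: 'n param. (\<chi> r c. if c = (i, j) then vec2 (diag2 (fst (snd
      \<theta>))) $ r
     else (mat 1 - fst \<theta> \<otimes>\<^sub>K fst \<theta>) $ r $ c) $ r $ c)" for r c
    by (cases "c = (i, j)"; cases r; cases "fst r = snd r")
      (auto simp: diag2_def polynomial_det_entries simp del: vector_minus_component
        intro: real_polynomial_function.intros(2))
  from real_polynomial_function_det[OF this] show ?thesis
    unfolding numerator2_def case_prod_unfold by simp
qed

lemma polynomial_numerator3:
  fixes i j k :: "'n::finite"
  shows "real_polynomial_function (numerator3 i j k)"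
proof -
  have "real_polynomial_function (\<lambda>\<theta> :: 'n param. (\<chi> r c. if c = (i, j, k) then vec3 (diag3 (snd
      (snd \<theta>))) $ r
     else (mat 1 - fst \<theta> \<otimes>\<^sub>K fst \<theta> \<otimes>\<^sub>K fst \<theta>) $ r $ c) $ r $ c)" for r c
    by (cases "c = (i, j, k)"; cases r; cases "fst r = fst (snd r) \<and> fst (snd r) = snd (snd r)")
      (auto simp: diag3_def polynomial_det_entries simp del: vector_minus_component
        intro: real_polynomial_function.intros(2))
  from real_polynomial_function_det[OF this] show ?thesis
    unfolding numerator3_def case_prod_unfold by simp
qed

section \<open>The modified Jacobian and its rank\<close>

text \<open>The derivative of the Lyapunov term with respect to \<open>A\<close> in the direction
  \<open>X\<close>, with \<open>S\<close> held fixed. The Jacobian is thus handled as a linear map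
  on matrices, whose columns are the values at \<open>unit_matrix b a\<close>.\<close>

definition jac2 :: "'n::finite matrix \<Rightarrow> 'n matrix \<Rightarrow> 'n matrix \<Rightarrow> 'n \<Rightarrow> 'n \<Rightarrow> real" where
  "jac2 A S X i j = contract2 X A S i j + contract2 A X S i j"

definition jac3 :: "'n::finite matrix \<Rightarrow> 'n tensor \<Rightarrow> 'n matrix \<Rightarrow> 'n \<Rightarrow> 'n \<Rightarrow> 'n \<Rightarrow> real" where
  "jac3 A T X i j k = contract3 X A A T i j k + contract3 A X A T i j k + contract3 A A X T i j k"

text \<open>All index tuples are taken, not just the sorted ones. For symmetric cumulants the
  condition is the same, and it makes sense without an order on the nodes, as in the analysis of the
  base point.\<close>

definition jac_vanishes :: "'n::finite matrix \<Rightarrow> 'n matrix \<Rightarrow> 'n tensor \<Rightarrow> 'n matrix \<Rightarrow> bool" where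
  "jac_vanishes A S T X \<longleftrightarrow> (\<forall>i j. i \<noteq> j \<longrightarrow> jac2 A S X i j = 0) \<and>
     (\<forall>i j k. \<not> (i = j \<and> j = k) \<longrightarrow> jac3 A T X i j k = 0)"

definition jac_injective :: "('n::finite \<times> 'n) set \<Rightarrow> 'n matrix \<Rightarrow> 'n matrix \<Rightarrow> 'n tensor \<Rightarrow> bool" where
  "jac_injective E A S T \<longleftrightarrow> (\<forall>X \<in> graph_matrices E. jac_vanishes A S T X \<longrightarrow> X = 0)"

definition symmetric2 :: "'n::finite matrix \<Rightarrow> bool" where
  "symmetric2 S \<longleftrightarrow> (\<forall>i j. S $ i $ j = S $ j $ i)"

definition symmetric3 :: "'n::finite tensor \<Rightarrow> bool" where
  "symmetric3 T \<longleftrightarrow> (\<forall>i j k. T $ i $ j $ k = T $ j $ i $ k \<and> T $ i $ j $ k = T $ i $ k $ j)"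

lemma contract2_swap: assumes "symmetric2 S" shows "contract2 A B S i j = contract2 B A S j i"
proof -
  have s: "S $ l $ m = S $ m $ l" for l m using assms unfolding symmetric2_def by blast
  have e: "A $ i $ l * B $ j $ m * S $ l $ m = B $ j $ m * A $ i $ l * S $ m $ l" for l m
    using s[of l m] by simp
  show ?thesis unfolding contract2_def e by (rule sum.swap)
qed

lemma contract3_swap12: assumes "symmetric3 T" shows "contract3 A B C T i j k = contract3 B A C T j i k"
proof -
  have s: "T $ l $ m $ q = T $ m $ l $ q" for l m q using assms unfolding symmetric3_def by blast
  have e: "A $ i $ l * B $ j $ m * C $ k $ q * T $ l $ m $ q = B $ j $ m * A $ i $ l * C $ k $ q * T
      $ m $ l $ q" for l m q
    using s[of l m q] by simp
  show ?thesis unfolding contract3_def e by (rule sum.swap)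
qed

lemma contract3_swap23: assumes "symmetric3 T" shows "contract3 A B C T i j k = contract3 A C B T i k j"
proof -
  have s: "T $ l $ m $ q = T $ l $ q $ m" for l m q using assms unfolding symmetric3_def by blast
  have e: "A $ i $ l * B $ j $ m * C $ k $ q * T $ l $ m $ q = A $ i $ l * C $ k $ q * B $ j $ m * T
      $ l $ q $ m" for l m q
    using s[of l m q] by simp
  show ?thesis unfolding contract3_def e by (rule sum.cong[OF refl]) (rule sum.swap)
qed

lemma jac2_swap: "symmetric2 S \<Longrightarrow> jac2 A S X i j = jac2 A S X j i"
  unfolding jac2_def using contract2_swap[of S X A i j] contract2_swap[of S A X i j] by linarith

lemma jac3_swap12: "symmetric3 T \<Longrightarrow> jac3 A T X i j k = jac3 A T X j i k"
  unfolding jac3_def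
  using contract3_swap12[of T X A A i j k] contract3_swap12[of T A X A i j k]
    contract3_swap12[of T A A X i j k] by linarith

lemma jac3_swap23: "symmetric3 T \<Longrightarrow> jac3 A T X i j k = jac3 A T X i k j"
  unfolding jac3_def
  using contract3_swap23[of T X A A i j k] contract3_swap23[of T A X A i j k]
    contract3_swap23[of T A A X i j k] by linarith

lemma jac_vanishes_iff_sorted:
  fixes A :: "'n::{finite,linorder} matrix"
  assumes S: "symmetric2 S" and T: "symmetric3 T"
  shows "jac_vanishes A S T X \<longleftrightarrow> (\<forall>i j. i < j \<longrightarrow> jac2 A S X i j = 0) \<and>
     (\<forall>i j k. i \<le> j \<and> j \<le> k \<and> \<not> (i = j \<and> j = k) \<longrightarrow> jac3 A T X i j k = 0)"
    (is "_ \<longleftrightarrow> ?R2 \<and> ?R3")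
proof
  assume "jac_vanishes A S T X"
  then show "?R2 \<and> ?R3" unfolding jac_vanishes_def by auto
next
  assume R: "?R2 \<and> ?R3"
  have "jac2 A S X i j = 0" if "i \<noteq> j" for i j
    using R that jac2_swap[OF S, of A X i j] by (metis linorder_less_linear)
  moreover have "jac3 A T X i j k = 0" if "\<not> (i = j \<and> j = k)" for i j k
  proof -
    note s = jac3_swap12[OF T, of A X] jac3_swap23[OF T, of A X]
    have *: "\<And>i j k. i \<le> j \<Longrightarrow> j \<le> k \<Longrightarrow> \<not> (i = j \<and> j = k) \<Longrightarrow> jac3 A T X i j k = 0"
      using R by blast
    consider "i \<le> j" "j \<le> k" | "i \<le> k" "k \<le> j" | "j \<le> i" "i \<le> k" | "j \<le> k" "k \<le> i"
      | "k \<le> i" "i \<le> j" | "k \<le> j" "j \<le> i"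
      by (meson linear)
    then show ?thesis
    proof cases
      case 1 then show ?thesis using *[of i j k] that by blast
    next
      case 2 then show ?thesis using *[of i k j] that s(2)[of i j k] by auto
    next
      case 3 then show ?thesis using *[of j i k] that s(1)[of i j k] by auto
    next
      case 4 then show ?thesis
        using *[of j k i] that s(1)[of i j k] s(2)[of j i k] by auto
    next
      case 5 then show ?thesis
        using *[of k i j] that s(2)[of i j k] s(1)[of i k j] by auto
    next
      case 6 then show ?thesis
        using *[of k j i] that s(1)[of i j k] s(2)[of j i k] s(1)[of j k i] by auto
    qed
  qed
  ultimately show "jac_vanishes A S T X" unfolding jac_vanishes_def by blast
qed

text \<open>The coordinate of the edge from \<open>a\<close> to \<open>b\<close> goes to row
  \<open>b\<close>, column \<open>a\<close>, the position of its weight in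
  \<open>graph_matrices\<close>.\<close>

definition edge_matrix :: "real^('n::finite \<times> 'n) \<Rightarrow> 'n matrix" where
  "edge_matrix x = (\<chi> b a. x $ (a, b))"

lemma contract_unit_matrix:
  "contract2 (unit_matrix b a) A S i j = (if i = b then \<Sum>m\<in>UNIV. A $ j $ m * S $ a $ m else 0)"
  "contract2 A (unit_matrix b a) S i j = (if j = b then \<Sum>l\<in>UNIV. A $ i $ l * S $ l $ a else 0)"
  "contract3 (unit_matrix b a) A B T i j k =
     (if i = b then \<Sum>m\<in>UNIV. \<Sum>q\<in>UNIV. A $ j $ m * B $ k $ q * T $ a $ m $ q else 0)"
  "contract3 A (unit_matrix b a) B T i j k =
     (if j = b then \<Sum>l\<in>UNIV. \<Sum>q\<in>UNIV. A $ i $ l * B $ k $ q * T $ l $ a $ q else 0)"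
  "contract3 A B (unit_matrix b a) T i j k =
     (if k = b then \<Sum>l\<in>UNIV. \<Sum>m\<in>UNIV. A $ i $ l * B $ j $ m * T $ l $ m $ a else 0)"
proof -
  have u: "unit_matrix b a $ r $ c * y * z = (if c = a then (if r = b then y * z else 0) else 0)"
    "y * unit_matrix b a $ r $ c * z = (if c = a then (if r = b then y * z else 0) else 0)"
    "unit_matrix b a $ r $ c * y * z * t = (if c = a then (if r = b then y * z * t else 0) else 0)"
    "y * unit_matrix b a $ r $ c * z * t = (if c = a then (if r = b then y * z * t else 0) else 0)"
    "y * z * unit_matrix b a $ r $ c * t = (if c = a then (if r = b then y * z * t else 0) else 0)"
    for r c and y z t :: real
    by (auto simp: unit_matrix_def)
  show "contract2 (unit_matrix b a) A S i j = (if i = b then \<Sum>m\<in>UNIV. A $ j $ m * S $ a $ m else 0)"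
    unfolding contract2_def u(1) by (subst sum.swap) (simp add: sum.delta)
  show "contract2 A (unit_matrix b a) S i j = (if j = b then \<Sum>l\<in>UNIV. A $ i $ l * S $ l $ a else 0)"
    unfolding contract2_def u(2) by (simp add: sum.delta)
  show "contract3 (unit_matrix b a) A B T i j k =
     (if i = b then \<Sum>m\<in>UNIV. \<Sum>q\<in>UNIV. A $ j $ m * B $ k $ q * T $ a $ m $ q else 0)"
  proof -
    have "(\<Sum>m\<in>UNIV. \<Sum>q\<in>UNIV. if l = a then if i = b then A $ j $ m * B $ k $ q * T $ l $ m $ q else
        0 else 0)
      = (if l = a then \<Sum>m\<in>UNIV. \<Sum>q\<in>UNIV. if i = b then A $ j $ m * B $ k $ q * T $ l $ m $ q else 0
          else 0)" for l
      by simp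
    then show ?thesis unfolding contract3_def u(3) by (simp add: sum.delta)
  qed
  show "contract3 A (unit_matrix b a) B T i j k =
     (if j = b then \<Sum>l\<in>UNIV. \<Sum>q\<in>UNIV. A $ i $ l * B $ k $ q * T $ l $ a $ q else 0)"
  proof -
    have "(\<Sum>q\<in>UNIV. if m = a then if j = b then A $ i $ l * B $ k $ q * T $ l $ m $ q else 0 else 0)
      = (if m = a then \<Sum>q\<in>UNIV. if j = b then A $ i $ l * B $ k $ q * T $ l $ m $ q else 0 else 0)"
          for l m
      by simp
    then show ?thesis unfolding contract3_def u(4) by (simp add: sum.delta)
  qed
  show "contract3 A B (unit_matrix b a) T i j k =
     (if k = b then \<Sum>l\<in>UNIV. \<Sum>m\<in>UNIV. A $ i $ l * B $ j $ m * T $ l $ m $ a else 0)"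
    unfolding contract3_def u(5) by (simp add: sum.delta)
qed

lemma sum_edge_unit_matrix:
  fixes x :: "real^('n::finite \<times> 'n)"
  shows "(\<Sum>a\<in>UNIV. \<Sum>b\<in>UNIV. (if i = b then f a else 0) * x $ (a, b)) = (\<Sum>a\<in>UNIV. edge_matrix x $ i $
      a * f a)"
proof (rule sum.cong[OF refl])
  fix a
  have "(\<Sum>b\<in>UNIV. (if i = b then f a else 0) * x $ (a, b)) = (\<Sum>b\<in>UNIV. if i = b then f a * x $ (a,
      i) else 0)"
    by (rule sum.cong) auto
  then show "(\<Sum>b\<in>UNIV. (if i = b then f a else 0) * x $ (a, b)) = edge_matrix x $ i $ a * f a"
    by (simp add: edge_matrix_def sum.delta')
qed

lemma matrix_vector_mult_nth: "(M *v x) $ r = (\<Sum>e\<in>UNIV. M $ r $ e * x $ e)"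
  by (simp add: matrix_vector_mult_def)

lemma J2_mult:
  assumes x: "\<And>e. e \<notin> E \<Longrightarrow> x $ e = 0" and "i \<le> j"
  shows "(J2 E S A *v x) $ (i, j) = jac2 A S (edge_matrix x) i j"
proof -
  have "(J2 E S A *v x) $ (i, j) = (\<Sum>a\<in>UNIV. \<Sum>b\<in>UNIV.
      (contract2 (unit_matrix b a) A S i j + contract2 A (unit_matrix b a) S i j) * x $ (a, b))"
    unfolding matrix_vector_mult_nth[of "J2 E S A"] sum_UNIV_pair
  proof (intro sum.cong refl)
    fix a b
    show "J2 E S A $ (i, j) $ (a, b) * x $ (a, b) = (contract2 (unit_matrix b a) A S i j + contract2
        A (unit_matrix b a) S i j) * x $ (a, b)"
      using x[of "(a, b)"] \<open>i \<le> j\<close>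
      by (cases "(a, b) \<in> E") (simp_all add: J2_def matrix_vector_mult_add_rdistrib kron_vec2)
  qed
  also have "\<dots> = jac2 A S (edge_matrix x) i j"
  proof -
    let ?X = "edge_matrix x"
    have "(\<Sum>a\<in>UNIV. ?X $ j $ a * (\<Sum>l\<in>UNIV. A $ i $ l * S $ l $ a)) = contract2 A ?X S i j"
      unfolding contract2_def sum_distrib_left by (subst sum.swap) (simp add: mult_ac)
    moreover have "(\<Sum>a\<in>UNIV. ?X $ i $ a * (\<Sum>m\<in>UNIV. A $ j $ m * S $ a $ m)) = contract2 ?X A S i j"
      unfolding contract2_def sum_distrib_left by (simp add: mult_ac)
    ultimately show ?thesis
      unfolding distrib_right sum.distrib contract_unit_matrix sum_edge_unit_matrix jac2_def by simp
  qed
  finally show ?thesis .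
qed

lemma J3_mult:
  assumes x: "\<And>e. e \<notin> E \<Longrightarrow> x $ e = 0" and "i \<le> j" "j \<le> k"
  shows "(J3 E T A *v x) $ (i, j, k) = jac3 A T (edge_matrix x) i j k"
proof -
  have "(J3 E T A *v x) $ (i, j, k) = (\<Sum>a\<in>UNIV. \<Sum>b\<in>UNIV.
      (contract3 (unit_matrix b a) A A T i j k + contract3 A (unit_matrix b a) A T i j k
        + contract3 A A (unit_matrix b a) T i j k) * x $ (a, b))"
    unfolding matrix_vector_mult_nth[of "J3 E T A"] sum_UNIV_pair
  proof (intro sum.cong refl)
    fix a b
    show "J3 E T A $ (i, j, k) $ (a, b) * x $ (a, b) = (contract3 (unit_matrix b a) A A T i j k +
        contract3 A (unit_matrix b a) A T i j k + contract3 A A (unit_matrix b a) T i j k) * x $ (a, b)"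
      using x[of "(a, b)"] \<open>i \<le> j\<close> \<open>j \<le> k\<close>
      by (cases "(a, b) \<in> E") (simp_all add: J3_def matrix_vector_mult_add_rdistrib kron_vec3)
  qed
  also have "\<dots> = jac3 A T (edge_matrix x) i j k"
  proof -
    let ?X = "edge_matrix x"
    have "(\<Sum>a\<in>UNIV. ?X $ j $ a * (\<Sum>l\<in>UNIV. \<Sum>q\<in>UNIV. A $ i $ l * A $ k $ q * T $ l $ a $ q))
        = contract3 A ?X A T i j k"
      unfolding contract3_def sum_distrib_left by (subst sum.swap) (simp add: mult_ac)
    moreover have "(\<Sum>a\<in>UNIV. ?X $ k $ a * (\<Sum>l\<in>UNIV. \<Sum>m\<in>UNIV. A $ i $ l * A $ j $ m * T $ l $ m $ a))
        = contract3 A A ?X T i j k"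
      unfolding contract3_def sum_distrib_left
      by (subst sum.swap, rule sum.cong[OF refl], subst sum.swap) (simp add: mult_ac)
    moreover have "(\<Sum>a\<in>UNIV. ?X $ i $ a * (\<Sum>m\<in>UNIV. \<Sum>q\<in>UNIV. A $ j $ m * A $ k $ q * T $ a $ m $ q))
        = contract3 ?X A A T i j k"
      unfolding contract3_def sum_distrib_left by (simp add: mult_ac)
    ultimately show ?thesis
      unfolding distrib_right sum.distrib contract_unit_matrix sum_edge_unit_matrix jac3_def by simp
  qed
  finally show ?thesis .
qed

lemma J_off_mult_zero_iff:
  assumes x: "\<And>e. e \<notin> E \<Longrightarrow> x $ e = 0" and ST: "symmetric2 S" "symmetric3 T"
  shows "J_off E S T A *v x = 0 \<longleftrightarrow> jac_vanishes A S T (edge_matrix x)"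
proof -
  have zero2: "(J2 E S A *v x) $ (i, j) = 0" if "\<not> i \<le> j" for i j
    using that by (simp add: matrix_vector_mult_def J2_def)
  have zero3: "(J3 E T A *v x) $ (i, j, k) = 0" if "\<not> (i \<le> j \<and> j \<le> k)" for i j k
    using that by (auto simp: matrix_vector_mult_def J3_def intro!: sum.neutral)
  have J2_eq: "(J2 E S A *v x) $ (i, j) = (if i \<le> j then jac2 A S (edge_matrix x) i j else 0)" for i j
    using zero2 J2_mult[OF x] by simp
  have J3_eq: "(J3 E T A *v x) $ (i, j, k) =
      (if i \<le> j \<and> j \<le> k then jac3 A T (edge_matrix x) i j k else 0)" for i j k
    using zero3 J3_mult[OF x] by simp
  have if0: "((if c then p else 0) = (0 :: real)) \<longleftrightarrow> (c \<longrightarrow> p = 0)" for c p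
    by simp
  have strict2: "(\<forall>i j. i \<noteq> j \<longrightarrow> (if i \<le> j then P i j else 0) = 0) \<longleftrightarrow> (\<forall>i j. i < j \<longrightarrow> P i j = 0)"
    for P :: "'a \<Rightarrow> 'a \<Rightarrow> real"
    by (smt (verit) order.strict_iff_order)
  have strict3:
    "(\<forall>i j k. \<not> (i = j \<and> j = k) \<longrightarrow> (if i \<le> j \<and> j \<le> k then Q i j k else 0) = 0) \<longleftrightarrow>
     (\<forall>i j k. i \<le> j \<and> j \<le> k \<and> \<not> (i = j \<and> j = k) \<longrightarrow> Q i j k = 0)"
    for Q :: "'a \<Rightarrow> 'a \<Rightarrow> 'a \<Rightarrow> real"
    by (smt (verit))
  have Inl: "(J_off E S T A *v x) $ Inl (i, j) = (if i \<noteq> j then (J2 E S A *v x) $ (i, j) else 0)"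
      for i j
    by (simp add: J_off_def matrix_vector_mult_def)
  have Inr: "(J_off E S T A *v x) $ Inr (i, j, k) =
      (if \<not> (i = j \<and> j = k) then (J3 E T A *v x) $ (i, j, k) else 0)" for i j k
    by (simp add: J_off_def matrix_vector_mult_def)
  have "J_off E S T A *v x = 0 \<longleftrightarrow>
      (\<forall>i j. (J_off E S T A *v x) $ Inl (i, j) = 0) \<and>
      (\<forall>i j k. (J_off E S T A *v x) $ Inr (i, j, k) = 0)"
    unfolding vec_eq_iff split_sum_all by (simp only: split_paired_All zero_index)
  also have "\<dots> \<longleftrightarrow>
      (\<forall>i j. i \<noteq> j \<longrightarrow> (J2 E S A *v x) $ (i, j) = 0) \<and>
      (\<forall>i j k. \<not> (i = j \<and> j = k) \<longrightarrow> (J3 E T A *v x) $ (i, j, k) = 0)"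
    unfolding Inl Inr if0 ..
  also have "\<dots> \<longleftrightarrow> (\<forall>i j. i < j \<longrightarrow> jac2 A S (edge_matrix x) i j = 0) \<and>
     (\<forall>i j k. i \<le> j \<and> j \<le> k \<and> \<not> (i = j \<and> j = k) \<longrightarrow> jac3 A T (edge_matrix x) i j k = 0)"
    unfolding J2_eq J3_eq strict2 strict3 ..
  finally show ?thesis unfolding jac_vanishes_iff_sorted[OF ST] .
qed

lemma J_off_nonedge_column:
  assumes "e \<notin> E"
  shows "J_off E S T A $ r $ e = 0"
proof (cases r)
  case (Inl p)
  then show ?thesis using assms by (cases p; cases e) (simp add: J_off_def J2_def)
next
  case (Inr p)
  then show ?thesis using assms by (cases p; cases e) (simp add: J_off_def J3_def)
qed

lemma jac_injective_iff_J_off: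
  fixes E :: "('n::{finite,linorder} \<times> 'n) set"
  assumes ST: "symmetric2 S" "symmetric3 T"
  shows "jac_injective E A S T \<longleftrightarrow>
    (\<forall>x. (\<forall>e. e \<notin> E \<longrightarrow> x $ e = 0) \<longrightarrow> J_off E S T A *v x = 0 \<longrightarrow> x = 0)"
proof
  assume inj: "jac_injective E A S T"
  show "\<forall>x. (\<forall>e. e \<notin> E \<longrightarrow> x $ e = 0) \<longrightarrow> J_off E S T A *v x = 0 \<longrightarrow> x = 0"
  proof (intro allI impI)
    fix x :: "real^('n \<times> 'n)" assume x: "\<forall>e. e \<notin> E \<longrightarrow> x $ e = 0" "J_off E S T A *v x = 0"
    have "edge_matrix x \<in> graph_matrices E"
      using x(1) by (auto simp: graph_matrices_def edge_matrix_def)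
    moreover have "jac_vanishes A S T (edge_matrix x)"
      using J_off_mult_zero_iff[OF _ ST] x by blast
    ultimately have "edge_matrix x = 0" using inj unfolding jac_injective_def by blast
    then show "x = 0" by (auto simp: edge_matrix_def vec_eq_iff)
  qed
next
  assume inj: "\<forall>x. (\<forall>e. e \<notin> E \<longrightarrow> x $ e = 0) \<longrightarrow> J_off E S T A *v x = 0 \<longrightarrow> x = 0"
  show "jac_injective E A S T" unfolding jac_injective_def
  proof (intro ballI impI)
    fix X assume X: "X \<in> graph_matrices E" "jac_vanishes A S T X"
    define x :: "real^('n \<times> 'n)" where "x = (\<chi> e. X $ snd e $ fst e)"
    have "edge_matrix x = X" by (simp add: x_def edge_matrix_def vec_eq_iff)
    moreover have supp: "\<forall>e. e \<notin> E \<longrightarrow> x $ e = 0"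
      using X(1) by (auto simp: x_def graph_matrices_def)
    ultimately have "x = 0" using inj X(2) J_off_mult_zero_iff[OF _ ST, of E x A] by metis
    then show "X = 0" by (auto simp: x_def vec_eq_iff)
  qed
qed

text \<open>Zero columns contribute nothing, so the range is the injective image of the vectors
  supported on \<open>E\<close>, a space of dimension \<open>card E\<close>.\<close>

lemma rank_eq_card_if_injective_on_support:
  fixes J :: "real^'c^'r"
  assumes col: "\<And>r e. e \<notin> E \<Longrightarrow> J $ r $ e = 0"
    and inj: "\<And>x. (\<forall>e. e \<notin> E \<longrightarrow> x $ e = 0) \<Longrightarrow> J *v x = 0 \<Longrightarrow> x = 0"
  shows "rank J = card E"
proof -
  define K where "K = {x :: real^'c. \<forall>e. e \<notin> E \<longrightarrow> x $ e = 0}"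
  have sub: "subspace K" by (auto simp: K_def subspace_def)
  have "range ((*v) J) = (*v) J ` K"
  proof (intro subset_antisym image_subsetI)
    show "J *v x \<in> range ((*v) J)" for x by blast
    fix x :: "real^'c"
    define y where "y = (\<chi> e. if e \<in> E then x $ e else 0)"
    have "J *v x = J *v y"
      by (auto simp: matrix_vector_mult_def vec_eq_iff y_def col intro!: sum.cong)
    moreover have "y \<in> K" by (simp add: K_def y_def)
    ultimately show "J *v x \<in> (*v) J ` K" by blast
  qed
  moreover have "inj_on ((*v) J) K"
    using linear_inj_on_iff_eq_0[OF matrix_vector_mul_linear sub] inj by (auto simp: K_def)
  moreover have "span K = K" using sub by (rule span_eq_iff[THEN iffD2])
  ultimately have "rank J = dim K"
    unfolding rank_dim_range by (metis dim_image_eq[OF matrix_vector_mul_linear])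
  also have "dim K = card E"
  proof -
    have "K = span ((\<lambda>e. axis e 1) ` E)"
    proof
      show "K \<subseteq> span ((\<lambda>e. axis e 1) ` E)"
      proof
        fix x assume x: "x \<in> K"
        have "x = (\<Sum>e\<in>E. x $ e *\<^sub>R axis e 1)"
        proof (subst vec_eq_iff, intro allI)
          fix i
          have "(\<Sum>e\<in>E. x $ e * axis e 1 $ i) = (\<Sum>e\<in>E. if e = i then x $ e else 0)"
            by (rule sum.cong) (auto simp: axis_def)
          then show "x $ i = (\<Sum>e\<in>E. x $ e *\<^sub>R axis e 1) $ i"
            using x by (simp add: K_def)
        qed
        also have "\<dots> \<in> span ((\<lambda>e. axis e 1) ` E)"
          by (intro span_sum span_scale span_base) auto
        finally show "x \<in> span ((\<lambda>e. axis e 1) ` E)" .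
      qed
      show "span ((\<lambda>e. axis e 1) ` E) \<subseteq> K"
        by (rule span_minimal[OF _ sub]) (auto simp: K_def axis_def)
    qed
    moreover have "independent ((\<lambda>e. axis e (1::real)) ` E)"
      by (rule independent_mono[OF independent_Basis]) (auto simp: axis_in_Basis_iff)
    moreover have "card ((\<lambda>e. axis e (1::real)) ` E) = card E"
      by (rule card_image) (auto simp: inj_on_def axis_eq_axis)
    ultimately show ?thesis by (simp add: dim_eq_card_independent)
  qed
  finally show ?thesis .
qed

section \<open>Derivatives of the cumulants\<close>

lemma contract2_has_derivative:
  assumes "\<And>i l. ((\<lambda>t. A t $ i $ l) has_real_derivative A' $ i $ l) (at 0)"
    and "\<And>i l. ((\<lambda>t. B t $ i $ l) has_real_derivative B' $ i $ l) (at 0)"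
    and "\<And>i l. ((\<lambda>t. S t $ i $ l) has_real_derivative S' $ i $ l) (at 0)"
  shows "((\<lambda>t. contract2 (A t) (B t) (S t) i j) has_real_derivative
    contract2 A' (B 0) (S 0) i j + contract2 (A 0) B' (S 0) i j + contract2 (A 0) (B 0) S' i j) (at 0)"
proof -
  have "((\<lambda>t. A t $ i $ l * B t $ j $ m * S t $ l $ m) has_real_derivative
      A' $ i $ l * B 0 $ j $ m * S 0 $ l $ m + A 0 $ i $ l * B' $ j $ m * S 0 $ l $ m
      + A 0 $ i $ l * B 0 $ j $ m * S' $ l $ m) (at 0)" for l m
    by (rule derivative_eq_intros assms refl | simp add: algebra_simps)+
  then have "((\<lambda>t. contract2 (A t) (B t) (S t) i j) has_real_derivative (\<Sum>l\<in>UNIV. \<Sum>m\<in>UNIV.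
      A' $ i $ l * B 0 $ j $ m * S 0 $ l $ m + A 0 $ i $ l * B' $ j $ m * S 0 $ l $ m
      + A 0 $ i $ l * B 0 $ j $ m * S' $ l $ m)) (at 0)"
    unfolding contract2_def by (intro DERIV_sum)
  then show ?thesis by (simp add: sum.distrib contract2_def)
qed

lemma contract3_has_derivative:
  assumes "\<And>i l. ((\<lambda>t. A t $ i $ l) has_real_derivative A' $ i $ l) (at 0)"
    and "\<And>i l. ((\<lambda>t. B t $ i $ l) has_real_derivative B' $ i $ l) (at 0)"
    and "\<And>i l. ((\<lambda>t. C t $ i $ l) has_real_derivative C' $ i $ l) (at 0)"
    and "\<And>i l k. ((\<lambda>t. T t $ i $ l $ k) has_real_derivative T' $ i $ l $ k) (at 0)"
  shows "((\<lambda>t. contract3 (A t) (B t) (C t) (T t) i j k) has_real_derivative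
    contract3 A' (B 0) (C 0) (T 0) i j k + contract3 (A 0) B' (C 0) (T 0) i j k
    + contract3 (A 0) (B 0) C' (T 0) i j k + contract3 (A 0) (B 0) (C 0) T' i j k) (at 0)"
proof -
  have "((\<lambda>t. A t $ i $ l * B t $ j $ m * C t $ k $ q * T t $ l $ m $ q) has_real_derivative
      A' $ i $ l * B 0 $ j $ m * C 0 $ k $ q * T 0 $ l $ m $ q
      + A 0 $ i $ l * B' $ j $ m * C 0 $ k $ q * T 0 $ l $ m $ q
      + A 0 $ i $ l * B 0 $ j $ m * C' $ k $ q * T 0 $ l $ m $ q
      + A 0 $ i $ l * B 0 $ j $ m * C 0 $ k $ q * T' $ l $ m $ q) (at 0)" for l m q
    by (rule derivative_eq_intros assms refl | simp add: algebra_simps)+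
  then have "((\<lambda>t. contract3 (A t) (B t) (C t) (T t) i j k) has_real_derivative
     (\<Sum>l\<in>UNIV. \<Sum>m\<in>UNIV. \<Sum>q\<in>UNIV.
      A' $ i $ l * B 0 $ j $ m * C 0 $ k $ q * T 0 $ l $ m $ q
      + A 0 $ i $ l * B' $ j $ m * C 0 $ k $ q * T 0 $ l $ m $ q
      + A 0 $ i $ l * B 0 $ j $ m * C' $ k $ q * T 0 $ l $ m $ q
      + A 0 $ i $ l * B 0 $ j $ m * C 0 $ k $ q * T' $ l $ m $ q)) (at 0)"
    unfolding contract3_def by (intro DERIV_sum)
  then show ?thesis by (simp add: sum.distrib contract3_def)
qed

text \<open>Numerator of the component along \<open>b\<close> over the product of both determinants.
  The finiteness result for fibres asks for one denominator common to all components.\<close>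

definition cumulant_numerator :: "'n::finite matrix \<times> 'n tensor \<Rightarrow> 'n param \<Rightarrow> real" where
  "cumulant_numerator b \<theta> =
     (\<Sum>i\<in>UNIV. \<Sum>j\<in>UNIV. det3 (fst \<theta>) * numerator2 i j \<theta> * fst b $ i $ j) +
     (\<Sum>i\<in>UNIV. \<Sum>j\<in>UNIV. \<Sum>k\<in>UNIV. det2 (fst \<theta>) * numerator3 i j k \<theta> * snd b $ i $ j $ k)"

lemma polynomial_cumulant_numerator: "real_polynomial_function (cumulant_numerator b)"
  unfolding cumulant_numerator_def[abs_def]
  by (intro real_polynomial_function.intros(2,3,4) real_polynomial_function_sum finite
      polynomial_det2 polynomial_det3 polynomial_numerator2 polynomial_numerator3)

lemma cumulant_map_numerator:
  assumes "det2 (fst \<theta>) \<noteq> 0" "det3 (fst \<theta>) \<noteq> 0"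
  shows "det2 (fst \<theta>) * det3 (fst \<theta>) * (cumulant_map \<theta> \<bullet> b) = cumulant_numerator b \<theta>"
  unfolding cumulant_numerator_def cumulant2_numerator[OF assms(1), symmetric]
    cumulant3_numerator[OF assms(2), symmetric]
  by (cases b) (simp add: cumulant_map_def inner_vec_def sum_distrib_left distrib_left mult_ac)

text \<open>Each component agrees with a quotient of polynomials on the open set where both
  determinants are non-zero; the derivative is transferred within this set.\<close>

lemma cumulant_map_differentiable:
  fixes \<theta> :: "'n::finite param"
  assumes "det2 (fst \<theta>) \<noteq> 0" "det3 (fst \<theta>) \<noteq> 0"
  shows "cumulant_map differentiable (at \<theta>)"
proof -
  let ?q = "\<lambda>\<theta> :: 'n param. det2 (fst \<theta>) * det3 (fst \<theta>)"
  have q: "real_polynomial_function ?q"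
    by (intro real_polynomial_function.intros(4) polynomial_det2 polynomial_det3)
  have "(\<lambda>x. cumulant_map x \<bullet> b) differentiable (at \<theta>)" for b
  proof -
    have "(\<lambda>x. cumulant_numerator b x / ?q x) differentiable (at \<theta>)"
      using assms
      by (intro differentiable_divide differentiable_at_real_polynomial_function
          polynomial_cumulant_numerator q) simp
    then obtain D where D: "((\<lambda>x. cumulant_numerator b x / ?q x) has_derivative D) (at \<theta>)"
      unfolding differentiable_def by blast
    have "open (?q -` (- {0}))"
      by (intro open_vimage) (use continuous_on_polymonial_function[of ?q UNIV] q in
          \<open>auto simp: real_polynomial_function_eq open_Compl\<close>)
    then have "((\<lambda>x. cumulant_map x \<bullet> b) has_derivative D) (at \<theta>)"
    proof (rule has_derivative_transform_within_open[OF D])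
      fix x assume "x \<in> ?q -` (- {0})"
      then have x: "det2 (fst x) \<noteq> 0" "det3 (fst x) \<noteq> 0" by auto
      then show "cumulant_numerator b x / ?q x = cumulant_map x \<bullet> b"
        using cumulant_map_numerator[OF x, of b] by (simp add: field_simps)
    qed (use assms in auto)
    then show ?thesis unfolding differentiable_def by blast
  qed
  then show ?thesis by (subst differentiable_componentwise_within) blast
qed

context
  fixes A X :: "'n::finite matrix" and w2 w3 u2 u3 :: "real^'n"
    and \<phi>' :: "'n param \<Rightarrow> 'n matrix \<times> 'n tensor"
  assumes dets: "det2 A \<noteq> 0" "det3 A \<noteq> 0"
    and der: "(cumulant_map has_derivative \<phi>') (at (A, w2, w3))"
begin

abbreviation (input) "line t \<equiv> (A, w2, w3) + t *\<^sub>R (X, u2, u3)"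
abbreviation (input) "S' \<equiv> fst (\<phi>' (X, u2, u3))"
abbreviation (input) "T' \<equiv> snd (\<phi>' (X, u2, u3))"

lemma cumulant_line_derivatives:
  "((\<lambda>t. cumulant2 (line t) $ i $ j) has_real_derivative S' $ i $ j) (at 0)"
  "((\<lambda>t. cumulant3 (line t) $ i $ j $ k) has_real_derivative T' $ i $ j $ k) (at 0)"
proof -
  have "((\<lambda>t. line t) has_derivative (\<lambda>t. 0 + t *\<^sub>R (X, u2, u3))) (at 0)"
    by (intro has_derivative_add has_derivative_const
        bounded_linear_imp_has_derivative bounded_linear_scaleR_left)
  then have "((\<lambda>t. line t) has_derivative (\<lambda>t. t *\<^sub>R (X, u2, u3))) (at 0)"
    by (simp only: add_0)
  moreover have "(cumulant_map has_derivative \<phi>') (at (line 0))"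
    using der by (simp only: scaleR_zero_left add_0_right)
  ultimately have "((\<lambda>t. cumulant_map (line t)) has_derivative (\<lambda>t. \<phi>' (t *\<^sub>R (X, u2, u3)))) (at 0)"
    by (rule has_derivative_compose)
  moreover have "\<phi>' (t *\<^sub>R (X, u2, u3)) = t *\<^sub>R \<phi>' (X, u2, u3)" for t
    using has_derivative_linear[OF der] linear_scale by blast
  ultimately have "((\<lambda>t. cumulant_map (line t)) has_derivative (\<lambda>t. t *\<^sub>R \<phi>' (X, u2, u3))) (at 0)"
    by (simp only:)
  then have d: "((\<lambda>t. fst (cumulant_map (line t))) has_derivative (\<lambda>t. fst (t *\<^sub>R \<phi>' (X, u2, u3))))
      (at 0)"
    "((\<lambda>t. snd (cumulant_map (line t))) has_derivative (\<lambda>t. snd (t *\<^sub>R \<phi>' (X, u2, u3)))) (at 0)"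
    by (rule has_derivative_fst, rule has_derivative_snd)
  have times: "(*) d = (\<lambda>t. t * d)" for d :: real
    by (rule ext) (rule mult.commute)
  note nth = bounded_linear.has_derivative[OF bounded_linear_vec_nth]
  have "((\<lambda>t. fst (cumulant_map (line t)) $ i $ j) has_derivative
      (\<lambda>t. fst (t *\<^sub>R \<phi>' (X, u2, u3)) $ i $ j)) (at 0)"
    by (rule nth, rule nth, rule d(1))
  then have "((\<lambda>t. cumulant2 (line t) $ i $ j) has_derivative (\<lambda>t. t * S' $ i $ j)) (at 0)"
    by (simp only: cumulant_map_def fst_conv fst_scaleR vector_scaleR_component real_scaleR_def)
  then show "((\<lambda>t. cumulant2 (line t) $ i $ j) has_real_derivative S' $ i $ j) (at 0)"
    unfolding has_field_derivative_def by (subst times)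
  have "((\<lambda>t. snd (cumulant_map (line t)) $ i $ j $ k) has_derivative
      (\<lambda>t. snd (t *\<^sub>R \<phi>' (X, u2, u3)) $ i $ j $ k)) (at 0)"
    by (rule nth, rule nth, rule nth, rule d(2))
  then have "((\<lambda>t. cumulant3 (line t) $ i $ j $ k) has_derivative (\<lambda>t. t * T' $ i $ j $ k)) (at 0)"
    by (simp only: cumulant_map_def snd_conv snd_scaleR vector_scaleR_component real_scaleR_def)
  then show "((\<lambda>t. cumulant3 (line t) $ i $ j $ k) has_real_derivative T' $ i $ j $ k) (at 0)"
    unfolding has_field_derivative_def by (subst times)
qed

lemma line_entry_derivatives:
  "((\<lambda>t. fst (line t) $ i $ j) has_real_derivative X $ i $ j) (at 0)"
  "((\<lambda>t. fst (snd (line t)) $ i) has_real_derivative u2 $ i) (at 0)"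
  "((\<lambda>t. snd (snd (line t)) $ i) has_real_derivative u3 $ i) (at 0)"
proof -
  have "((\<lambda>t. a + t * b) has_real_derivative b) (at 0)" for a b :: real
    by (auto intro!: derivative_eq_intros)
  then show "((\<lambda>t. fst (line t) $ i $ j) has_real_derivative X $ i $ j) (at 0)"
    "((\<lambda>t. fst (snd (line t)) $ i) has_real_derivative u2 $ i) (at 0)"
    "((\<lambda>t. snd (snd (line t)) $ i) has_real_derivative u3 $ i) (at 0)"
    by simp_all
qed

lemma eventually_dets_line: "eventually (\<lambda>t. det2 (fst (line t)) \<noteq> 0 \<and> det3 (fst (line t)) \<noteq> 0)
    (nhds 0)"
proof -
  let ?q = "\<lambda>\<theta> :: 'n param. det2 (fst \<theta>) * det3 (fst \<theta>)"
  have "real_polynomial_function ?q"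
    by (intro real_polynomial_function.intros(4) polynomial_det2 polynomial_det3)
  then have "continuous_on UNIV ?q"
    using continuous_on_polymonial_function real_polynomial_function_eq by blast
  then have "continuous_on UNIV (\<lambda>t. ?q (line t))"
    by (rule continuous_on_compose2) (auto intro!: continuous_intros)
  then have "open ((\<lambda>t. ?q (line t)) -` (- {0}))"
    by (intro open_vimage) (auto simp: open_Compl)
  moreover have "0 \<in> (\<lambda>t. ?q (line t)) -` (- {0})" using dets by simp
  ultimately have "eventually (\<lambda>t. t \<in> (\<lambda>t. ?q (line t)) -` (- {0})) (nhds 0)"
    by (rule eventually_nhds_in_open)
  then show ?thesis by (rule eventually_mono) auto
qed

text \<open>Implicit differentiation of the Lyapunov equation along the line. The equation holds on
  a whole neighbourhood of 0, because the determinants stay non-zero there.\<close>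

lemma cumulant2_derivative_equation:
  "S' $ i $ j = contract2 X A (cumulant2 (A, w2, w3)) i j + contract2 A X (cumulant2 (A, w2, w3)) i j
     + contract2 A A S' i j + (if i = j then u2 $ i else 0)"
proof -
  let ?R = "\<lambda>t. contract2 (fst (line t)) (fst (line t)) (cumulant2 (line t)) i j
     + (if i = j then fst (snd (line t)) $ i else 0)"
  have "(?R has_real_derivative (contract2 X (fst (line 0)) (cumulant2 (line 0)) i j
      + contract2 (fst (line 0)) X (cumulant2 (line 0)) i j
      + contract2 (fst (line 0)) (fst (line 0)) S' i j) + (if i = j then u2 $ i else 0)) (at 0)"
    by (rule DERIV_add[OF contract2_has_derivative]; (cases "i = j")?)
      (use line_entry_derivatives cumulant_line_derivatives in auto)
  moreover have "eventually (\<lambda>t. cumulant2 (line t) $ i $ j = ?R t) (nhds 0)"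
    using eventually_dets_line
  proof (rule eventually_mono)
    fix t assume "det2 (fst (line t)) \<noteq> 0 \<and> det3 (fst (line t)) \<noteq> 0"
    then have "det2 (fst (line t)) \<noteq> 0" ..
    from cumulant2_equation[OF this, of "fst (snd (line t))" "snd (snd (line t))" i j]
    show "cumulant2 (line t) $ i $ j = ?R t" by simp
  qed
  ultimately have "((\<lambda>t. cumulant2 (line t) $ i $ j) has_real_derivative
      (contract2 X A (cumulant2 (A, w2, w3)) i j + contract2 A X (cumulant2 (A, w2, w3)) i j
      + contract2 A A S' i j) + (if i = j then u2 $ i else 0)) (at 0)"
    using DERIV_cong_ev[of 0 0 "\<lambda>t. cumulant2 (line t) $ i $ j" ?R] by simp
  then show ?thesis using DERIV_unique cumulant_line_derivatives(1) by blast
qed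

lemma cumulant3_derivative_equation:
  "T' $ i $ j $ k = contract3 X A A (cumulant3 (A, w2, w3)) i j k
     + contract3 A X A (cumulant3 (A, w2, w3)) i j k + contract3 A A X (cumulant3 (A, w2, w3)) i j k
     + contract3 A A A T' i j k + (if i = j \<and> j = k then u3 $ i else 0)"
proof -
  let ?R = "\<lambda>t. contract3 (fst (line t)) (fst (line t)) (fst (line t)) (cumulant3 (line t)) i j k
     + (if i = j \<and> j = k then snd (snd (line t)) $ i else 0)"
  have "(?R has_real_derivative (contract3 X (fst (line 0)) (fst (line 0)) (cumulant3 (line 0)) i j k
      + contract3 (fst (line 0)) X (fst (line 0)) (cumulant3 (line 0)) i j k
      + contract3 (fst (line 0)) (fst (line 0)) X (cumulant3 (line 0)) i j k
      + contract3 (fst (line 0)) (fst (line 0)) (fst (line 0)) T' i j k)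
      + (if i = j \<and> j = k then u3 $ i else 0)) (at 0)"
    by (rule DERIV_add[OF contract3_has_derivative]; (cases "i = j \<and> j = k")?)
      (use line_entry_derivatives cumulant_line_derivatives in auto)
  moreover have "eventually (\<lambda>t. cumulant3 (line t) $ i $ j $ k = ?R t) (nhds 0)"
    using eventually_dets_line
  proof (rule eventually_mono)
    fix t assume "det2 (fst (line t)) \<noteq> 0 \<and> det3 (fst (line t)) \<noteq> 0"
    then have "det3 (fst (line t)) \<noteq> 0" ..
    from cumulant3_equation[OF this, of "fst (snd (line t))" "snd (snd (line t))" i j k]
    show "cumulant3 (line t) $ i $ j $ k = ?R t" by simp
  qed
  ultimately have "((\<lambda>t. cumulant3 (line t) $ i $ j $ k) has_real_derivative
      (contract3 X A A (cumulant3 (A, w2, w3)) i j k + contract3 A X A (cumulant3 (A, w2, w3)) i j k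
      + contract3 A A X (cumulant3 (A, w2, w3)) i j k
      + contract3 A A A T' i j k) + (if i = j \<and> j = k then u3 $ i else 0)) (at 0)"
    using DERIV_cong_ev[of 0 0 "\<lambda>t. cumulant3 (line t) $ i $ j $ k" ?R] by simp
  then show ?thesis using DERIV_unique cumulant_line_derivatives(2) by blast
qed

end

text \<open>A vanishing derivative reduces the differentiated equations to the Jacobian rows plus
  the noise directions. The latter are absent off the diagonal, which forces \<open>X = 0\<close>;
  the diagonal equations then read \<open>u2 = 0\<close> and \<open>u3 = 0\<close>.\<close>

lemma cumulant_derivative_injective:
  assumes dets: "det2 A \<noteq> 0" "det3 A \<noteq> 0"
    and der: "(cumulant_map has_derivative \<phi>') (at (A, w2, w3))"
    and inj: "jac_injective E A (cumulant2 (A, w2, w3)) (cumulant3 (A, w2, w3))"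
    and X: "X \<in> graph_matrices E" and zero: "\<phi>' (X, u2, u3) = 0"
  shows "(X, u2, u3) = 0"
proof -
  let ?S = "cumulant2 (A, w2, w3)" and ?T = "cumulant3 (A, w2, w3)"
  have z2: "contract2 A A 0 i j = 0" and z3: "contract3 A A A 0 i j k = 0" for i j k
    by (simp_all add: contract2_def contract3_def)
  have e2: "jac2 A ?S X i j + (if i = j then u2 $ i else 0) = 0" for i j
    using cumulant2_derivative_equation[OF dets der, of X u2 u3 i j] zero
    by (simp add: jac2_def z2)
  have e3: "jac3 A ?T X i j k + (if i = j \<and> j = k then u3 $ i else 0) = 0" for i j k
    using cumulant3_derivative_equation[OF dets der, of X u2 u3 i j k] zero
    by (simp add: jac3_def z3)
  have "jac2 A ?S X i j = 0" if "i \<noteq> j" for i j using e2[of i j] that by simp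
  moreover have "jac3 A ?T X i j k = 0" if "\<not> (i = j \<and> j = k)" for i j k
    using e3[of i j k] that by auto
  ultimately have "jac_vanishes A ?S ?T X" unfolding jac_vanishes_def by blast
  then have "X = 0" using inj X unfolding jac_injective_def by blast
  moreover have "jac2 A ?S 0 i j = 0" "jac3 A ?T 0 i j k = 0" for i j k
    by (simp_all add: jac2_def jac3_def contract2_def contract3_def)
  ultimately have "u2 $ i = 0" "u3 $ i = 0" for i
    using e2[of i i] e3[of i i i] by simp_all
  then show ?thesis using \<open>X = 0\<close> by (simp add: vec_eq_iff zero_prod_def)
qed

text \<open>The difference of \<open>S\<close> and its transpose solves the homogeneous Lyapunov
  equation, whose only solution for stable \<open>A\<close> is zero.\<close>

lemma cumulant2_symmetric:
  assumes "schur_stable A"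
  shows "symmetric2 (cumulant2 (A, w2, w3))"
proof -
  let ?S = "cumulant2 (A, w2, w3)"
  define D where "D = (\<chi> i j. ?S $ i $ j - ?S $ j $ i)"
  have "D = 0"
  proof (rule contract2_fixed_point_zero[OF assms])
    fix i j
    have "contract2 A A D i j = contract2 A A ?S i j - contract2 A A ?S j i"
    proof -
      have "contract2 A A ?S j i = (\<Sum>l\<in>UNIV. \<Sum>m\<in>UNIV. A $ i $ l * A $ j $ m * ?S $ m $ l)"
        unfolding contract2_def by (subst sum.swap) (simp only: mult.commute)
      then show ?thesis
        by (simp add: contract2_def D_def right_diff_distrib sum_subtractf)
    qed
    then show "D $ i $ j = contract2 A A D i j"
      using cumulant2_equation[OF schur_stable_det2[OF assms], of w2 w3 i j]
        cumulant2_equation[OF schur_stable_det2[OF assms], of w2 w3 j i]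
      by (auto simp: D_def)
  qed
  then show ?thesis by (auto simp: D_def symmetric2_def vec_eq_iff)
qed

lemma cumulant3_symmetric:
  assumes "schur_stable A"
  shows "symmetric3 (cumulant3 (A, w2, w3))"
proof -
  let ?T = "cumulant3 (A, w2, w3)"
  note eq = cumulant3_equation[OF schur_stable_det3[OF assms], of w2 w3]
  define D where "D = (\<chi> i j k. ?T $ i $ j $ k - ?T $ j $ i $ k)"
  have "D = 0"
  proof (rule contract3_fixed_point_zero[OF assms])
    fix i j k
    have "contract3 A A A D i j k = contract3 A A A ?T i j k - contract3 A A A ?T j i k"
    proof -
      have "contract3 A A A ?T j i k =
          (\<Sum>l\<in>UNIV. \<Sum>m\<in>UNIV. \<Sum>q\<in>UNIV. A $ i $ l * A $ j $ m * A $ k $ q * ?T $ m $ l $ q)"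
        unfolding contract3_def by (subst sum.swap) (simp only: mult.commute)
      then show ?thesis
        by (simp add: contract3_def D_def right_diff_distrib sum_subtractf)
    qed
    then show "D $ i $ j $ k = contract3 A A A D i j k"
      using eq[of i j k] eq[of j i k] by (auto simp: D_def)
  qed
  then have s12: "?T $ i $ j $ k = ?T $ j $ i $ k" for i j k by (auto simp: D_def vec_eq_iff)
  define D' where "D' = (\<chi> i j k. ?T $ i $ j $ k - ?T $ i $ k $ j)"
  have "D' = 0"
  proof (rule contract3_fixed_point_zero[OF assms])
    fix i j k
    have "contract3 A A A D' i j k = contract3 A A A ?T i j k - contract3 A A A ?T i k j"
    proof -
      have "contract3 A A A ?T i k j =
          (\<Sum>l\<in>UNIV. \<Sum>m\<in>UNIV. \<Sum>q\<in>UNIV. A $ i $ l * A $ k $ q * A $ j $ m * ?T $ l $ q $ m)"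
        unfolding contract3_def by (rule sum.cong[OF refl]) (rule sum.swap)
      then show ?thesis
        by (simp add: contract3_def D'_def right_diff_distrib sum_subtractf mult.assoc
            mult.left_commute[of "A $ k $ _"])
    qed
    then show "D' $ i $ j $ k = contract3 A A A D' i j k"
      using eq[of i j k] eq[of i k j] by (auto simp: D'_def)
  qed
  then have "?T $ i $ j $ k = ?T $ i $ k $ j" for i j k by (auto simp: D'_def vec_eq_iff)
  then show ?thesis using s12 unfolding symmetric3_def by blast
qed

text \<open>One determinant would clear each single row, but both are multiplied in throughout: the
  polynomial matrix is then a non-zero multiple of \<open>J_off\<close> and has the same
  kernel.\<close>

lemma J_off_entry_polynomial:
  fixes E :: "('n::{finite,linorder} \<times> 'n) set"
  shows "\<exists>p. real_polynomial_function p \<and> (\<forall>\<theta>. det2 (fst \<theta>) \<noteq> 0 \<longrightarrow> det3 (fst \<theta>) \<noteq> 0 \<longrightarrow>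
    p \<theta> = det2 (fst \<theta>) * det3 (fst \<theta>) * J_off E (cumulant2 \<theta>) (cumulant3 \<theta>) (fst \<theta>) $ r $ e)"
proof -
  obtain a b where e: "e = (a, b)" by (cases e)
  let ?U = "unit_matrix b a"
  show ?thesis
  proof (cases r)
    case (Inl ij)
    obtain i j where ij: "ij = (i, j)" by (cases ij)
    show ?thesis
    proof (cases "i \<le> j \<and> i \<noteq> j \<and> (a, b) \<in> E")
      case True
      let ?p = "\<lambda>\<theta> :: 'n param. \<Sum>l\<in>UNIV. \<Sum>m\<in>UNIV.
        (?U $ i $ l * fst \<theta> $ j $ m + fst \<theta> $ i $ l * ?U $ j $ m) * (det3 (fst \<theta>) * numerator2 l m \<theta>)"
      have "real_polynomial_function ?p"
        by (intro real_polynomial_function_sum real_polynomial_function.intros(2,3,4) finite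
            polynomial_det3 polynomial_numerator2 polynomial_param_entries)
      moreover have "?p \<theta> = det2 (fst \<theta>) * det3 (fst \<theta>) *
          J_off E (cumulant2 \<theta>) (cumulant3 \<theta>) (fst \<theta>) $ r $ e"
        if "det2 (fst \<theta>) \<noteq> 0" for \<theta>
      proof -
        have "J_off E (cumulant2 \<theta>) (cumulant3 \<theta>) (fst \<theta>) $ r $ e =
            contract2 ?U (fst \<theta>) (cumulant2 \<theta>) i j + contract2 (fst \<theta>) ?U (cumulant2 \<theta>) i j"
          using True unfolding Inl ij e
          by (simp add: J_off_def J2_def matrix_vector_mult_add_rdistrib kron_vec2)
        then show ?thesis
          unfolding cumulant2_numerator[OF that, symmetric] contract2_def
          by (simp add: sum_distrib_left distrib_left distrib_right sum.distrib mult_ac)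
      qed
      ultimately show ?thesis by blast
    next
      case False
      then show ?thesis unfolding Inl ij e
        by (intro exI[of _ "\<lambda>_. 0"]) (auto simp: J_off_def J2_def intro:
            real_polynomial_function.intros(2))
    qed
  next
    case (Inr ijk)
    obtain i j k where ijk: "ijk = (i, j, k)" by (cases ijk)
    show ?thesis
    proof (cases "i \<le> j \<and> j \<le> k \<and> \<not> (i = j \<and> j = k) \<and> (a, b) \<in> E")
      case True
      let ?p = "\<lambda>\<theta> :: 'n param. \<Sum>l\<in>UNIV. \<Sum>m\<in>UNIV. \<Sum>q\<in>UNIV.
        (?U $ i $ l * fst \<theta> $ j $ m * fst \<theta> $ k $ q + fst \<theta> $ i $ l * ?U $ j $ m * fst \<theta> $ k $ q
          + fst \<theta> $ i $ l * fst \<theta> $ j $ m * ?U $ k $ q) * (det2 (fst \<theta>) * numerator3 l m q \<theta>)"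
      have "real_polynomial_function ?p"
        by (intro real_polynomial_function_sum real_polynomial_function.intros(2,3,4) finite
            polynomial_det2 polynomial_numerator3 polynomial_param_entries)
      moreover have "?p \<theta> = det2 (fst \<theta>) * det3 (fst \<theta>) *
          J_off E (cumulant2 \<theta>) (cumulant3 \<theta>) (fst \<theta>) $ r $ e"
        if "det3 (fst \<theta>) \<noteq> 0" for \<theta>
      proof -
        have "J_off E (cumulant2 \<theta>) (cumulant3 \<theta>) (fst \<theta>) $ r $ e =
            contract3 ?U (fst \<theta>) (fst \<theta>) (cumulant3 \<theta>) i j k + contract3 (fst \<theta>) ?U (fst \<theta>)
                (cumulant3 \<theta>) i j k
            + contract3 (fst \<theta>) (fst \<theta>) ?U (cumulant3 \<theta>) i j k"
          using True unfolding Inr ijk e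
          by (simp add: J_off_def J3_def matrix_vector_mult_add_rdistrib kron_vec3)
        then show ?thesis
          unfolding cumulant3_numerator[OF that, symmetric] contract3_def
          by (simp add: sum_distrib_left distrib_left distrib_right sum.distrib mult_ac)
      qed
      ultimately show ?thesis by blast
    next
      case False
      then show ?thesis unfolding Inr ijk e
        by (intro exI[of _ "\<lambda>_. 0"]) (auto simp: J_off_def J3_def intro:
            real_polynomial_function.intros(2))
    qed
  qed
qed

text \<open>
  The added diagonal entries make up for the columns of non-edges, which vanish in the Jacobian.
\<close>

lemma gram_det_nonzero_iff:
  fixes J P :: "real^'c^'r"
  assumes c: "c \<noteq> 0" and P: "P = c *\<^sub>R J"
  shows "det (\<chi> e e'. (\<Sum>r\<in>UNIV. P $ r $ e * P $ r $ e') + of_bool (e = e' \<and> e \<notin> E)) \<noteq> 0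
    \<longleftrightarrow> (\<forall>x. (\<forall>e. e \<notin> E \<longrightarrow> x $ e = 0) \<longrightarrow> J *v x = 0 \<longrightarrow> x = 0)" (is "det ?G \<noteq> 0 \<longleftrightarrow> _")
proof -
  define D where "D x = (\<chi> e. of_bool (e \<notin> E) * x $ e)" for x :: "real^'c"
  have G: "?G *v x = transpose P *v (P *v x) + D x" for x
  proof -
    have "(?G *v x) $ e = (transpose P *v (P *v x) + D x) $ e" for e
    proof -
      have "(\<Sum>e'\<in>UNIV. of_bool (e = e' \<and> e \<notin> E) * x $ e') = (\<Sum>e'\<in>UNIV. if e' = e then of_bool (e \<notin>
          E) * x $ e else 0)"
        by (rule sum.cong) auto
      moreover have "(\<Sum>e'\<in>UNIV. (\<Sum>r\<in>UNIV. P $ r $ e * P $ r $ e') * x $ e')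
          = (\<Sum>r\<in>UNIV. P $ r $ e * (\<Sum>e'\<in>UNIV. P $ r $ e' * x $ e'))"
        unfolding sum_distrib_left sum_distrib_right by (subst sum.swap) (simp add: mult.assoc)
      ultimately show ?thesis
        by (simp add: matrix_vector_mult_def transpose_def D_def distrib_right sum.distrib)
    qed
    then show ?thesis by (simp add: vec_eq_iff)
  qed
  have Px: "P *v x = c *\<^sub>R (J *v x)" for x
    unfolding P by (simp add: scaleR_matrix_vector_assoc)
  have ker: "?G *v x = 0 \<longleftrightarrow> (\<forall>e. e \<notin> E \<longrightarrow> x $ e = 0) \<and> J *v x = 0" for x
  proof
    assume "?G *v x = 0"
    \<comment> \<open>Pairing with \<open>x\<close> turns the quadratic form into a sum of squares:
      the squared norm of \<open>P *v x\<close> and the squares of the non-edge coordinates. Both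
      parts must vanish.\<close>
    then have "x \<bullet> (transpose P *v (P *v x)) + x \<bullet> D x = 0"
      using G by (metis inner_add_right inner_zero_right)
    moreover have "x \<bullet> (transpose P *v (P *v x)) = (P *v x) \<bullet> (P *v x)"
      by (simp only: dot_lmul_matrix[symmetric] vector_transpose_matrix)
    moreover have "x \<bullet> D x = (\<Sum>e\<in>UNIV. of_bool (e \<notin> E) * (x $ e)\<^sup>2)"
      by (simp add: inner_vec_def D_def power2_eq_square mult_ac)
    moreover have "(\<Sum>e\<in>UNIV. of_bool (e \<notin> E) * (x $ e)\<^sup>2) \<ge> 0"
      by (intro sum_nonneg) auto
    moreover have "(P *v x) \<bullet> (P *v x) \<ge> 0" by simp
    ultimately have z: "(P *v x) \<bullet> (P *v x) = 0" "(\<Sum>e\<in>UNIV. of_bool (e \<notin> E) * (x $ e)\<^sup>2) = 0"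
      by linarith+
    have "J *v x = 0" using z(1) c Px by simp
    moreover have "x $ e = 0" if "e \<notin> E" for e
    proof -
      have "\<forall>e\<in>UNIV. of_bool (e \<notin> E) * (x $ e)\<^sup>2 = 0"
        using z(2) by (subst (asm) sum_nonneg_eq_0_iff) auto
      then have "of_bool (e \<notin> E) * (x $ e)\<^sup>2 = 0" by (rule bspec) simp
      then show ?thesis using that by simp
    qed
    ultimately show "(\<forall>e. e \<notin> E \<longrightarrow> x $ e = 0) \<and> J *v x = 0" by blast
  next
    assume x: "(\<forall>e. e \<notin> E \<longrightarrow> x $ e = 0) \<and> J *v x = 0"
    then have "D x = 0" by (auto simp: D_def vec_eq_iff)
    then show "?G *v x = 0" using x unfolding G Px by simp
  qed
  show ?thesis
    unfolding invertible_det_nz[symmetric] invertible_left_inverse matrix_left_invertible_ker ker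
        imp_conjL ..
qed

text \<open>Over the reals a Gram determinant is non-zero exactly when the columns are independent,
  so one polynomial replaces the family of maximal minors.\<close>

lemma jac_injective_polynomial:
  fixes E :: "('n::{finite,linorder} \<times> 'n) set"
  shows "\<exists>h. real_polynomial_function h \<and> (\<forall>\<theta>. schur_stable (fst \<theta>) \<longrightarrow>
    (h \<theta> \<noteq> 0 \<longleftrightarrow> jac_injective E (fst \<theta>) (cumulant2 \<theta>) (cumulant3 \<theta>)))"
proof -
  obtain p where p: "\<And>r e. real_polynomial_function (p r e)"
    "\<And>r e \<theta>. det2 (fst \<theta>) \<noteq> 0 \<Longrightarrow> det3 (fst \<theta>) \<noteq> 0 \<Longrightarrow>
      p r e \<theta> = det2 (fst \<theta>) * det3 (fst \<theta>) * J_off E (cumulant2 \<theta>) (cumulant3 \<theta>) (fst \<theta>) $ r $ e"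
    using J_off_entry_polynomial[of E] by metis
  define h where "h \<theta> = det (\<chi> e e'. (\<Sum>r\<in>UNIV. p r e \<theta> * p r e' \<theta>) + of_bool (e = e' \<and> e \<notin> E))" for \<theta>
  have "real_polynomial_function h"
    unfolding h_def[abs_def]
    by (rule real_polynomial_function_det)
      (auto intro!: real_polynomial_function_sum real_polynomial_function.intros(2,3,4) p(1))
  moreover have "h \<theta> \<noteq> 0 \<longleftrightarrow> jac_injective E (fst \<theta>) (cumulant2 \<theta>) (cumulant3 \<theta>)"
    if st: "schur_stable (fst \<theta>)" for \<theta>
  proof -
    note d = schur_stable_det2[OF st] schur_stable_det3[OF st]
    have "symmetric2 (cumulant2 \<theta>)" "symmetric3 (cumulant3 \<theta>)"
      using cumulant2_symmetric[OF st] cumulant3_symmetric[OF st] by (metis prod.collapse)+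
    note inj = jac_injective_iff_J_off[OF this, of E "fst \<theta>"]
    let ?P = "\<chi> r e. p r e \<theta>"
    have "?P = (det2 (fst \<theta>) * det3 (fst \<theta>)) *\<^sub>R J_off E (cumulant2 \<theta>) (cumulant3 \<theta>) (fst \<theta>)"
      using p(2)[OF d] by (simp add: vec_eq_iff)
    from gram_det_nonzero_iff[OF _ this, of E] show ?thesis
      using d inj unfolding h_def by simp
  qed
  ultimately show ?thesis by blast
qed

lemma rank_J_off:
  fixes E :: "('n::{finite,linorder} \<times> 'n) set"
  assumes "schur_stable (fst \<theta>)" "jac_injective E (fst \<theta>) (cumulant2 \<theta>) (cumulant3 \<theta>)"
  shows "rank (J_off E (cumulant2 \<theta>) (cumulant3 \<theta>) (fst \<theta>)) = card E"
proof -
  have "symmetric2 (cumulant2 \<theta>)" "symmetric3 (cumulant3 \<theta>)"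
    using cumulant2_symmetric[OF assms(1)] cumulant3_symmetric[OF assms(1)] by (metis prod.collapse)+
  note inj = jac_injective_iff_J_off[OF this, of E "fst \<theta>"]
  show ?thesis
    by (rule rank_eq_card_if_injective_on_support[OF J_off_nonedge_column]) (use inj assms(2) in auto)
qed

text \<open>At a coordinate of largest modulus, an eigenvector bounds \<open>cmod z\<close> by the
  absolute row sum. The criterion is explicit and survives small changes of
  \<open>A\<close>.\<close>

lemma schur_stable_row_sums:
  fixes A :: "'n::finite matrix"
  assumes "\<And>i. (\<Sum>l\<in>UNIV. \<bar>A $ i $ l\<bar>) < 1"
  shows "schur_stable A"
  unfolding schur_stable_def
proof (intro allI impI)
  fix z assume "eigenvalue (map_matrix complex_of_real A) z"
  then obtain v where v: "v \<noteq> 0" "map_matrix complex_of_real A *v v = z *s v"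
    unfolding eigenvalue_def by blast
  obtain i where i: "\<And>l. cmod (v $ l) \<le> cmod (v $ i)"
  proof -
    have "Max (range (\<lambda>l. cmod (v $ l))) \<in> range (\<lambda>l. cmod (v $ l))" by (rule Max_in) auto
    then obtain i where "cmod (v $ i) = Max (range (\<lambda>l. cmod (v $ l)))" by (metis imageE)
    then have "cmod (v $ l) \<le> cmod (v $ i)" for l by simp
    then show thesis using that by blast
  qed
  have pos: "cmod (v $ i) > 0"
  proof (rule ccontr)
    assume "\<not> ?thesis"
    then have "v $ l = 0" for l using i[of l] norm_ge_zero[of "v $ l"] by (metis dual_order.antisym
        norm_eq_zero not_less order_trans)
    then show False using v(1) by (simp add: vec_eq_iff)
  qed
  have "z * v $ i = (\<Sum>l\<in>UNIV. complex_of_real (A $ i $ l) * v $ l)"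
    using arg_cong[OF v(2), of "\<lambda>x. x $ i"] by (simp add: matrix_vector_mult_def map_matrix_def)
  then have "cmod z * cmod (v $ i) \<le> (\<Sum>l\<in>UNIV. \<bar>A $ i $ l\<bar> * cmod (v $ l))"
    by (metis (no_types, lifting) norm_mult norm_of_real norm_sum sum.cong)
  also have "\<dots> \<le> (\<Sum>l\<in>UNIV. \<bar>A $ i $ l\<bar> * cmod (v $ i))"
    by (intro sum_mono mult_left_mono i) auto
  also have "\<dots> < 1 * cmod (v $ i)"
    unfolding sum_distrib_right[symmetric] using assms pos by (rule mult_strict_right_mono)
  finally show "cmod z < 1" using pos by simp
qed

section \<open>First-order perturbation\<close>

text \<open>
  Unit vectors \<open>x\<^sub>n\<close> in the kernels of \<open>L e\<^sub>n\<close> accumulate at some \<open>x\<^sub>0\<close> with \<open>L 0 x\<^sub>0 = 0\<close>, and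
  \<open>L1 x\<^sub>0\<close> is a limit of elements of \<open>L 0 ` K\<close>. This subspace is closed, so no convergence of
  \<open>(x\<^sub>n - x\<^sub>0) / e\<^sub>n\<close> is needed to find the first-order correction \<open>y\<close>.
\<close>

lemma perturbed_injective:
  fixes L :: "real \<Rightarrow> 'v::euclidean_space \<Rightarrow> 'w::euclidean_space"
  assumes lin: "\<And>e. linear (L e)"
    and der: "\<And>x. ((\<lambda>e. (L e x - L 0 x) /\<^sub>R e) \<longlongrightarrow> L1 x) (at 0)"
    and K: "subspace K"
    and cond: "\<And>x y. x \<in> K \<Longrightarrow> y \<in> K \<Longrightarrow> L 0 x = 0 \<Longrightarrow> L 0 y + L1 x = 0 \<Longrightarrow> x = 0"
  shows "eventually (\<lambda>e. \<forall>x\<in>K. L e x = 0 \<longrightarrow> x = 0) (at 0)"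
proof (rule ccontr)
  assume neg: "\<not> ?thesis"
  have "\<exists>e x. e \<noteq> 0 \<and> \<bar>e\<bar> < inverse (real (Suc n)) \<and> x \<in> K \<and> L e x = 0 \<and> norm x = 1" for n
  proof -
    have "\<exists>e. e \<noteq> 0 \<and> dist e 0 < inverse (real (Suc n)) \<and> \<not> (\<forall>x\<in>K. L e x = 0 \<longrightarrow> x = 0)"
      using neg unfolding eventually_at by (metis UNIV_I inverse_positive_iff_positive
          of_nat_0_less_iff zero_less_Suc)
    then obtain e x where ex: "e \<noteq> 0" "dist e 0 < inverse (real (Suc n))" "x \<in> K" "L e x = 0" "x \<noteq> 0"
      by blast
    have "L e ((1 / norm x) *\<^sub>R x) = 0" using linear_scale[OF lin] ex by simp
    moreover have "(1 / norm x) *\<^sub>R x \<in> K" using K ex(3) by (rule subspace_scale)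
    moreover have "norm ((1 / norm x) *\<^sub>R x) = 1" using ex by simp
    ultimately show ?thesis using ex by (metis dist_0_norm dist_commute real_norm_def)
  qed
  then obtain e x where e: "\<And>n. e n \<noteq> 0" "\<And>n. \<bar>e n\<bar> < inverse (real (Suc n))"
    and x: "\<And>n. x n \<in> K" "\<And>n. L (e n) (x n) = 0" "\<And>n. norm (x n) = 1" by metis
  have "\<And>n. x n \<in> sphere 0 1" using x(3) by simp
  then obtain x0 \<rho> where x0: "x0 \<in> sphere 0 1" and \<rho>: "strict_mono (\<rho> :: nat \<Rightarrow> nat)"
    and conv: "(x \<circ> \<rho>) \<longlonglongrightarrow> x0"
    using compact_sphere[of 0 1] unfolding compact_def by metis
  have "closed K" using K by (rule closed_subspace)
  then have "x0 \<in> K" by (rule closed_sequentially[OF _ _ conv]) (use x(1) in auto)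
  have "(\<lambda>n. e n) \<longlonglongrightarrow> 0"
    by (rule tendsto_rabs_zero_cancel, rule tendsto_sandwich[of "\<lambda>_. 0", OF _ _ tendsto_const
        LIMSEQ_inverse_real_of_nat])
      (use e(2) in \<open>auto intro!: always_eventually less_imp_le\<close>)
  then have elim: "(\<lambda>n. e (\<rho> n)) \<longlonglongrightarrow> 0"
    using LIMSEQ_subseq_LIMSEQ[OF _ \<rho>] by (simp add: o_def)
  then have efil: "filterlim (\<lambda>n. e (\<rho> n)) (at 0) sequentially"
    using e(1) by (simp add: filterlim_at)
  define D where "D t y = (L t y - L 0 y) /\<^sub>R t" for t y
  \<comment> \<open>Expansion in the basis upgrades convergence of the difference quotients at fixed
    vectors to convergence along the moving vectors \<open>x (\<rho> n)\<close>.\<close>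
  have Dlin: "D t y = (\<Sum>b\<in>Basis. (y \<bullet> b) *\<^sub>R D t b)" for t y
  proof -
    have "linear (D t)" unfolding D_def using lin
      by (auto simp: linear_iff scaleR_add_right scaleR_diff_right algebra_simps)
    then have "D t (\<Sum>b\<in>Basis. (y \<bullet> b) *\<^sub>R b) = (\<Sum>b\<in>Basis. (y \<bullet> b) *\<^sub>R D t b)"
      by (simp add: linear_sum linear_scale)
    then show ?thesis by (simp only: euclidean_representation)
  qed
  have Dlim: "(\<lambda>n. D (e (\<rho> n)) b) \<longlonglongrightarrow> L1 b" for b
    using filterlim_compose[OF der efil] by (simp add: D_def)
  have L1: "L1 x0 = (\<Sum>b\<in>Basis. (x0 \<bullet> b) *\<^sub>R L1 b)"
  proof (rule LIMSEQ_unique[OF Dlim])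
    show "(\<lambda>n. D (e (\<rho> n)) x0) \<longlonglongrightarrow> (\<Sum>b\<in>Basis. (x0 \<bullet> b) *\<^sub>R L1 b)"
      by (subst Dlin) (intro tendsto_intros Dlim)
  qed
  have Dx: "(\<lambda>n. D (e (\<rho> n)) (x (\<rho> n))) \<longlonglongrightarrow> L1 x0"
    unfolding L1
    by (subst Dlin) (intro tendsto_intros Dlim conv[unfolded o_def])
  have L0x: "L 0 (x (\<rho> n)) = - e (\<rho> n) *\<^sub>R D (e (\<rho> n)) (x (\<rho> n))" for n
    using e(1)[of "\<rho> n"] x(2)[of "\<rho> n"] by (simp add: D_def)
  have "(\<lambda>n. L 0 (x (\<rho> n))) \<longlonglongrightarrow> - 0 *\<^sub>R L1 x0"
    unfolding L0x by (intro tendsto_intros elim Dx)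
  moreover have "(\<lambda>n. L 0 (x (\<rho> n))) \<longlonglongrightarrow> L 0 x0"
    using lin conv by (intro bounded_linear.tendsto[of "L 0"]) (simp_all add:
        linear_conv_bounded_linear o_def)
  ultimately have z0: "L 0 x0 = 0" using LIMSEQ_unique by fastforce
  have "closed (L 0 ` K)"
    using closed_subspace linear_subspace_image[OF lin K] by blast
  moreover have "- D (e (\<rho> n)) (x (\<rho> n)) \<in> L 0 ` K" for n
  proof
    show "- D (e (\<rho> n)) (x (\<rho> n)) = L 0 ((1 / e (\<rho> n)) *\<^sub>R x (\<rho> n))"
      using e(1)[of "\<rho> n"] by (simp add: linear_scale[OF lin] L0x)
    show "(1 / e (\<rho> n)) *\<^sub>R x (\<rho> n) \<in> K" using K x(1) by (rule subspace_scale)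
  qed
  moreover have "(\<lambda>n. - D (e (\<rho> n)) (x (\<rho> n))) \<longlonglongrightarrow> - L1 x0"
    using Dx by (rule tendsto_minus)
  ultimately have "- L1 x0 \<in> L 0 ` K" by (rule closed_sequentially)
  then obtain y where "y \<in> K" "L 0 y = - L1 x0" by auto
  then have "x0 = 0" using cond[OF \<open>x0 \<in> K\<close> \<open>y \<in> K\<close> z0] by simp
  then show False using x0 by simp
qed

text \<open>Packs the off-diagonal rows into one vector, so that the Jacobian is a linear map
  between Euclidean spaces, as the perturbation criterion expects.\<close>

definition jac_rows :: "'n::finite matrix \<Rightarrow> 'n matrix \<Rightarrow> 'n tensor \<Rightarrow> 'n matrix
    \<Rightarrow> real^(('n \<times> 'n) + ('n \<times> 'n \<times> 'n))" where
  "jac_rows A S T X = (\<chi> r. case r of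
       Inl (i, j) \<Rightarrow> if i \<noteq> j then jac2 A S X i j else 0
     | Inr (i, j, k) \<Rightarrow> if \<not> (i = j \<and> j = k) then jac3 A T X i j k else 0)"

text \<open>Product rule for \<open>jac2\<close> when the matrix moves with velocity
  \<open>B\<close> and the cumulant with velocity \<open>S1\<close>, while the argument
  \<open>X\<close> stays fixed.\<close>

definition jac2_deriv :: "'n::finite matrix \<Rightarrow> 'n matrix \<Rightarrow> 'n matrix \<Rightarrow> 'n matrix \<Rightarrow> 'n matrix
    \<Rightarrow> 'n \<Rightarrow> 'n \<Rightarrow> real" where
  "jac2_deriv A B S S1 X i j = contract2 X B S i j + contract2 X A S1 i j
     + contract2 B X S i j + contract2 A X S1 i j"

definition jac3_deriv :: "'n::finite matrix \<Rightarrow> 'n matrix \<Rightarrow> 'n tensor \<Rightarrow> 'n tensor \<Rightarrow> 'n matrix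
    \<Rightarrow> 'n \<Rightarrow> 'n \<Rightarrow> 'n \<Rightarrow> real" where
  "jac3_deriv A B T T1 X i j k =
     contract3 X B A T i j k + contract3 X A B T i j k + contract3 X A A T1 i j k
     + contract3 B X A T i j k + contract3 A X B T i j k + contract3 A X A T1 i j k
     + contract3 B A X T i j k + contract3 A B X T i j k + contract3 A A X T1 i j k"

lemma contract2_linear:
  "contract2 (X + Y) A S i j = contract2 X A S i j + contract2 Y A S i j"
  "contract2 A (X + Y) S i j = contract2 A X S i j + contract2 A Y S i j"
  "contract2 (c *\<^sub>R X) A S i j = c * contract2 X A S i j"
  "contract2 A (c *\<^sub>R X) S i j = c * contract2 A X S i j"
  by (simp_all add: contract2_def sum.distrib distrib_left distrib_right sum_distrib_left
      mult.assoc mult.left_commute[of _ c])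

lemma contract3_linear:
  "contract3 (X + Y) A B T i j k = contract3 X A B T i j k + contract3 Y A B T i j k"
  "contract3 A (X + Y) B T i j k = contract3 A X B T i j k + contract3 A Y B T i j k"
  "contract3 A B (X + Y) T i j k = contract3 A B X T i j k + contract3 A B Y T i j k"
  "contract3 (c *\<^sub>R X) A B T i j k = c * contract3 X A B T i j k"
  "contract3 A (c *\<^sub>R X) B T i j k = c * contract3 A X B T i j k"
  "contract3 A B (c *\<^sub>R X) T i j k = c * contract3 A B X T i j k"
  by (simp_all add: contract3_def sum.distrib distrib_left distrib_right sum_distrib_left
      mult.assoc mult.left_commute[of _ c])

lemma linear_jac_rows: "linear (jac_rows A S T)"
  by (rule linearI)
    (auto simp: jac_rows_def vec_eq_iff jac2_def jac3_def contract2_linear contract3_linear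
      distrib_left split: sum.split prod.split)

lemma jac_rows_zero_iff: "jac_rows A S T X = 0 \<longleftrightarrow> jac_vanishes A S T X"
proof
  assume z: "jac_rows A S T X = 0"
  have "jac2 A S X i j = 0" if "i \<noteq> j" for i j
    using that arg_cong[OF z, of "\<lambda>v. v $ Inl (i, j)"] by (simp add: jac_rows_def)
  moreover have "jac3 A T X i j k = 0" if "\<not> (i = j \<and> j = k)" for i j k
    using that arg_cong[OF z, of "\<lambda>v. v $ Inr (i, j, k)"] by (auto simp: jac_rows_def split: if_splits)
  ultimately show "jac_vanishes A S T X" unfolding jac_vanishes_def by blast
next
  assume "jac_vanishes A S T X"
  then show "jac_rows A S T X = 0"
    by (auto simp: jac_rows_def jac_vanishes_def vec_eq_iff split: sum.split)
qed

lemma subspace_graph_matrices: "subspace (graph_matrices E)"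
  by (auto simp: graph_matrices_def subspace_def)

context
  fixes A B :: "'n::finite matrix" and w2 w3 :: "real^'n" and E :: "('n \<times> 'n) set"
  assumes stable: "schur_stable A"
    and cond: "\<And>S1 T1 X Y. X \<in> graph_matrices E \<Longrightarrow> Y \<in> graph_matrices E \<Longrightarrow>
      (\<And>i j. S1 $ i $ j = contract2 B A (cumulant2 (A, w2, w3)) i j
         + contract2 A B (cumulant2 (A, w2, w3)) i j + contract2 A A S1 i j) \<Longrightarrow>
      (\<And>i j k. T1 $ i $ j $ k = contract3 B A A (cumulant3 (A, w2, w3)) i j k
         + contract3 A B A (cumulant3 (A, w2, w3)) i j k
         + contract3 A A B (cumulant3 (A, w2, w3)) i j k + contract3 A A A T1 i j k) \<Longrightarrow>
      jac_vanishes A (cumulant2 (A, w2, w3)) (cumulant3 (A, w2, w3)) X \<Longrightarrow>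
      (\<And>i j. i \<noteq> j \<Longrightarrow> jac2 A (cumulant2 (A, w2, w3)) Y i j
         + jac2_deriv A B (cumulant2 (A, w2, w3)) S1 X i j = 0) \<Longrightarrow>
      (\<And>i j k. \<not> (i = j \<and> j = k) \<Longrightarrow> jac3 A (cumulant3 (A, w2, w3)) Y i j k
         + jac3_deriv A B (cumulant3 (A, w2, w3)) T1 X i j k = 0) \<Longrightarrow> X = 0"
begin

text \<open>The velocities \<open>S1\<close> and \<open>T1\<close> of the cumulants enter the
  assumption through the differentiated Lyapunov equations, in which the noise is constant.
  \<open>X\<close> plays the limiting kernel vector and \<open>Y\<close> its first-order
  correction.\<close>

lemma jac_injective_perturbed:
  "eventually (\<lambda>e. jac_injective E (A + e *\<^sub>R B)
     (cumulant2 (A + e *\<^sub>R B, w2, w3)) (cumulant3 (A + e *\<^sub>R B, w2, w3))) (at 0)"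
proof -
  note dets = schur_stable_det2[OF stable] schur_stable_det3[OF stable]
  obtain \<phi>' where der: "(cumulant_map has_derivative \<phi>') (at (A, w2, w3))"
    using cumulant_map_differentiable[of "(A, w2, w3)"] dets unfolding differentiable_def by auto
  define S where "S e = cumulant2 (A + e *\<^sub>R B, w2, w3)" for e
  define T where "T e = cumulant3 (A + e *\<^sub>R B, w2, w3)" for e
  define S1 where "S1 = fst (\<phi>' (B, 0, 0))"
  define T1 where "T1 = snd (\<phi>' (B, 0, 0))"
  have dA: "((\<lambda>e. (A + e *\<^sub>R B) $ i $ j) has_real_derivative B $ i $ j) (at 0)" for i j
  proof -
    have "((\<lambda>t. a + t * b) has_real_derivative b) (at 0)" for a b :: real
      by (auto intro!: derivative_eq_intros)
    then show ?thesis by simp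
  qed
  have dS: "((\<lambda>e. S e $ i $ j) has_real_derivative S1 $ i $ j) (at 0)" for i j
    using cumulant_line_derivatives(1)[OF dets der, of B 0 0 i j] by (simp add: S_def S1_def)
  have dT: "((\<lambda>e. T e $ i $ j $ k) has_real_derivative T1 $ i $ j $ k) (at 0)" for i j k
    using cumulant_line_derivatives(2)[OF dets der, of B 0 0 i j k] by (simp add: T_def T1_def)
  have dX: "((\<lambda>e. X $ i $ j) has_real_derivative (0 :: 'n matrix) $ i $ j) (at 0)" for X :: "'n
      matrix" and i j
    by simp
  have zero: "contract2 0 M N i j = 0" "contract2 M 0 N i j = 0" "contract3 0 M N Q i j k = 0"
    "contract3 M 0 N Q i j k = 0" "contract3 M N 0 Q i j k = 0" for M N :: "'n matrix" and Q i j k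
    by (simp_all add: contract2_def contract3_def)
  let ?L = "\<lambda>e. jac_rows (A + e *\<^sub>R B) (S e) (T e)"
  define L1 where "L1 X = (\<chi> r. case r of
       Inl (i, j) \<Rightarrow> if i \<noteq> j then jac2_deriv A B (S 0) S1 X i j else 0
     | Inr (i, j, k) \<Rightarrow> if \<not> (i = j \<and> j = k) then jac3_deriv A B (T 0) T1 X i j k else 0)" for X
  have d2: "((\<lambda>e. jac2 (A + e *\<^sub>R B) (S e) X i j) has_real_derivative jac2_deriv A B (S 0) S1 X i j)
      (at 0)" for X i j
    unfolding jac2_def jac2_deriv_def
    by (rule DERIV_cong[OF DERIV_add[OF contract2_has_derivative[OF dX dA dS]
        contract2_has_derivative[OF dA dX dS]]])
      (simp add: zero)
  have d3: "((\<lambda>e. jac3 (A + e *\<^sub>R B) (T e) X i j k) has_real_derivative jac3_deriv A B (T 0) T1 X i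
      j k) (at 0)" for X i j k
    unfolding jac3_def jac3_deriv_def
    by (rule DERIV_cong[OF DERIV_add[OF DERIV_add[OF contract3_has_derivative[OF dX dA dA dT]
          contract3_has_derivative[OF dA dX dA dT]] contract3_has_derivative[OF dA dA dX dT]]])
      (simp add: zero)
  have lim: "((\<lambda>e. (?L e X - ?L 0 X) /\<^sub>R e) \<longlongrightarrow> L1 X) (at 0)" for X
  proof (rule vec_tendstoI)
    fix r
    show "((\<lambda>e. ((?L e X - ?L 0 X) /\<^sub>R e) $ r) \<longlongrightarrow> L1 X $ r) (at 0)"
    proof (cases r)
      case (Inl p)
      obtain i j where "p = (i, j)" by (cases p)
      then show ?thesis using d2[of X i j] Inl
        by (cases "i = j") (simp_all add: jac_rows_def L1_def has_field_derivative_iff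
            divide_inverse mult.commute)
    next
      case (Inr p)
      obtain i j k where "p = (i, j, k)" by (cases p)
      then show ?thesis using d3[of X i j k] Inr
        by (cases "i = j \<and> j = k")
          (simp_all add: jac_rows_def L1_def has_field_derivative_iff divide_inverse mult.commute)
    qed
  qed
  have inj: "X = 0" if X: "X \<in> graph_matrices E" and Y: "Y \<in> graph_matrices E"
    and L0X: "?L 0 X = 0" and L0Y: "?L 0 Y + L1 X = 0" for X Y
  proof (rule cond[OF X Y, of S1 T1])
    show "S1 $ i $ j = contract2 B A (cumulant2 (A, w2, w3)) i j
         + contract2 A B (cumulant2 (A, w2, w3)) i j + contract2 A A S1 i j" for i j
      using cumulant2_derivative_equation[OF dets der, of B 0 0 i j] by (simp add: S1_def)
    show "T1 $ i $ j $ k = contract3 B A A (cumulant3 (A, w2, w3)) i j k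
         + contract3 A B A (cumulant3 (A, w2, w3)) i j k
         + contract3 A A B (cumulant3 (A, w2, w3)) i j k + contract3 A A A T1 i j k" for i j k
      using cumulant3_derivative_equation[OF dets der, of B 0 0 i j k] by (simp add: T1_def)
    show "jac_vanishes A (cumulant2 (A, w2, w3)) (cumulant3 (A, w2, w3)) X"
      using L0X by (simp add: jac_rows_zero_iff S_def T_def)
    show "jac2 A (cumulant2 (A, w2, w3)) Y i j + jac2_deriv A B (cumulant2 (A, w2, w3)) S1 X i j = 0"
      if "i \<noteq> j" for i j
      using arg_cong[OF L0Y, of "\<lambda>v. v $ Inl (i, j)"] that
      by (simp add: jac_rows_def L1_def S_def)
    show "jac3 A (cumulant3 (A, w2, w3)) Y i j k + jac3_deriv A B (cumulant3 (A, w2, w3)) T1 X i j k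
        = 0"
      if "\<not> (i = j \<and> j = k)" for i j k
      using arg_cong[OF L0Y, of "\<lambda>v. v $ Inr (i, j, k)"] that
      by (auto simp: jac_rows_def L1_def T_def split: if_splits)
  qed
  have "eventually (\<lambda>e. \<forall>X\<in>graph_matrices E. ?L e X = 0 \<longrightarrow> X = 0) (at 0)"
    by (rule perturbed_injective[OF linear_jac_rows lim subspace_graph_matrices]) (use inj in blast)
  then show ?thesis
    by (simp add: jac_injective_def jac_rows_zero_iff S_def T_def)
qed

end

text \<open>Visibly open, and stable by the row sum criterion: a point of this set has a ball around
  it whose graph matrices all lie in the parameter space. Positivity of the third-order noise
  selects one component of the non-zero values.\<close>

definition dominated_params :: "'n::finite param set" where
  "dominated_params = {\<theta>. (\<forall>i. (\<Sum>l\<in>UNIV. \<bar>fst \<theta> $ i $ l\<bar>) < 1) \<and>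
     (\<forall>i. fst (snd \<theta>) $ i > 0) \<and> (\<forall>i. snd (snd \<theta>) $ i > 0)}"

lemma open_dominated_params: "open (dominated_params :: 'n::finite param set)"
proof -
  have "dominated_params = (\<Inter>i. {\<theta> :: 'n param. (\<Sum>l\<in>UNIV. \<bar>fst \<theta> $ i $ l\<bar>) < 1}) \<inter>
     ((\<Inter>i. {\<theta>. 0 < fst (snd \<theta>) $ i}) \<inter> (\<Inter>i. {\<theta>. 0 < snd (snd \<theta>) $ i}))"
    unfolding dominated_params_def by auto
  moreover have "open \<dots>"
    by (intro open_Int open_INT finite ballI open_Collect_less continuous_intros)
  ultimately show ?thesis by simp
qed

lemma dominated_params_stable: "\<theta> \<in> dominated_params \<Longrightarrow> schur_stable (fst \<theta>)"
  by (rule schur_stable_row_sums) (simp add: dominated_params_def)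

lemma dominated_params_in_param_space:
  "\<theta> \<in> dominated_params \<Longrightarrow> fst \<theta> \<in> graph_matrices E \<Longrightarrow> \<theta> \<in> param_space E"
  using dominated_params_stable[of \<theta>]
  by (cases \<theta>) (auto simp: dominated_params_def param_space_def less_imp_neq[symmetric])

text \<open>The free coordinates: one per edge and, since the zero matrix is supported on every
  graph, all noise entries.\<close>

definition coordinates :: "('n::finite \<times> 'n) set \<Rightarrow> 'n param set" where
  "coordinates E = {b \<in> Basis. fst b \<in> graph_matrices E}"

lemma coordinate_subspace:
  "{\<theta> :: 'n::finite param. \<forall>b\<in>Basis - coordinates E. \<theta> \<bullet> b = 0} = {\<theta>. fst \<theta> \<in> graph_matrices E}"
proof (intro set_eqI iffI; clarsimp)
  fix A :: "'n matrix" and u v :: "real^'n"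
  assume z: "\<forall>b\<in>Basis - coordinates E. (A, u, v) \<bullet> b = 0"
  show "A \<in> graph_matrices E" unfolding graph_matrices_def
  proof (safe)
    fix i j assume ij: "(i, j) \<notin> E"
    let ?b = "(axis j (axis i 1), 0, 0) :: 'n param"
    have "axis j (axis i 1) \<in> (Basis :: 'n matrix set)" by (simp add: axis_in_Basis_iff)
    then have "?b \<in> Basis" unfolding Basis_prod_def zero_prod_def[symmetric] by blast
    moreover have "?b \<notin> coordinates E" using ij by (auto simp: coordinates_def graph_matrices_def
        axis_def)
    ultimately have "(A, u, v) \<bullet> ?b = 0" using z by blast
    then show "A $ j $ i = 0" by (simp add: inner_axis)
  qed
next
  fix A :: "'n matrix" and u v :: "real^'n" and B :: "'n matrix" and b c :: "real^'n"
  assume A: "A \<in> graph_matrices E" and b: "(B, b, c) \<in> Basis" "(B, b, c) \<notin> coordinates E"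
  then have B: "B \<notin> graph_matrices E" by (simp add: coordinates_def)
  then have "B \<noteq> 0" by (auto simp: graph_matrices_def)
  then obtain i j where ij: "B = axis j (axis i 1)" "b = 0" "c = 0"
    using b(1) by (auto simp: Basis_prod_def Basis_vec_def zero_prod_def)
  have "B $ j' $ i' = (if j' = j \<and> i' = i then 1 else 0)" for i' j'
    by (simp add: ij axis_def)
  then have "(i, j) \<notin> E" using B unfolding graph_matrices_def by (auto split: if_splits)
  then have "A $ j $ i = 0" using A by (auto simp: graph_matrices_def)
  then show "A \<bullet> B + (u \<bullet> b + v \<bullet> c) = 0" by (simp add: ij inner_axis)
qed

lemma generic_conclusions_from_one_point:
  fixes E :: "('n::{finite,linorder} \<times> 'n) set" and \<theta>0 :: "'n param"
  assumes E: "fst \<theta>0 \<in> graph_matrices E" and dom: "\<theta>0 \<in> dominated_params"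
    and inj: "jac_injective E (fst \<theta>0) (cumulant2 \<theta>0) (cumulant3 \<theta>0)"
  shows "generically (param_space E)
      (\<lambda>\<theta>. rank (J_off E (cumulant2 \<theta>) (cumulant3 \<theta>) (fst \<theta>)) = card E)"
    and "locally_identifiable E"
proof -
  have stable: "schur_stable (fst \<theta>)" if "\<theta> \<in> param_space E" for \<theta>
    using that by (auto simp: param_space_def)
  note st0 = dominated_params_stable[OF dom]
  have \<theta>0: "\<theta>0 \<in> param_space E" using dominated_params_in_param_space[OF dom E] .
  obtain h where h: "real_polynomial_function h" "\<And>\<theta>. schur_stable (fst \<theta>) \<Longrightarrow>
    (h \<theta> \<noteq> 0 \<longleftrightarrow> jac_injective E (fst \<theta>) (cumulant2 \<theta>) (cumulant3 \<theta>))"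
    using jac_injective_polynomial by blast
  have "h \<theta>0 \<noteq> 0" using h(2)[OF st0] inj by blast
  then have "proper_algebraic_subset (param_space E) {\<theta> \<in> param_space E. h \<theta> = 0}"
    unfolding proper_algebraic_subset_def using h(1) \<theta>0
    by (intro conjI exI[of _ "{h}"]) auto
  moreover have "rank (J_off E (cumulant2 \<theta>) (cumulant3 \<theta>) (fst \<theta>)) = card E"
    if "\<theta> \<in> param_space E - {\<theta> \<in> param_space E. h \<theta> = 0}" for \<theta>
    using that h(2)[OF stable] by (intro rank_J_off stable) auto
  ultimately show "generically (param_space E)
      (\<lambda>\<theta>. rank (J_off E (cumulant2 \<theta>) (cumulant3 \<theta>) (fst \<theta>)) = card E)"
    unfolding generically_def by blast
  obtain r where r: "r > 0" "ball \<theta>0 r \<subseteq> dominated_params"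
    using open_dominated_params dom unfolding open_contains_ball by blast
  obtain A w2 w3 where split: "\<theta>0 = (A, w2, w3)" by (cases \<theta>0)
  have dets: "det2 (fst \<theta>0) \<noteq> 0" "det3 (fst \<theta>0) \<noteq> 0"
    using schur_stable_det2[OF st0] schur_stable_det3[OF st0] .
  obtain \<phi>' where der: "(cumulant_map has_derivative \<phi>') (at \<theta>0)"
    using cumulant_map_differentiable[OF dets] unfolding differentiable_def by blast
  show "locally_identifiable E"
    unfolding locally_identifiable_def
  proof (rule generically_finite_fibres[where I = "coordinates E" and W = "{\<theta>. fst \<theta> \<in>
      graph_matrices E}"
        and ?x0.0 = \<theta>0 and r = r and \<phi>' = \<phi>' and q = "\<lambda>\<theta>. det2 (fst \<theta>) * det3 (fst \<theta>)" and n =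
            cumulant_numerator])
    show "coordinates E \<subseteq> Basis" by (auto simp: coordinates_def)
    show "{\<theta>. fst \<theta> \<in> graph_matrices E} = {x. \<forall>b\<in>Basis - coordinates E. x \<bullet> b = 0}"
      by (rule coordinate_subspace[symmetric])
    show "param_space E \<subseteq> {\<theta>. fst \<theta> \<in> graph_matrices E}" by (auto simp: param_space_def)
    show "{\<theta>. fst \<theta> \<in> graph_matrices E} \<inter> ball \<theta>0 r \<subseteq> param_space E"
      using r(2) dominated_params_in_param_space by blast
    show "\<theta>0 \<in> {\<theta>. fst \<theta> \<in> graph_matrices E}" using E by simp
    show "real_polynomial_function (\<lambda>\<theta> :: 'n param. det2 (fst \<theta>) * det3 (fst \<theta>))"
      by (intro real_polynomial_function.intros(4) polynomial_det2 polynomial_det3)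
    show "det2 (fst x) * det3 (fst x) \<noteq> 0" if "x \<in> param_space E" for x
      using schur_stable_det2[OF stable[OF that]] schur_stable_det3[OF stable[OF that]] by simp
    show "det2 (fst x) * det3 (fst x) * (cumulant_map x \<bullet> b) = cumulant_numerator b x"
      if "x \<in> param_space E" for x b
      by (rule cumulant_map_numerator[OF schur_stable_det2[OF stable[OF that]] schur_stable_det3[OF
          stable[OF that]]])
    show "v = 0" if "v \<in> {\<theta>. fst \<theta> \<in> graph_matrices E}" "\<phi>' v = 0" for v
    proof -
      obtain X u2 u3 where v: "v = (X, u2, u3)" by (cases v)
      show ?thesis unfolding v
        by (rule cumulant_derivative_injective[of A \<phi>' w2 w3 E X u2 u3])
          (use dets der inj that in \<open>simp_all add: split v\<close>)
    qed
  qed (use r(1) der polynomial_cumulant_numerator in auto)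
qed

section \<open>The base point: a collider with isolated nodes\<close>

lemma contract2_nested: "contract2 A B S a b = (\<Sum>l\<in>UNIV. A $ a $ l * (\<Sum>m\<in>UNIV. B $ b $ m * S $ l $ m))"
  by (simp add: contract2_def sum_distrib_left mult.assoc)

lemma contract3_nested: "contract3 A B C T a b c =
    (\<Sum>l\<in>UNIV. A $ a $ l * (\<Sum>m\<in>UNIV. B $ b $ m * (\<Sum>q\<in>UNIV. C $ c $ q * T $ l $ m $ q)))"
  by (simp add: contract3_def sum_distrib_left mult.assoc)

text \<open>
  These noise levels make the cumulants at the base point integral: an isolated node with
  self-loop weight 1/2 has variance \<open>9 / (1 - 1/4) = 12\<close> and third cumulant
  \<open>686 / (1 - 1/8) = 784\<close>.
\<close>

abbreviation base_param :: "'n::finite matrix \<Rightarrow> 'n param" where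
  "base_param A \<equiv> (A, (\<chi> _. 9), (\<chi> _. 686))"

locale collider =
  fixes i :: "'n::finite" and P :: "'n set"
  assumes i_notin: "i \<notin> P" and card_P: "card P = 1 \<or> card P = 2"
begin

text \<open>Besides the loops only the edges from \<open>P\<close> to \<open>i\<close> are present,
  so nodes outside are isolated. The absolute row sums are at most 3/4, and with noise level 9 the
  weight 1/8 makes the covariance of \<open>i\<close> with each parent equal to 1.\<close>

definition A0 :: "'n matrix" where
  "A0 = (\<chi> a b. if a = b then 1 / 2 else if a = i \<and> b \<in> P then 1 / 8 else 0)"

text \<open>Entry \<open>a\<close> of \<open>A0\<close> applied to \<open>f\<close>. Nested
  contractions become nested \<open>row\<close> terms, in which only sums over \<open>P\<close> are
  left.\<close>

definition row :: "'n \<Rightarrow> ('n \<Rightarrow> real) \<Rightarrow> real" where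
  "row a f = f a / 2 + (if a = i then (\<Sum>p\<in>P. f p) / 8 else 0)"

abbreviation "S \<equiv> cumulant2 (base_param A0)"
abbreviation "T \<equiv> cumulant3 (base_param A0)"
abbreviation "U \<equiv> insert i P"

lemma row_sum: "(\<Sum>m\<in>UNIV. A0 $ a $ m * f m) = row a f"
proof -
  have "(\<Sum>m\<in>UNIV. A0 $ a $ m * f m) = (\<Sum>m\<in>UNIV. (if m = a then f a / 2 else 0)
      + (if m \<in> P then (if a = i then f m / 8 else 0) else 0))"
    by (rule sum.cong) (use i_notin in \<open>auto simp: A0_def\<close>)
  also have "\<dots> = f a / 2 + (\<Sum>m\<in>P. if a = i then f m / 8 else 0)"
    by (simp add: sum.distrib sum.inter_restrict[symmetric])
  finally show ?thesis by (simp add: row_def sum_divide_distrib)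
qed

lemma row_simps: "a \<noteq> i \<Longrightarrow> row a f = f a / 2" "row i f = f i / 2 + (\<Sum>p\<in>P. f p) / 8"
  by (simp_all add: row_def)

lemma row_linear:
  "row a (\<lambda>m. f m + g m) = row a f + row a g"
  "row a (\<lambda>m. c * f m) = c * row a f"
  "row a (\<lambda>m. \<Sum>k\<in>K. h k m) = (\<Sum>k\<in>K. row a (h k))"
  by (simp_all add: row_def sum.distrib sum_distrib_left sum_divide_distrib add_divide_distrib
      algebra_simps sum.swap[of _ P])

lemma row_zero [simp]: "row a (\<lambda>_. 0) = 0"
  by (simp add: row_def)

lemma stable_A0: "(\<Sum>l\<in>UNIV. \<bar>A0 $ a $ l\<bar>) < 1"
proof -
  have "(\<Sum>l\<in>UNIV. \<bar>A0 $ a $ l\<bar>) = (\<Sum>l\<in>UNIV. A0 $ a $ l * 1)"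
    by (rule sum.cong) (auto simp: A0_def)
  also have "\<dots> < 1" unfolding row_sum row_def using card_P by auto
  finally show ?thesis .
qed

lemma S_equation: "S $ a $ b = row a (\<lambda>l. row b (\<lambda>m. S $ l $ m)) + (if a = b then 9 else 0)"
  using cumulant2_equation[OF schur_stable_det2[OF schur_stable_row_sums[OF stable_A0]], of "\<chi> _. 9"
      "\<chi> _. 686" a b]
  by (simp add: contract2_nested row_sum)

lemma T_equation: "T $ a $ b $ c =
    row a (\<lambda>l. row b (\<lambda>m. row c (\<lambda>q. T $ l $ m $ q))) + (if a = b \<and> b = c then 686 else 0)"
  using cumulant3_equation[OF schur_stable_det3[OF schur_stable_row_sums[OF stable_A0]], of "\<chi> _. 9"
      "\<chi> _. 686" a b c]
  by (simp add: contract3_nested row_sum)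

lemma S_sym: "S $ a $ b = S $ b $ a"
  using cumulant2_symmetric[OF schur_stable_row_sums[OF stable_A0]] unfolding symmetric2_def by blast

lemma T_sym: "T $ a $ b $ c = T $ b $ a $ c" "T $ a $ b $ c = T $ a $ c $ b"
  using cumulant3_symmetric[OF schur_stable_row_sums[OF stable_A0]] unfolding symmetric3_def by blast+

section \<open>The cumulants at the base point\<close>

lemma P_neq: "p \<in> P \<Longrightarrow> p \<noteq> i" using i_notin by blast

text \<open>The fixed-point equations are triangular in the number of indices equal to
  \<open>i\<close>: an entry refers, besides itself, only to entries with fewer of them. The
  third-order cumulants are solved in the same order.\<close>

lemma S_off: "a \<noteq> i \<Longrightarrow> b \<noteq> i \<Longrightarrow> S $ a $ b = (if a = b then 12 else 0)"
  using S_equation[of a b] by (simp add: row_simps split: if_splits)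

lemma S_i: "b \<noteq> i \<Longrightarrow> S $ i $ b = (if b \<in> P then 1 else 0)"
proof -
  assume b: "b \<noteq> i"
  have "(\<Sum>p\<in>P. S $ p $ b / 2) = (\<Sum>p\<in>P. if p = b then 6 else 0)"
    by (rule sum.cong) (use b P_neq S_off in auto)
  then show ?thesis using S_equation[of i b] b by (simp add: row_simps split: if_splits)
qed

lemma S_i': "b \<noteq> i \<Longrightarrow> S $ b $ i = (if b \<in> P then 1 else 0)"
  using S_i S_sym by metis

lemma sum_P_S: "(\<Sum>p\<in>P. S $ i $ p) = card P" "(\<Sum>p\<in>P. S $ p $ i) = card P"
  "b \<noteq> i \<Longrightarrow> (\<Sum>p\<in>P. S $ p $ b) = (if b \<in> P then 12 else 0)"
  "b \<noteq> i \<Longrightarrow> (\<Sum>p\<in>P. S $ b $ p) = (if b \<in> P then 12 else 0)"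
proof -
  have "(\<Sum>p\<in>P. S $ i $ p) = (\<Sum>p\<in>P. 1)" by (rule sum.cong) (use P_neq S_i in auto)
  then show 1: "(\<Sum>p\<in>P. S $ i $ p) = card P" by simp
  then show "(\<Sum>p\<in>P. S $ p $ i) = card P" by (subst S_sym) simp
  assume b: "b \<noteq> i"
  have "(\<Sum>p\<in>P. S $ p $ b) = (\<Sum>p\<in>P. if p = b then 12 else 0)"
    by (rule sum.cong) (use P_neq S_off b in auto)
  then show "(\<Sum>p\<in>P. S $ p $ b) = (if b \<in> P then 12 else 0)" by simp
  then show "(\<Sum>p\<in>P. S $ b $ p) = (if b \<in> P then 12 else 0)" by (subst S_sym) simp
qed

lemma S_ii: "S $ i $ i = 12 + 5 * card P / 12"
proof -
  have "(\<Sum>p\<in>P. S $ p $ i / 2 + (\<Sum>q\<in>P. S $ p $ q) / 8) = card P / 2 + 12 * card P / 8"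
  proof -
    have "(\<Sum>p\<in>P. (\<Sum>q\<in>P. S $ p $ q) / 8) = (\<Sum>p\<in>P. 12 / 8)"
      by (rule sum.cong) (use P_neq sum_P_S(4) in auto)
    then show ?thesis by (simp add: sum.distrib sum_divide_distrib[symmetric] sum_P_S)
  qed
  then show ?thesis using S_equation[of i i] by (simp add: row_simps sum_P_S field_simps)
qed

lemma T_off: "a \<noteq> i \<Longrightarrow> b \<noteq> i \<Longrightarrow> c \<noteq> i \<Longrightarrow> T $ a $ b $ c = (if a = b \<and> b = c then 784 else 0)"
  using T_equation[of a b c] by (cases "a = b \<and> b = c") (auto simp: row_simps)

lemma T_i: "b \<noteq> i \<Longrightarrow> c \<noteq> i \<Longrightarrow> T $ i $ b $ c = (if b = c \<and> b \<in> P then 28 else 0)"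
proof -
  assume bc: "b \<noteq> i" "c \<noteq> i"
  have "(\<Sum>p\<in>P. T $ p $ b $ c / 4) = (\<Sum>p\<in>P. if p = b then (if b = c then 196 else 0) else 0)"
    by (rule sum.cong) (use bc P_neq T_off in auto)
  then show ?thesis using T_equation[of i b c] bc
    by (simp add: row_simps split: if_splits)
qed

lemma T_ii: "c \<noteq> i \<Longrightarrow> T $ i $ i $ c = (if c \<in> P then 9 else 0)"
proof -
  assume c: "c \<noteq> i"
  have s1: "(\<Sum>p\<in>P. T $ i $ p $ c) = (if c \<in> P then 28 else 0)"
  proof -
    have "(\<Sum>p\<in>P. T $ i $ p $ c) = (\<Sum>p\<in>P. if p = c then 28 else 0)"
      by (rule sum.cong) (use c P_neq T_i in auto)
    then show ?thesis by simp
  qed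
  then have s2: "(\<Sum>p\<in>P. T $ p $ i $ c) = (if c \<in> P then 28 else 0)"
    by (subst T_sym(1))
  have s3: "(\<Sum>p\<in>P. \<Sum>q\<in>P. T $ p $ q $ c) = (if c \<in> P then 784 else 0)"
  proof -
    have "(\<Sum>p\<in>P. \<Sum>q\<in>P. T $ p $ q $ c) = (\<Sum>p\<in>P. \<Sum>q\<in>P. if q = p then (if p = c then 784 else 0) else 0)"
      by (intro sum.cong refl) (use c P_neq T_off in auto)
    also have "\<dots> = (\<Sum>p\<in>P. if p = c then 784 else 0)" by simp
    finally show ?thesis by simp
  qed
  have "T $ i $ i $ c = (T $ i $ i $ c / 4 + (\<Sum>p\<in>P. T $ i $ p $ c) / 16) / 2
      + ((\<Sum>p\<in>P. T $ p $ i $ c) / 4 + (\<Sum>p\<in>P. \<Sum>q\<in>P. T $ p $ q $ c) / 16) / 8"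
    using T_equation[of i i c] c
    by (simp add: row_simps sum.distrib sum_divide_distrib[symmetric])
  then show ?thesis unfolding s1 s2 s3 by (cases "c \<in> P"; simp add: field_simps)
qed

lemma T_perm: "T $ b $ i $ c = T $ i $ b $ c" "T $ b $ c $ i = T $ i $ b $ c"
  using T_sym by metis+

lemma T_iii: "T $ i $ i $ i = 784 + 97 * card P / 28"
proof -
  have s1: "(\<Sum>p\<in>P. T $ i $ i $ p) = 9 * card P"
  proof -
    have "(\<Sum>p\<in>P. T $ i $ i $ p) = (\<Sum>p\<in>P. 9)" by (rule sum.cong) (use P_neq T_ii in auto)
    then show ?thesis by simp
  qed
  have s2: "(\<Sum>p\<in>P. \<Sum>q\<in>P. T $ i $ p $ q) = 28 * card P"
  proof -
    have "(\<Sum>p\<in>P. \<Sum>q\<in>P. T $ i $ p $ q) = (\<Sum>p\<in>P. \<Sum>q\<in>P. if q = p then 28 else 0)"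
      by (intro sum.cong refl) (use P_neq T_i in auto)
    then show ?thesis by simp
  qed
  have s3: "(\<Sum>p\<in>P. \<Sum>q\<in>P. \<Sum>r\<in>P. T $ p $ q $ r) = 784 * card P"
  proof -
    have "(\<Sum>p\<in>P. \<Sum>q\<in>P. \<Sum>r\<in>P. T $ p $ q $ r)
        = (\<Sum>p\<in>P. \<Sum>q\<in>P. \<Sum>r\<in>P. if r = q then (if q = p then 784 else 0) else 0)"
      by (intro sum.cong refl) (use P_neq T_off in auto)
    then show ?thesis by simp
  qed
  have "T $ i $ i $ i = T $ i $ i $ i / 8 + 3 * (\<Sum>p\<in>P. T $ i $ i $ p) / 32
      + 3 * (\<Sum>p\<in>P. \<Sum>q\<in>P. T $ i $ p $ q) / 128
      + (\<Sum>p\<in>P. \<Sum>q\<in>P. \<Sum>r\<in>P. T $ p $ q $ r) / 512 + 686"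
  proof -
    have e: "(\<Sum>p\<in>P. T $ i $ p $ i) = (\<Sum>p\<in>P. T $ i $ i $ p)"
      "(\<Sum>p\<in>P. T $ p $ i $ i) = (\<Sum>p\<in>P. T $ i $ i $ p)"
      "(\<Sum>p\<in>P. \<Sum>q\<in>P. T $ p $ i $ q) = (\<Sum>p\<in>P. \<Sum>q\<in>P. T $ i $ p $ q)"
      "(\<Sum>p\<in>P. \<Sum>q\<in>P. T $ p $ q $ i) = (\<Sum>p\<in>P. \<Sum>q\<in>P. T $ i $ p $ q)"
      using T_perm T_sym by (intro sum.cong refl; metis)+
    have "T $ i $ i $ i = ((T $ i $ i $ i / 2 + (\<Sum>p\<in>P. T $ i $ i $ p) / 8) / 2
        + ((\<Sum>p\<in>P. T $ i $ p $ i) / 2 + (\<Sum>p\<in>P. \<Sum>q\<in>P. T $ i $ p $ q) / 8) / 8) / 2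
      + (((\<Sum>p\<in>P. T $ p $ i $ i) / 2 + (\<Sum>p\<in>P. \<Sum>q\<in>P. T $ p $ i $ q) / 8) / 2
        + ((\<Sum>p\<in>P. \<Sum>q\<in>P. T $ p $ q $ i) / 2
          + (\<Sum>p\<in>P. \<Sum>q\<in>P. \<Sum>r\<in>P. T $ p $ q $ r) / 8) / 8) / 8 + 686"
      using T_equation[of i i i]
      by (simp add: row_simps sum.distrib sum_divide_distrib[symmetric])
    then show ?thesis unfolding e by (simp add: field_simps)
  qed
  then show ?thesis unfolding s1 s2 s3 by (simp add: field_simps)
qed

text \<open>Outside nodes are isolated, hence independent of everything else: their mixed cumulants
  vanish.\<close>

lemma S_out: "l \<notin> U \<Longrightarrow> S $ l $ m = (if m = l then 12 else 0)" "l \<notin> U \<Longrightarrow> S $ m $ l = (if m = l then 12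
    else 0)"
  using S_off[of l m] S_i'[of l] S_sym[of l m] by (cases "m = i"; auto)+

lemma T_out:
  assumes "l \<notin> U"
  shows "T $ l $ m $ q = (if m = l \<and> q = l then 784 else 0)"
    "T $ m $ l $ q = (if m = l \<and> q = l then 784 else 0)"
    "T $ m $ q $ l = (if m = l \<and> q = l then 784 else 0)"
proof -
  have l: "l \<noteq> i" "l \<notin> P" using assms by auto
  show *: "T $ l $ m $ q = (if m = l \<and> q = l then 784 else 0)" for m q
  proof (cases "m = i")
    case True
    then have "T $ l $ m $ q = T $ i $ l $ q" using T_sym(1) by metis
    then show ?thesis using True l T_i[of l q] T_ii[of l] T_sym(2)[of i l i]
      by (cases "q = i") auto
  next
    case False
    then show ?thesis using l T_off[of l m q] T_i[of l m] T_perm(2)[of l m]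
      by (cases "q = i") auto
  qed
  show "T $ m $ l $ q = (if m = l \<and> q = l then 784 else 0)"
    using *[of m q] T_sym(1)[of m l q] by simp
  show "T $ m $ q $ l = (if m = l \<and> q = l then 784 else 0)"
    using *[of m q] T_sym(2)[of m q l] T_sym(1)[of m l q] by simp
qed

end

section \<open>Attaching the remaining nodes\<close>

lemma jac_vanishesD:
  assumes "jac_vanishes A S T X"
  shows "i \<noteq> j \<Longrightarrow> jac2 A S X i j = 0" "\<not> (i = j \<and> j = k) \<Longrightarrow> jac3 A T X i j k = 0"
  using assms by (simp_all add: jac_vanishes_def)

context collider
begin

lemma row_cong: "(\<And>r. r = a \<or> (a = i \<and> r \<in> P) \<Longrightarrow> f r = g r) \<Longrightarrow> row a f = row a g"
  by (auto simp: row_def intro!: sum.cong)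

lemma row_out:
  assumes "l \<notin> U" "a \<noteq> l" "\<And>r. r \<noteq> l \<Longrightarrow> f r = 0"
  shows "row a f = 0"
proof -
  have "row a f = row a (\<lambda>_. 0)"
  proof (rule row_cong)
    fix r assume "r = a \<or> (a = i \<and> r \<in> P)"
    then have "r \<noteq> l" using assms(1,2) by auto
    then show "f r = 0" by (rule assms(3))
  qed
  then show ?thesis by simp
qed

text \<open>On \<open>U\<close> the matrix \<open>A0\<close> is triangular with diagonal 1/2, the
  parents coming before \<open>i\<close>, hence invertible. This strips \<open>row\<close> from
  equations that hold on all of \<open>U\<close>.\<close>

lemma row_injective:
  assumes "\<And>c. c \<in> U \<Longrightarrow> row c f = 0" "c \<in> U"
  shows "f c = 0"
proof -
  have p: "f p = 0" if "p \<in> P" for p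
    using assms(1)[of p] that P_neq by (simp add: row_simps)
  then have "f i = 0" using assms(1)[of i] by (simp add: row_simps)
  then show ?thesis using p assms(2) by auto
qed

lemma sum_on_U:
  fixes y :: "'n \<Rightarrow> real"
  assumes "\<And>m. m \<notin> U \<Longrightarrow> g m = 0"
  shows "(\<Sum>m\<in>UNIV. y m * g m) = y i * g i + (\<Sum>p\<in>P. y p * g p)"
proof -
  have "(\<Sum>m\<in>UNIV. y m * g m) = (\<Sum>m\<in>U. y m * g m)"
    by (rule sum.mono_neutral_right) (use assms in auto)
  then show ?thesis using i_notin by simp
qed

lemma sum_single:
  assumes "\<And>m. m \<noteq> a \<Longrightarrow> g m = (0 :: real)"
  shows "(\<Sum>m\<in>UNIV. y m * g m) = y a * g (a :: 'n)"
proof -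
  have "(\<Sum>m\<in>UNIV. y m * g m) = (\<Sum>m\<in>UNIV. if m = a then y a * g a else 0)"
    by (rule sum.cong) (use assms in auto)
  then show ?thesis by simp
qed

lemma S_combination:
  "p \<in> P \<Longrightarrow> (\<Sum>m\<in>UNIV. y m * S $ m $ p) = 12 * y p + y i"
  "(\<Sum>m\<in>UNIV. y m * S $ m $ i) = S $ i $ i * y i + (\<Sum>p\<in>P. y p)"
  "l \<notin> U \<Longrightarrow> (\<Sum>m\<in>UNIV. y m * S $ m $ l) = 12 * y l"
proof -
  show "(\<Sum>m\<in>UNIV. y m * S $ m $ p) = 12 * y p + y i" if p: "p \<in> P"
  proof -
    have "(\<Sum>q\<in>P. y q * S $ q $ p) = (\<Sum>q\<in>P. if q = p then 12 * y p else 0)"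
      by (rule sum.cong) (use P_neq S_off p in auto)
    then have "(\<Sum>q\<in>P. y q * S $ q $ p) = 12 * y p" using p by simp
    moreover have "S $ m $ p = 0" if "m \<notin> U" for m using S_out(1)[OF that, of p] p that by auto
    ultimately show ?thesis using sum_on_U[of "\<lambda>m. S $ m $ p" y] S_i[of p] p P_neq by simp
  qed
  have "(\<Sum>q\<in>P. y q * S $ q $ i) = (\<Sum>q\<in>P. y q)"
    by (rule sum.cong) (use P_neq S_i' in auto)
  moreover have "S $ m $ i = 0" if "m \<notin> U" for m using S_out(1)[OF that, of i] that by auto
  ultimately show "(\<Sum>m\<in>UNIV. y m * S $ m $ i) = S $ i $ i * y i + (\<Sum>p\<in>P. y p)"
    using sum_on_U[of "\<lambda>m. S $ m $ i" y] by simp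
  show "(\<Sum>m\<in>UNIV. y m * S $ m $ l) = 12 * y l" if "l \<notin> U"
    using sum_single[of l "\<lambda>m. S $ m $ l" y] S_out(2)[OF that] by simp
qed

lemma T_combination:
  "p \<in> P \<Longrightarrow> (\<Sum>m\<in>UNIV. y m * T $ m $ p $ p) = 784 * y p + 28 * y i"
  "p \<in> P \<Longrightarrow> (\<Sum>m\<in>UNIV. y m * T $ m $ i $ p) = 28 * y p + 9 * y i"
  "l \<notin> U \<Longrightarrow> (\<Sum>m\<in>UNIV. y m * T $ m $ l $ l) = 784 * y l"
proof -
  show "(\<Sum>m\<in>UNIV. y m * T $ m $ p $ p) = 784 * y p + 28 * y i" if p: "p \<in> P"
  proof -
    have "(\<Sum>q\<in>P. y q * T $ q $ p $ p) = (\<Sum>q\<in>P. if q = p then 784 * y p else 0)"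
      by (rule sum.cong) (use P_neq T_off p in auto)
    then have "(\<Sum>q\<in>P. y q * T $ q $ p $ p) = 784 * y p" using p by simp
    moreover have "T $ m $ p $ p = 0" if "m \<notin> U" for m using T_out(1)[OF that, of p p] p that by auto
    ultimately show ?thesis using sum_on_U[of "\<lambda>m. T $ m $ p $ p" y] T_i[of p p] p P_neq by simp
  qed
  show "(\<Sum>m\<in>UNIV. y m * T $ m $ i $ p) = 28 * y p + 9 * y i" if p: "p \<in> P"
  proof -
    have "(\<Sum>q\<in>P. y q * T $ q $ i $ p) = (\<Sum>q\<in>P. if q = p then 28 * y p else 0)"
      by (rule sum.cong) (use P_neq T_i T_perm(1) p in auto)
    then have "(\<Sum>q\<in>P. y q * T $ q $ i $ p) = 28 * y p" using p by simp
    moreover have "T $ m $ i $ p = 0" if "m \<notin> U" for m using T_out(1)[OF that, of i p] p that by auto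
    ultimately show ?thesis using sum_on_U[of "\<lambda>m. T $ m $ i $ p" y] T_ii[of p] p P_neq by simp
  qed
  show "(\<Sum>m\<in>UNIV. y m * T $ m $ l $ l) = 784 * y l" if "l \<notin> U"
    using sum_single[of l "\<lambda>m. T $ m $ l $ l" y] T_out(2)[OF that] by simp
qed

section \<open>Kernel entries at nodes outside the collider\<close>

lemma jac2_nested: "jac2 A0 M X a b =
    (\<Sum>l\<in>UNIV. X $ a $ l * row b (\<lambda>m. M $ l $ m)) + row a (\<lambda>l. \<Sum>m\<in>UNIV. X $ b $ m * M $ l $ m)"
  by (simp only: jac2_def contract2_nested row_sum)

lemma jac3_nested: "jac3 A0 M X a b c =
    (\<Sum>l\<in>UNIV. X $ a $ l * row b (\<lambda>m. row c (\<lambda>q. M $ l $ m $ q)))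
    + row a (\<lambda>l. \<Sum>m\<in>UNIV. X $ b $ m * row c (\<lambda>q. M $ l $ m $ q))
    + row a (\<lambda>l. row b (\<lambda>m. \<Sum>q\<in>UNIV. X $ c $ q * M $ l $ m $ q))"
  by (simp only: jac3_def contract3_nested row_sum)

text \<open>In the row \<open>(l, l, a)\<close> every mixed cumulant with the isolated node
  \<open>l\<close> drops out. Only the entry of the edge from \<open>l\<close> to \<open>a\<close>
  survives, with the factor 784 / 4 = 196.\<close>

lemma kernel_vanishes_into_outside:
  assumes van: "jac_vanishes A0 S T X" and l: "l \<notin> U" and a: "a \<noteq> l"
  shows "X $ a $ l = 0"
proof -
  have li: "l \<noteq> i" using l by auto
  have z: "row a (\<lambda>q. T $ p $ l $ q) = 0" "row a (\<lambda>q. T $ l $ p $ q) = 0" for p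
    by (rule row_out[OF l a]; simp add: T_out(2)[OF l] T_out(1)[OF l])+
  have "jac3 A0 T X l l a = 0" by (rule jac_vanishesD(2)[OF van]) (use a in simp)
  moreover have "jac3 A0 T X l l a = (\<Sum>q\<in>UNIV. X $ a $ q * T $ l $ l $ q) / 4"
    unfolding jac3_nested row_simps(1)[OF li] z by simp
  moreover have "(\<Sum>q\<in>UNIV. X $ a $ q * T $ l $ l $ q) = 784 * X $ a $ l"
    using sum_single[of l "\<lambda>q. T $ l $ l $ q" "\<lambda>q. X $ a $ q"] by (simp add: T_out[OF l])
  ultimately show ?thesis by simp
qed

text \<open>With the reverse entries already zero, the rows \<open>(l, c)\<close> say that
  \<open>A0\<close>, applied to row \<open>l\<close> of \<open>X\<close> times \<open>S\<close>,
  vanishes on \<open>U\<close>. Both \<open>A0\<close> and \<open>S\<close> are invertible on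
  \<open>U\<close>; for \<open>S\<close> this is the elimination at the end, with pivot
  \<open>12 + card P / 3\<close>.\<close>

lemma kernel_vanishes_from_outside:
  assumes van: "jac_vanishes A0 S T X" and l: "l \<notin> U" and a: "a \<in> U"
  shows "X $ l $ a = 0"
proof -
  have li: "l \<noteq> i" using l by auto
  define f where "f c = (\<Sum>m\<in>UNIV. X $ l $ m * S $ m $ c)" for c
  have f0: "f c = 0" if "c \<in> U" for c
  proof (rule row_injective[OF _ that])
    fix c assume c: "c \<in> U"
    then have cl: "c \<noteq> l" using l by auto
    have "jac2 A0 S X l c = 0" by (rule jac_vanishesD(1)[OF van]) (use cl in simp)
    moreover have "(\<Sum>m\<in>UNIV. X $ c $ m * S $ l $ m) = 12 * X $ c $ l"
      using sum_single[of l "\<lambda>m. S $ l $ m" "\<lambda>m. X $ c $ m"] by (simp add: S_out[OF l])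
    moreover have "X $ c $ l = 0" by (rule kernel_vanishes_into_outside[OF van l cl])
    ultimately show "row c f = 0"
      unfolding jac2_nested row_simps(1)[OF li] f_def by (simp add: row_linear)
  qed
  have p: "12 * X $ l $ p + X $ l $ i = 0" if "p \<in> P" for p
  proof -
    have "f p = 0" using that by (intro f0) simp
    then show ?thesis unfolding f_def S_combination(1)[OF that] .
  qed
  have "f i = 0" by (intro f0) simp
  then have "S $ i $ i * X $ l $ i + (\<Sum>p\<in>P. X $ l $ p) = 0"
    unfolding f_def S_combination(2) .
  moreover have "(\<Sum>p\<in>P. X $ l $ p) = (\<Sum>p\<in>P. - X $ l $ i / 12)"
  proof (rule sum.cong[OF refl])
    show "X $ l $ p = - X $ l $ i / 12" if "p \<in> P" for p using p[OF that] by simp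
  qed
  ultimately have "(12 + 5 * card P / 12) * X $ l $ i - card P * X $ l $ i / 12 = 0"
    by (simp add: S_ii)
  then have li0: "X $ l $ i = 0" using card_P by (elim disjE) simp_all
  show ?thesis
  proof (cases "a = i")
    case False
    then have "a \<in> P" using a by simp
    then show ?thesis using p[of a] li0 by simp
  qed (use li0 in simp)
qed

text \<open>
  The equations collected here are what remains, at first order, of the rows indexed by one node
  \<open>l\<close> outside and nodes of the component of its parent \<open>u\<close>. Exactly one of \<open>\<beta>\<close> (edge from \<open>u\<close> to
  \<open>l\<close>) and \<open>\<gamma>\<close> (edge from \<open>l\<close> to \<open>u\<close>) is 1.
\<close>

lemma attachment_equations:
  fixes x \<beta> \<gamma> :: real and s e w y :: "'n \<Rightarrow> real" and t :: "'n \<Rightarrow> 'n \<Rightarrow> real"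
  assumes C: "C = (if u \<in> U then U else {u})"
    and \<beta>\<gamma>: "(\<beta> = 1 \<and> \<gamma> = 0) \<or> (\<beta> = 0 \<and> \<gamma> = 1)"
    and s: "\<And>c. c \<in> C \<Longrightarrow> s c = \<beta> * row c (\<lambda>q. S $ u $ q) + 6 * (if c = u then \<gamma> else 0) + row c s / 2"
    and t: "\<And>c c'. c \<in> C \<Longrightarrow> c' \<in> C \<Longrightarrow>
       t c c' = \<beta> * row c (\<lambda>q. row c' (\<lambda>r. T $ u $ q $ r)) + row c (\<lambda>q. row c' (\<lambda>r. t q r)) / 2"
    and e: "\<And>c. c \<in> C \<Longrightarrow> e c = 196 * (if c = u then \<gamma> else 0) + row c e / 4"
    and r1: "\<And>c. c \<in> C \<Longrightarrow> 196 * w c + x * (784 * (if c = u then \<gamma> else 0) + row c e) = 0"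
    and r2: "\<And>c. c \<in> C \<Longrightarrow> row c (\<lambda>q. \<Sum>m\<in>UNIV. y m * S $ m $ q) + 6 * w c
        + x * (12 * (if c = u then \<gamma> else 0) + row c s) = 0"
    and r3: "\<And>c c'. c \<in> C \<Longrightarrow> c' \<in> C \<Longrightarrow>
       row c (\<lambda>q. row c' (\<lambda>r. \<Sum>m\<in>UNIV. y m * T $ m $ q $ r)) + x * row c (\<lambda>q. row c' (\<lambda>r. t q r)) = 0"
  shows "x = 0"
proof (cases "u \<in> U")
  case False
  then have ui: "u \<noteq> i" and Cu: "C = {u}" using C by auto
  have "S $ u $ u = 12" "T $ u $ u $ u = 784" using S_out[OF False] T_out[OF False] by simp_all
  note R = row_simps(1)[OF ui] this S_combination(3)[OF False] T_combination(3)[OF False]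
  have "s u = \<beta> * 6 + 6 * \<gamma> + s u / 4" "t u u = \<beta> * 196 + t u u / 8" "e u = 196 * \<gamma> + e u / 8"
    "196 * w u + x * (784 * \<gamma> + e u / 2) = 0"
    "6 * y u + 6 * w u + x * (12 * \<gamma> + s u / 2) = 0"
    "196 * y u + x * (t u u / 4) = 0"
    using s[of u] t[of u u] e[of u] r1[of u] r2[of u] r3[of u u] unfolding Cu by (simp_all add: R)
  \<comment> \<open>The corrections \<open>y u\<close> and \<open>w u\<close> are overdetermined. If
    \<open>\<beta> = 1\<close>, then \<open>w u = 0\<close>, and the last two equations give
    \<open>y u\<close> as -2/3 and as -2/7 times \<open>x\<close>. If \<open>\<gamma> = 1\<close>,
    then \<open>y u = 0\<close>, and \<open>w u\<close> is both -32/7 and -8/3 times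
    \<open>x\<close>.\<close>
  then have v: "s u = 8 * \<beta> + 8 * \<gamma>" "t u u = 224 * \<beta>" "e u = 224 * \<gamma>"
    and eqs: "196 * w u + x * (784 * \<gamma> + e u / 2) = 0"
    "6 * y u + 6 * w u + x * (12 * \<gamma> + s u / 2) = 0"
    "196 * y u + x * (t u u / 4) = 0" by linarith+
  show ?thesis using \<beta>\<gamma> eqs unfolding v by (elim disjE) simp_all
next
  case True
  then have CU: "C = U" using C by simp
  note s = s[unfolded CU] and t = t[unfolded CU] and e = e[unfolded CU]
    and r1 = r1[unfolded CU] and r2 = r2[unfolded CU] and r3 = r3[unfolded CU]
  define f where "f c = (\<Sum>m\<in>UNIV. y m * S $ m $ c)" for c
  define F where "F c d = (\<Sum>m\<in>UNIV. y m * T $ m $ c $ d)" for c d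
  \<comment> \<open>\<open>row\<close> is injective on \<open>U\<close> in each of the two indices,
    so both can be stripped from \<open>r3\<close>.\<close>
  have FT: "F c d = - x * t c d" if "c \<in> U" "d \<in> U" for c d
  proof -
    have "row d (\<lambda>r. F c r + x * t c r) = 0" if "d \<in> U" for d
    proof (rule row_injective[OF _ \<open>c \<in> U\<close>, of "\<lambda>q. row d (\<lambda>r. F q r + x * t q r)"])
      fix c assume "c \<in> U"
      then show "row c (\<lambda>q. row d (\<lambda>r. F q r + x * t q r)) = 0"
        using r3[of c d] \<open>d \<in> U\<close> unfolding F_def by (simp only: row_linear)
    qed
    then have "F c d + x * t c d = 0" by (rule row_injective[OF _ \<open>d \<in> U\<close>])
    then show ?thesis by simp
  qed
  have pU: "p \<in> U" "p \<noteq> i" if "p \<in> P" for p using that P_neq by auto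
  have tpq: "t p q = \<beta> * T $ u $ p $ q / 4 + t p q / 8" if "p \<in> P" "q \<in> P" for p q
    using t[of p q] pU[OF that(1)] pU[OF that(2)] by (simp add: row_simps)
  have tip: "t i p = \<beta> * (T $ u $ i $ p / 4 + (\<Sum>q\<in>P. T $ u $ q $ p) / 16)
      + (t i p / 4 + (\<Sum>q\<in>P. t q p) / 16) / 2" if "p \<in> P" for p
    using t[of i p] pU[OF that] by (simp add: row_simps sum_divide_distrib[symmetric])
  have sp: "s p = \<beta> * S $ u $ p / 2 + 6 * (if p = u then \<gamma> else 0) + s p / 4" if "p \<in> P" for p
    using s[of p] pU[OF that] by (simp add: row_simps)
  have si: "s i = \<beta> * (S $ u $ i / 2 + (\<Sum>p\<in>P. S $ u $ p) / 8) + 6 * (if i = u then \<gamma> else 0)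
      + (s i / 2 + (\<Sum>p\<in>P. s p) / 8) / 2"
    using s[of i] by (simp add: row_simps)
  have ep: "e p = 196 * (if p = u then \<gamma> else 0) + e p / 8" if "p \<in> P" for p
    using e[of p] pU[OF that] by (simp add: row_simps)
  have ei: "e i = 196 * (if i = u then \<gamma> else 0) + (e i / 2 + (\<Sum>p\<in>P. e p) / 8) / 4"
    using e[of i] by (simp add: row_simps)
  have Fpp: "784 * y p + 28 * y i = - x * t p p" if "p \<in> P" for p
    using FT[of p p] pU[OF that] T_combination(1)[OF that] by (simp add: F_def)
  have Fip: "28 * y p + 9 * y i = - x * t i p" if "p \<in> P" for p
    using FT[of i p] pU[OF that] T_combination(2)[OF that] by (simp add: F_def)
  obtain p0 where p0: "p0 \<in> P" using card_P by fastforce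
  from \<beta>\<gamma> show ?thesis
  proof
    \<comment> \<open>The edge runs from \<open>l\<close> to \<open>u\<close>. The third-order rows
      force \<open>y = 0\<close> on \<open>U\<close>, and the rows \<open>(l, u)\<close> and
      \<open>(l, l, u)\<close> then give two different multiples of \<open>x\<close> for
      \<open>w u\<close>.\<close>
    assume b: "\<beta> = 0 \<and> \<gamma> = 1"
    have "t p q = 0" if "p \<in> P" "q \<in> P" for p q using tpq[OF that] b by simp
    then have "t i p = 0" "t p p = 0" if "p \<in> P" for p using tip[OF that] b that by simp_all
    then have "28 * y p0 + 9 * y i = 0" "784 * y p0 + 28 * y i = 0"
      using Fip[OF p0] Fpp[OF p0] p0 by simp_all
    then have yi: "y i = 0" by linarith
    have yp: "y p = 0" if "p \<in> P" for p
      using Fip[OF that] \<open>\<And>p. p \<in> P \<Longrightarrow> t i p = 0\<close>[OF that] yi by simp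
    have "f p = 0" if "p \<in> P" for p
      using S_combination(1)[OF that, of y] yi yp[OF that] by (simp add: f_def)
    moreover have "f i = 0" using S_combination(2)[of y] yi yp by (simp add: f_def)
    ultimately have "row u f = row u (\<lambda>_. 0)" by (intro row_cong) (use True in auto)
    then have r2u: "6 * w u + x * (12 + row u s) = 0"
      using r2[OF True] b by (simp add: f_def[abs_def])
    have r1u: "196 * w u + x * (784 + row u e) = 0" using r1[OF True] b by simp
    have "row u s = 4 \<and> row u e = 112"
    proof (cases "u = i")
      case True
      have "s p = 0" "e p = 0" if "p \<in> P" for p
        using sp[OF that] ep[OF that] b pU[OF that] True by simp_all
      then have "(\<Sum>p\<in>P. s p) = 0" "(\<Sum>p\<in>P. e p) = 0" by simp_all
      then show ?thesis using si ei b True by (simp add: row_simps)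
    next
      case False
      then have "u \<in> P" using \<open>u \<in> U\<close> by simp
      then show ?thesis using sp[of u] ep[of u] b False by (simp add: row_simps)
    qed
    then have "6 * w u + x * 16 = 0" "196 * w u + x * 896 = 0" using r1u r2u by simp_all
    then show ?thesis by linarith
  next
    \<comment> \<open>The edge runs from \<open>u\<close> to \<open>l\<close>. Now \<open>e\<close>
      and \<open>w\<close> vanish on \<open>U\<close>, and the second- and third-order rows
      overdetermine \<open>y\<close>.\<close>
    assume b: "\<beta> = 1 \<and> \<gamma> = 0"
    have ep0: "e p = 0" if "p \<in> P" for p using ep[OF that] b by (cases "p = u"; simp; linarith)
    then have "e i = 0" using ei b by (cases "i = u"; simp; linarith)
    then have "row c e = row c (\<lambda>_. 0)" if "c \<in> U" for c
      by (intro row_cong) (use that ep0 in auto)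
    then have w0: "w c = 0" if "c \<in> U" for c using r1[OF that] b that by (cases "c = u") simp_all
    have fs: "f c = - x * s c" if "c \<in> U" for c
    proof -
      have "f c + x * s c = 0"
      proof (rule row_injective[OF _ that])
        fix c assume "c \<in> U"
        then show "row c (\<lambda>q. f q + x * s q) = 0"
          using r2[of c] w0[of c] b unfolding f_def by (cases "c = u") (simp_all add: row_linear)
      qed
      then show ?thesis by simp
    qed
    have fp: "12 * y p + y i = - x * s p" if "p \<in> P" for p
      using fs[of p] S_combination(1)[OF that, of y] that by (simp add: f_def)
    have fi: "S $ i $ i * y i + (\<Sum>p\<in>P. y p) = - x * s i"
      using fs[of i] S_combination(2)[of y] by (simp add: f_def)
    show ?thesis
    proof (cases "u = i")
      \<comment> \<open>Three equations at a single parent \<open>p0\<close> suffice: the first two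
        give \<open>y p0 = x / 42\<close> and \<open>y i = - 20 / 21 * x\<close>, which contradicts
        the third unless \<open>x = 0\<close>.\<close>
      case True
      have "s p0 = 2 / 3" using sp[OF p0] b True S_i[of p0] p0 pU[OF p0] by simp
      moreover have tpq': "t q p0 = (if q = p0 then 8 else 0)" if "q \<in> P" for q
        using tpq[OF that p0] b True T_i[of q p0] pU[OF that] pU[OF p0] p0 by (simp split: if_splits)
      moreover have "t i p0 = 34 / 7"
      proof -
        have "(\<Sum>q\<in>P. t q p0) = (\<Sum>q\<in>P. if q = p0 then 8 else 0)"
          by (rule sum.cong) (use tpq' in auto)
        then have "(\<Sum>q\<in>P. t q p0) = 8" using p0 by simp
        moreover have "(\<Sum>q\<in>P. T $ i $ q $ p0) = (\<Sum>q\<in>P. if q = p0 then 28 else 0)"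
          by (rule sum.cong) (use T_i pU p0 in auto)
        then have "(\<Sum>q\<in>P. T $ i $ q $ p0) = 28" using p0 by simp
        ultimately have "t i p0 = 17 / 4 + t i p0 / 8"
          using tip[OF p0] b True T_ii[of p0] pU[OF p0] p0 by (simp add: add_divide_distrib)
        then show ?thesis by linarith
      qed
      ultimately have "12 * y p0 + y i = - x * (2 / 3)" "784 * y p0 + 28 * y i = - x * 8"
        "28 * y p0 + 9 * y i = - x * (34 / 7)"
        using fp[OF p0] Fpp[OF p0] Fip[OF p0] p0 by simp_all
      then show ?thesis by linarith
    next
      \<comment> \<open>The equations at \<open>u\<close> itself fix \<open>y u = 0\<close> and
        \<open>y i = - 8 * x\<close>; a second parent, if present, is then determined too, and the
        row \<open>(l, i)\<close> fails unless \<open>x = 0\<close>.\<close>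
      case False
      then have u: "u \<in> P" using \<open>u \<in> U\<close> by simp
      have su: "s p = (if p = u then 8 else 0)" if "p \<in> P" for p
        using sp[OF that] b S_off[of u p] pU[OF u] pU[OF that] by (simp split: if_splits)
      have tuu: "t u u = 224" using tpq[OF u u] b T_off[of u u u] pU[OF u] by simp
      have sums: "(\<Sum>p\<in>P. s p) = 8"
      proof -
        have "(\<Sum>p\<in>P. s p) = (\<Sum>p\<in>P. if p = u then 8 else 0)"
          by (rule sum.cong) (use su in auto)
        then show ?thesis using u by simp
      qed
      have "s i = 5 / 2 + s i / 4"
        using si sums sum_P_S(4)[of u] S_i'[of u] pU[OF u] u b False
        by (cases "i = u") (simp_all add: add_divide_distrib)
      then have si': "s i = 10 / 3" by linarith
      have 1: "12 * y u + y i = - x * 8" "784 * y u + 28 * y i = - x * 224"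
        using fp[OF u] su[OF u] Fpp[OF u] tuu by simp_all
      then have y: "y u = 0" "y i = - 8 * x" by linarith+
      have yp: "y p = 2 / 3 * x" if "p \<in> P - {u}" for p
        using fp[of p] su[of p] that y by simp
      have "(\<Sum>p\<in>P. y p) = y u + (\<Sum>p\<in>P - {u}. y p)" using u by (simp add: sum.remove)
      also have "(\<Sum>p\<in>P - {u}. y p) = (\<Sum>p\<in>P - {u}. 2 / 3 * x)"
        by (rule sum.cong[OF refl]) (rule yp)
      also have "y u + \<dots> = (card P - 1) * (2 / 3 * x)" using y u by simp
      finally have "(12 + 5 * card P / 12) * (- 8 * x) + (card P - 1) * (2 / 3 * x) = - x * (10 / 3)"
        using fi si' y by (simp add: S_ii)
      then show ?thesis using card_P by (elim disjE) (simp_all add: field_simps)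
    qed
  qed
qed

end

context collider
begin

text \<open>\<open>C\<close> is the component of \<open>u\<close> in the base graph, and
  \<open>A0\<close> has no entries between different components.\<close>

lemma row_component:
  assumes "C = (if u \<in> U then U else {u})" "c \<in> C" "\<And>r. r \<in> C \<Longrightarrow> f r = 0"
  shows "row c f = 0"
proof -
  have "row c f = row c (\<lambda>_. 0)"
    by (rule row_cong) (use assms in \<open>auto split: if_splits\<close>)
  then show ?thesis by simp
qed

lemma component_zero:
  assumes "C = (if u \<in> U then U else {u})" "m \<notin> C" "c \<in> C"
  shows "S $ m $ c = 0" "T $ m $ c $ q = 0"
proof -
  have "(m \<notin> U \<or> c \<notin> U) \<and> m \<noteq> c" using assms by (auto split: if_splits)
  then show "S $ m $ c = 0" "T $ m $ c $ q = 0"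
    using S_out[of m c] S_out[of c m] T_out[of m c q] T_out[of c m q] by auto
qed

text \<open>The rows \<open>(l, l, c)\<close>, \<open>(l, c)\<close> and \<open>(l, c, d)\<close>
  with \<open>c\<close>, \<open>d\<close> in the component of the parent yield the attachment
  equations. There \<open>s\<close>, \<open>t\<close>, \<open>e\<close> are first-order changes of
  the cumulants between \<open>l\<close> and the component, and \<open>w\<close>, \<open>y\<close>
  come from column and row \<open>l\<close> of the correction \<open>Y\<close>. Independence of
  \<open>l\<close> at the base point removes the other terms.\<close>

lemma attached_node_vanishes:
  assumes l: "l \<notin> U" and lC: "l \<notin> C" and C: "C = (if u \<in> U then U else {u})"
    and \<beta>\<gamma>: "(\<beta> = 1 \<and> \<gamma> = 0) \<or> (\<beta> = 0 \<and> \<gamma> = (1 :: real))"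
    and B: "\<And>m. m \<in> C \<Longrightarrow> B $ l $ m = (if m = u then \<beta> else 0)"
      "\<And>m. m \<in> C \<Longrightarrow> B $ m $ l = (if m = u then \<gamma> else 0)"
    and X: "\<And>m. m \<noteq> l \<Longrightarrow> X $ l $ m = 0" "\<And>c m. c \<in> C \<Longrightarrow> X $ c $ m = 0"
    and S1: "\<And>a b. S1 $ a $ b = contract2 B A0 S a b + contract2 A0 B S a b + contract2 A0 A0 S1 a b"
    and T1: "\<And>a b c. T1 $ a $ b $ c = contract3 B A0 A0 T a b c + contract3 A0 B A0 T a b c
      + contract3 A0 A0 B T a b c + contract3 A0 A0 A0 T1 a b c"
    and Y2: "\<And>a b. a \<noteq> b \<Longrightarrow> jac2 A0 S Y a b + jac2_deriv A0 B S S1 X a b = 0"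
    and Y3: "\<And>a b c. \<not> (a = b \<and> b = c) \<Longrightarrow> jac3 A0 T Y a b c + jac3_deriv A0 B T T1 X a b c = 0"
  shows "X $ l $ l = 0"
proof -
  have li: "l \<noteq> i" using l by auto
  have uC: "u \<in> C" using C by (auto split: if_splits)
  have ne: "c \<noteq> l" if "c \<in> C" for c using that lC by auto
  note rl = row_simps(1)[OF li]
  note row0 = row_component[OF C]
  note comp = component_zero[OF C]
  note Tl = T_out[OF l]
  note Sl = S_out[OF l]
  have sumB: "(\<Sum>m\<in>UNIV. B $ l $ m * g m) = \<beta> * g u" if "\<And>m. m \<notin> C \<Longrightarrow> g m = 0" for g
  proof -
    have "(\<Sum>m\<in>UNIV. B $ l $ m * g m) = (\<Sum>m\<in>UNIV. if m = u then \<beta> * g u else 0)"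
    proof (rule sum.cong[OF refl])
      fix m show "B $ l $ m * g m = (if m = u then \<beta> * g u else 0)"
        using B(1)[of m] that[of m] uC by (cases "m \<in> C") auto
    qed
    then show ?thesis by simp
  qed
  have sumX: "(\<Sum>m\<in>UNIV. X $ l $ m * g m) = X $ l $ l * g l" for g
  proof -
    have "(\<Sum>m\<in>UNIV. X $ l $ m * g m) = (\<Sum>m\<in>UNIV. if m = l then X $ l $ l * g l else 0)"
      by (rule sum.cong) (use X(1) in auto)
    then show ?thesis by simp
  qed
  have sumXc: "(\<Sum>m\<in>UNIV. X $ c $ m * g m) = 0" if "c \<in> C" for c g
    by (rule sum.neutral) (use X(2)[OF that] in simp)
  have sumS: "(\<Sum>m\<in>UNIV. h m * S $ l $ m) = 12 * h l" for h
    using sum_single[of l "\<lambda>m. S $ l $ m" h] by (simp add: Sl)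
  have sumT: "(\<Sum>m\<in>UNIV. h m * T $ l $ l $ m) = 784 * h l" for h
    using sum_single[of l "\<lambda>m. T $ l $ l $ m" h] by (simp add: Tl)
  have T0: "row c (\<lambda>q. T $ p $ l $ q) = 0" "row c (\<lambda>q. T $ l $ p $ q) = 0" if "c \<in> C" for c p
    by (rule row_out[OF l ne[OF that]]; simp add: Tl)+
  have T0': "row c (\<lambda>q. \<Sum>r\<in>UNIV. h r * T $ l $ q $ r) = 0" if "c \<in> C" for c h
    by (rule row_out[OF l ne[OF that]]) (simp add: Tl)
  have Bl: "B $ c $ l = (if c = u then \<gamma> else 0)" if "c \<in> C" for c using B(2)[OF that] .
  define x where "x = X $ l $ l"
  show ?thesis unfolding x_def[symmetric]
  proof (rule attachment_equations[OF C \<beta>\<gamma>, where s = "\<lambda>c. S1 $ l $ c" and t = "\<lambda>c d. T1 $ l $ c $ d"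
        and e = "\<lambda>c. T1 $ l $ l $ c" and w = "\<lambda>c. Y $ c $ l" and y = "\<lambda>m. Y $ l $ m"])
    fix c assume c: "c \<in> C"
    have "contract2 B A0 S l c = \<beta> * row c (\<lambda>q. S $ u $ q)"
      unfolding contract2_nested row_sum by (rule sumB) (rule row0[OF c], rule comp(1))
    moreover have "contract2 A0 B S l c = 6 * (if c = u then \<gamma> else 0)"
      unfolding contract2_nested row_sum rl sumS Bl[OF c] by simp
    moreover have "contract2 A0 A0 S1 l c = row c (\<lambda>c. S1 $ l $ c) / 2"
      unfolding contract2_nested row_sum rl ..
    ultimately show "S1 $ l $ c = \<beta> * row c (\<lambda>q. S $ u $ q) + 6 * (if c = u then \<gamma> else 0)
        + row c (\<lambda>c. S1 $ l $ c) / 2"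
      using S1[of l c] by linarith
    have "contract3 B A0 A0 T l l c = 0" "contract3 A0 B A0 T l l c = 0"
      unfolding contract3_nested row_sum rl T0[OF c] by simp_all
    moreover have "contract3 A0 A0 B T l l c = 196 * (if c = u then \<gamma> else 0)"
      unfolding contract3_nested row_sum rl sumT Bl[OF c] by simp
    moreover have "contract3 A0 A0 A0 T1 l l c = row c (\<lambda>c. T1 $ l $ l $ c) / 4"
      unfolding contract3_nested row_sum rl by simp
    ultimately show "T1 $ l $ l $ c = 196 * (if c = u then \<gamma> else 0) + row c (\<lambda>c. T1 $ l $ l $ c) / 4"
      using T1[of l l c] by linarith
    have "jac3 A0 T Y l l c + jac3_deriv A0 B T T1 X l l c = 0" by (rule Y3) (use ne[OF c] in auto)
    moreover have "jac3 A0 T Y l l c = 196 * Y $ c $ l"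
      unfolding jac3_nested rl T0[OF c] sumT by simp
    moreover have "jac3_deriv A0 B T T1 X l l c
        = x * (784 * (if c = u then \<gamma> else 0) + row c (\<lambda>c. T1 $ l $ l $ c))"
      unfolding jac3_deriv_def contract3_nested row_sum sumX sumXc[OF c] rl T0[OF c] sumT Bl[OF c] x_def
      by (simp add: row_linear algebra_simps)
    ultimately show "196 * Y $ c $ l + x * (784 * (if c = u then \<gamma> else 0) + row c (\<lambda>c. T1 $ l $ l $
        c)) = 0"
      by simp
    have "jac2 A0 S Y l c + jac2_deriv A0 B S S1 X l c = 0" by (rule Y2) (use ne[OF c] in auto)
    moreover have "jac2 A0 S Y l c = row c (\<lambda>q. \<Sum>m\<in>UNIV. Y $ l $ m * S $ m $ q) + 6 * Y $ c $ l"
      unfolding jac2_nested rl sumS by (simp add: row_linear)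
    moreover have "jac2_deriv A0 B S S1 X l c = x * (12 * (if c = u then \<gamma> else 0) + row c (\<lambda>c. S1 $
        l $ c))"
      unfolding jac2_deriv_def contract2_nested row_sum sumX sumXc[OF c] rl sumS Bl[OF c] x_def
      by (simp add: algebra_simps)
    ultimately show "row c (\<lambda>q. \<Sum>m\<in>UNIV. Y $ l $ m * S $ m $ q) + 6 * Y $ c $ l
        + x * (12 * (if c = u then \<gamma> else 0) + row c (\<lambda>c. S1 $ l $ c)) = 0"
      by simp
    fix d assume d: "d \<in> C"
    have z: "row c (\<lambda>q. row d (\<lambda>r. T $ m $ q $ r)) = 0" if "m \<notin> C" for m
      by (rule row0[OF c], simp only: comp(2)[OF that], simp)
    have "contract3 B A0 A0 T l c d = \<beta> * row c (\<lambda>q. row d (\<lambda>r. T $ u $ q $ r))"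
      unfolding contract3_nested row_sum by (rule sumB) (rule z)
    moreover have "contract3 A0 B A0 T l c d = 0" "contract3 A0 A0 B T l c d = 0"
      unfolding contract3_nested row_sum rl T0[OF d] T0'[OF c] by simp_all
    moreover have "contract3 A0 A0 A0 T1 l c d = row c (\<lambda>q. row d (\<lambda>r. T1 $ l $ q $ r)) / 2"
      unfolding contract3_nested row_sum rl ..
    ultimately show "T1 $ l $ c $ d = \<beta> * row c (\<lambda>q. row d (\<lambda>r. T $ u $ q $ r))
        + row c (\<lambda>q. row d (\<lambda>r. T1 $ l $ q $ r)) / 2"
      using T1[of l c d] by linarith
    have "jac3 A0 T Y l c d + jac3_deriv A0 B T T1 X l c d = 0" by (rule Y3) (use ne[OF c] in auto)
    moreover have "jac3 A0 T Y l c d = row c (\<lambda>q. row d (\<lambda>r. \<Sum>m\<in>UNIV. Y $ l $ m * T $ m $ q $ r))"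
      unfolding jac3_nested rl T0[OF d] T0'[OF c] by (simp add: row_linear)
    moreover have "jac3_deriv A0 B T T1 X l c d = x * row c (\<lambda>q. row d (\<lambda>r. T1 $ l $ q $ r))"
      unfolding jac3_deriv_def contract3_nested row_sum sumX sumXc[OF c] sumXc[OF d] rl T0[OF d]
          T0'[OF c] x_def
      by simp
    ultimately show "row c (\<lambda>q. row d (\<lambda>r. \<Sum>m\<in>UNIV. Y $ l $ m * T $ m $ q $ r))
        + x * row c (\<lambda>q. row d (\<lambda>r. T1 $ l $ q $ r)) = 0"
      by simp
  qed
qed

end

section \<open>The kernel on the collider block\<close>

context collider
begin

lemma row_scaled:
  "a \<noteq> i \<Longrightarrow> row a f = 1 / 2 * f a" "row i f = 1 / 2 * f i + 1 / 8 * (\<Sum>p\<in>P. f p)"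
  by (simp_all add: row_def)

lemma T_values:
  assumes "b \<in> P" "c \<in> P"
  shows "T $ i $ b $ c = (if b = c then 28 else 0)" "T $ b $ i $ c = (if b = c then 28 else 0)"
    "T $ b $ c $ i = (if b = c then 28 else 0)"
    "T $ i $ i $ b = 9" "T $ i $ b $ i = 9" "T $ b $ i $ i = 9"
    "a \<in> P \<Longrightarrow> T $ a $ b $ c = (if a = b \<and> b = c then 784 else 0)"
proof -
  have n: "b \<noteq> i" "c \<noteq> i" using assms P_neq by auto
  show *: "T $ i $ b $ c = (if b = c then 28 else 0)" using T_i[OF n] assms by auto
  then show "T $ b $ i $ c = (if b = c then 28 else 0)" "T $ b $ c $ i = (if b = c then 28 else 0)"
    using T_perm[of b c] by simp_all
  show 9: "T $ i $ i $ b = 9" using T_ii[OF n(1)] assms by simp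
  then show 9: "T $ i $ b $ i = 9" using T_sym(2)[of i i b] by simp
  then show "T $ b $ i $ i = 9" using T_sym(1)[of i b i] by simp
  show "T $ a $ b $ c = (if a = b \<and> b = c then 784 else 0)" if "a \<in> P"
    using T_off[OF _ n, of a] P_neq[OF that] by simp
qed

lemma S_values:
  assumes "b \<in> P" "c \<in> P"
  shows "S $ i $ b = 1" "S $ b $ i = 1" "S $ b $ c = (if b = c then 12 else 0)"
  using S_i[of b] S_i'[of b] S_off[of b c] assms P_neq by auto

lemma sum_kernel_row:
  assumes "jac_vanishes A0 S T X" "a \<in> U"
  shows "(\<Sum>m\<in>UNIV. X $ a $ m * g m) = X $ a $ i * g i + (\<Sum>p\<in>P. X $ a $ p * g p)"
proof -
  have "X $ a $ m = 0" if "m \<notin> U" for m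
    by (rule kernel_vanishes_into_outside[OF assms(1) that]) (use assms(2) that in auto)
  then show ?thesis using sum_on_U[of "\<lambda>m. X $ a $ m" g] by (simp add: mult.commute)
qed

text \<open>Without the edge from \<open>i\<close> to \<open>j\<close> three unknowns remain. The
  rows \<open>(i, j)\<close>, \<open>(i, j, j)\<close> and \<open>(i, i, j)\<close>, scaled to the
  integer system \<open>e\<close>, have determinant -208.\<close>

lemma block_vanishes_single:
  assumes van: "jac_vanishes A0 S T X" and P: "P = {j}" and ji: "X $ j $ i = 0"
    and ab: "a \<in> U" "b \<in> U"
  shows "X $ a $ b = 0"
proof -
  have U: "i \<in> U" "j \<in> U" and jP: "j \<in> P" and n: "j \<noteq> i" using P P_neq by auto
  note sm = sum_kernel_row[OF van U(1)] sum_kernel_row[OF van U(2)]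
  have sP: "(\<Sum>p\<in>P. h p) = h j" for h :: "'n \<Rightarrow> real" using P by simp
  note vals = T_values[OF jP jP, simplified] T_values(7)[OF jP jP jP, simplified]
    S_values[OF jP jP, simplified]
  note ex = jac2_nested jac3_nested sm row_scaled(1)[OF n] row_scaled(2) sP vals ji
  have "jac2 A0 S X i j = 0" by (rule jac_vanishesD(1)[OF van]) (use n in auto)
  note 1 = this[unfolded ex, simplified]
  have "jac3 A0 T X i j j = 0" by (rule jac_vanishesD(2)[OF van]) (use n in auto)
  note 2 = this[unfolded ex, simplified]
  have "jac3 A0 T X i i j = 0" by (rule jac_vanishesD(2)[OF van]) (use n in auto)
  note 3 = this[unfolded ex, simplified]
  have e: "X $ i $ i + 12 * X $ i $ j + 4 * X $ j $ j = 0"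
    "X $ i $ i + 28 * X $ i $ j + 16 * X $ j $ j = 0"
    "4 * X $ i $ i + 56 * X $ i $ j + 9 * X $ j $ j = 0"
    using 1 2 3 by (simp_all add: field_simps)
  then have "X $ j $ j = 0" by linarith
  then have "X $ i $ i = 0" "X $ i $ j = 0" "X $ j $ j = 0" using e by linarith+
  then show ?thesis using ab P ji by auto
qed

text \<open>All ten off-diagonal rows on the three nodes are written out with all nine entries of
  the block as unknowns, which covers every pattern of edges among them.\<close>

lemma block_vanishes_pair:
  assumes van: "jac_vanishes A0 S T X" and P: "P = {j, k}" and jk: "j \<noteq> k"
    and ab: "a \<in> U" "b \<in> U"
  shows "X $ a $ b = 0"
proof -
  have U: "i \<in> U" "j \<in> U" "k \<in> U" and jP: "j \<in> P" "k \<in> P" and n: "j \<noteq> i" "k \<noteq> i" using P P_neq by auto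
  note sm = sum_kernel_row[OF van U(1)] sum_kernel_row[OF van U(2)] sum_kernel_row[OF van U(3)]
  have sP: "(\<Sum>p\<in>P. h p) = h j + h k" for h :: "'n \<Rightarrow> real" using P jk by simp
  have Pc: "card P = 2" using P jk by simp
  have ii: "T $ i $ i $ i = 11073 / 14" "S $ i $ i = 77 / 6"
    using T_iii S_ii Pc by simp_all
  have T0: "T $ j $ j $ k = 0" "T $ j $ k $ j = 0" "T $ k $ j $ j = 0" "T $ j $ k $ k = 0" "T $ k $
      j $ k = 0"
    "T $ k $ k $ j = 0" "T $ j $ j $ j = 784" "T $ k $ k $ k = 784"
    using T_off n jk by auto
  note vals = T_values(1-6)[OF jP(1) jP(1), simplified] T_values(1-6)[OF jP(2) jP(2), simplified]
    T_values(1-3)[OF jP(1) jP(2), simplified jk jk[symmetric] if_False simp_thms]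
    T_values(1-3)[OF jP(2) jP(1), simplified jk jk[symmetric] if_False simp_thms] T0
    S_values[OF jP(1) jP(1), simplified] S_values[OF jP(2) jP(2), simplified]
    S_values(3)[OF jP(1) jP(2), simplified jk if_False simp_thms]
    S_values(3)[OF jP(2) jP(1), simplified jk[symmetric] if_False simp_thms]
    ii
  note ex = jac2_nested jac3_nested sm row_scaled(1)[OF n(1)] row_scaled(1)[OF n(2)] row_scaled(2)
      sP vals
  note v2 = jac_vanishesD(1)[OF van] and v3 = jac_vanishesD(2)[OF van]
  note ne = n n[symmetric] jk jk[symmetric]
  have "jac2 A0 S X i j = 0" by (rule v2) (use ne in auto)
  note 1 = this[unfolded ex, simplified]
  have "jac2 A0 S X i k = 0" by (rule v2) (use ne in auto)
  note 2 = this[unfolded ex, simplified]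
  have "jac2 A0 S X j k = 0" by (rule v2) (use ne in auto)
  note 3 = this[unfolded ex, simplified]
  have "jac3 A0 T X i j j = 0" by (rule v3) (use ne in auto)
  note 4 = this[unfolded ex, simplified]
  have "jac3 A0 T X i k k = 0" by (rule v3) (use ne in auto)
  note 5 = this[unfolded ex, simplified]
  have "jac3 A0 T X i i j = 0" by (rule v3) (use ne in auto)
  note 6 = this[unfolded ex, simplified]
  have "jac3 A0 T X i i k = 0" by (rule v3) (use ne in auto)
  note 7 = this[unfolded ex, simplified]
  have "jac3 A0 T X j j k = 0" by (rule v3) (use ne in auto)
  note 8 = this[unfolded ex, simplified]
  have "jac3 A0 T X j k k = 0" by (rule v3) (use ne in auto)
  note 9 = this[unfolded ex, simplified]
  have "jac3 A0 T X i j k = 0" by (rule v3) (use ne in auto)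
  note 10 = this[unfolded ex, simplified]
  define x1 x2 x3 y1 y2 y3 z1 z2 z3 where x: "x1 = X $ i $ i" "x2 = X $ i $ j" "x3 = X $ i $ k"
    "y1 = X $ j $ i" "y2 = X $ j $ j" "y3 = X $ j $ k" "z1 = X $ k $ i" "z2 = X $ k $ j" "z3 = X $ k
        $ k"
  note eqs = 1 2 3 4 5 6 7 8 9 10
  have "3 * x1 + 36 * x2 + 40 * y1 + 12 * y2 + 12 * y3 = 0"
    "3 * x1 + 36 * x3 + 40 * z1 + 12 * z3 + 12 * z2 = 0"
    using eqs(1,2) unfolding x[symmetric] by (simp_all add: field_simps)
  moreover have "y1 + 12 * y3 + z1 + 12 * z2 = 0" "z1 + 28 * z2 = 0" "y1 + 28 * y3 = 0"
      "y1 + 14 * y3 + z1 + 14 * z2 = 0"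
    using eqs(3,8,9,10) unfolding x[symmetric] by (simp_all add: field_simps)
  moreover have "7 * x1 + 196 * x2 + 8 * y1 + 112 * y2 = 0" "7 * x1 + 196 * x3 + 8 * z1 + 112 * z3 = 0"
    using eqs(4,5) unfolding x[symmetric] by (simp_all add: field_simps)
  moreover have "28 * x1 + 392 * x2 + 703 * y1 + 63 * y2 + 63 * y3 = 0"
    "28 * x1 + 392 * x3 + 703 * z1 + 63 * z2 + 63 * z3 = 0"
    using eqs(6,7) unfolding x[symmetric] by (simp_all add: field_simps)
  ultimately have "x1 = 0" "x2 = 0" "x3 = 0" "y1 = 0" "y2 = 0" "y3 = 0" "z1 = 0" "z2 = 0" "z3 = 0"
    by linarith+
  then have "X $ i $ i = 0" "X $ i $ j = 0" "X $ i $ k = 0" "X $ j $ i = 0" "X $ j $ j = 0" "X $ j $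
      k = 0"
     "X $ k $ i = 0" "X $ k $ j = 0" "X $ k $ k = 0" unfolding x .
  then show ?thesis using ab P by auto
qed

end

section \<open>The spanning forest and the choice of the point\<close>

lemma connected_leaves_proper_subset:
  assumes "graph_connected E" "a \<in> V" "c \<notin> V"
  shows "\<exists>x\<in>V. \<exists>y. y \<notin> V \<and> (x, y) \<in> E \<union> E\<inverse>"
proof (rule ccontr)
  assume neg: "\<not> ?thesis"
  have "(a, c) \<in> (E \<union> E\<inverse>)\<^sup>*" using assms(1) unfolding graph_connected_def by blast
  then have "c \<in> V"
  proof (induction rule: rtrancl_induct)
    case base
    then show ?case by fact
  next
    case (step y z)
    then show ?case using neg by blast
  qed
  then show False using assms(3) by contradiction
qed

text \<open>\<open>dist\<close> is the length of a shortest undirected path from \<open>U\<close>,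
  and \<open>par l\<close> the last node before \<open>l\<close> on such a path. The strict decrease
  excludes cycles and later carries the induction.\<close>

lemma parent_towards_subset:
  assumes "graph_connected E" "u0 \<in> U"
  obtains par :: "'n \<Rightarrow> 'n" and dist :: "'n \<Rightarrow> nat"
  where "\<And>l. l \<notin> U \<Longrightarrow> dist (par l) < dist l \<and> (par l, l) \<in> E \<union> E\<inverse>"
proof -
  define R where "R = E \<union> E\<inverse>"
  define dist where "dist l = (LEAST n. \<exists>u\<in>U. (u, l) \<in> R ^^ n)" for l
  have ex: "\<exists>n. \<exists>u\<in>U. (u, l) \<in> R ^^ n" for l
    using assms rtrancl_imp_relpow[of "(u0, l)" R] unfolding graph_connected_def R_def by blast
  have "\<exists>z. dist z < dist l \<and> (z, l) \<in> E \<union> E\<inverse>" if l: "l \<notin> U" for l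
  proof -
    obtain u where u: "u \<in> U" "(u, l) \<in> R ^^ dist l"
      using LeastI_ex[OF ex[of l]] unfolding dist_def by blast
    have "dist l \<noteq> 0"
    proof
      assume "dist l = 0"
      then show False using u l by simp
    qed
    then obtain n where n: "dist l = Suc n" by (cases "dist l") auto
    obtain z where z: "(u, z) \<in> R ^^ n" "(z, l) \<in> R"
      using u(2) unfolding n by (rule relpow_Suc_E)
    have "dist z \<le> n" unfolding dist_def by (rule Least_le) (use u(1) z(1) in blast)
    then show ?thesis using z(2) n unfolding R_def by (intro exI[of _ z]) simp
  qed
  then have "\<exists>par. \<forall>l. l \<notin> U \<longrightarrow> dist (par l) < dist l \<and> (par l, l) \<in> E \<union> E\<inverse>"
    by (intro choice) blast
  then show thesis using that by blast
qed

lemma injective_point_from_collider: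
  fixes E :: "('n::finite \<times> 'n) set"
  assumes conn: "graph_connected E" and loops: "\<And>a. (a, a) \<in> E"
    and col: "collider i P" and edges: "\<And>p. p \<in> P \<Longrightarrow> (p, i) \<in> E"
    and block: "\<And>X a b. X \<in> graph_matrices E \<Longrightarrow>
      jac_vanishes (collider.A0 i P) (cumulant2 (base_param (collider.A0 i P)))
        (cumulant3 (base_param (collider.A0 i P))) X \<Longrightarrow>
      a \<in> insert i P \<Longrightarrow> b \<in> insert i P \<Longrightarrow> X $ a $ b = 0"
  shows "\<exists>\<theta> \<in> dominated_params. fst \<theta> \<in> graph_matrices E \<and>
    jac_injective E (fst \<theta>) (cumulant2 \<theta>) (cumulant3 \<theta>)"
proof -
  interpret collider i P by (rule col)
  obtain par dist where par: "\<And>l. l \<notin> U \<Longrightarrow> dist (par l) < (dist l :: nat)"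
    and par_edge: "\<And>l. l \<notin> U \<Longrightarrow> (par l, l) \<in> E \<union> E\<inverse>"
    using parent_towards_subset[OF conn insertI1[of i P]] by metis
  \<comment> \<open>Each forest edge is used in one direction only: from parent to node if that edge
    is in \<open>E\<close>, and reversed otherwise. This keeps \<open>B\<close> on the graph and
    makes exactly one of \<open>\<beta>\<close>, \<open>\<gamma>\<close> equal to 1.\<close>
  define B :: "'n matrix" where "B = (\<chi> a b. if (a \<notin> U \<and> b = par a \<and> (b, a) \<in> E)
      \<or> (b \<notin> U \<and> a = par b \<and> (a, b) \<notin> E) then 1 else 0)"
  have B: "B \<in> graph_matrices E"
    unfolding graph_matrices_def B_def using par_edge by auto
  have A: "A0 \<in> graph_matrices E"
    unfolding graph_matrices_def A0_def using loops edges by auto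
  have injective: "eventually (\<lambda>e. jac_injective E (A0 + e *\<^sub>R B)
     (cumulant2 (base_param (A0 + e *\<^sub>R B))) (cumulant3 (base_param (A0 + e *\<^sub>R B)))) (at 0)"
  proof (rule jac_injective_perturbed[OF schur_stable_row_sums[OF stable_A0]])
    fix S1 T1 X Y
    assume X: "X \<in> graph_matrices E"
      and S1: "\<And>a b. S1 $ a $ b = contract2 B A0 S a b + contract2 A0 B S a b + contract2 A0 A0 S1 a b"
      and T1: "\<And>a b c. T1 $ a $ b $ c = contract3 B A0 A0 T a b c + contract3 A0 B A0 T a b c
        + contract3 A0 A0 B T a b c + contract3 A0 A0 A0 T1 a b c"
      and van: "jac_vanishes A0 S T X"
      and Y2: "\<And>a b. a \<noteq> b \<Longrightarrow> jac2 A0 S Y a b + jac2_deriv A0 B S S1 X a b = 0"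
      and Y3: "\<And>a b c. \<not> (a = b \<and> b = c) \<Longrightarrow> jac3 A0 T Y a b c + jac3_deriv A0 B T T1 X a b c = 0"
    have off: "X $ a $ b = 0" if "a \<noteq> b" for a b
    proof (cases "b \<in> U")
      case False
      then show ?thesis using kernel_vanishes_into_outside[OF van False that] by simp
    next
      case True
      then show ?thesis using block[OF X van] kernel_vanishes_from_outside[OF van] by (cases "a \<in>
          U") auto
    qed
    have outside: "X $ l $ l = 0" if "l \<notin> U" for l
      using that
    proof (induction "dist l" arbitrary: l rule: less_induct)
      case less
      define u where "u = par l"
      define C where "C = (if u \<in> U then U else {u})"
      have dist: "dist u < dist l" unfolding u_def by (rule par[OF less.prems])
      then have "u \<noteq> l" by auto
      then have lC: "l \<notin> C" using less.prems by (simp add: C_def)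
      have CU: "m \<in> U \<or> m = u" if "m \<in> C" for m using that by (auto simp: C_def split: if_splits)
      \<comment> \<open>If \<open>l\<close> were the parent of an outside node of \<open>C\<close>,
        then \<open>B\<close> would have a second entry between \<open>l\<close> and
        \<open>C\<close>; the distances exclude this.\<close>
      have par_par: "m \<in> U" if "m \<in> C" "l = par m" for m
      proof (rule ccontr)
        assume m: "m \<notin> U"
        then have "m = u" using CU[OF that(1)] by simp
        then show False using par[OF m] dist that(2) by simp
      qed
      define \<beta> :: real where "\<beta> = (if (u, l) \<in> E then 1 else 0)"
      define \<gamma> :: real where "\<gamma> = (if (u, l) \<in> E then 0 else 1)"
      show ?case
      proof (rule attached_node_vanishes[OF less.prems lC C_def, of \<beta> \<gamma> B X S1 T1 Y])
        show "(\<beta> = 1 \<and> \<gamma> = 0) \<or> (\<beta> = 0 \<and> \<gamma> = 1)" by (simp add: \<beta>_def \<gamma>_def)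
        show "B $ l $ m = (if m = u then \<beta> else 0)" if "m \<in> C" for m
          using less.prems par_par[OF that] by (auto simp: B_def u_def \<beta>_def)
        show "B $ m $ l = (if m = u then \<gamma> else 0)" if "m \<in> C" for m
          using less.prems par_par[OF that] by (auto simp: B_def u_def \<gamma>_def)
        show "X $ l $ m = 0" if "m \<noteq> l" for m using off[of l m] that by simp
        show "X $ c $ m = 0" if "c \<in> C" for c m
        proof (cases "c = m")
          case True
          then show ?thesis using CU[OF that] less.hyps[OF dist] block[OF X van] by blast
        qed (rule off)
      qed (fact S1 T1 Y2 Y3)+
    qed
    show "X = 0"
      unfolding vec_eq_iff
    proof (intro allI)
      fix a b
      show "X $ a $ b = 0 $ a $ b"
      proof (cases "a = b")
        case True
        then show ?thesis using outside[of a] block[OF X van, of a a] by (cases "a \<in> U") auto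
      qed (use off in simp)
    qed
  qed
  have dom0: "base_param A0 \<in> dominated_params"
    using stable_A0 by (simp add: dominated_params_def)
  have "open ((\<lambda>e. base_param (A0 + e *\<^sub>R B)) -` dominated_params)"
    by (intro open_vimage open_dominated_params continuous_intros)
  moreover have "0 \<in> (\<lambda>e. base_param (A0 + e *\<^sub>R B)) -` dominated_params"
    using dom0 by simp
  ultimately have "eventually (\<lambda>e. e \<in> (\<lambda>e. base_param (A0 + e *\<^sub>R B)) -` dominated_params) (at 0)"
    by (rule eventually_at_in_open')
  with injective have "eventually (\<lambda>e. jac_injective E (A0 + e *\<^sub>R B)
     (cumulant2 (base_param (A0 + e *\<^sub>R B))) (cumulant3 (base_param (A0 + e *\<^sub>R B)))
     \<and> base_param (A0 + e *\<^sub>R B) \<in> dominated_params) (at 0)"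
    by eventually_elim simp
  then obtain e where e: "jac_injective E (A0 + e *\<^sub>R B)
     (cumulant2 (base_param (A0 + e *\<^sub>R B))) (cumulant3 (base_param (A0 + e *\<^sub>R B)))"
     "base_param (A0 + e *\<^sub>R B) \<in> dominated_params"
    using eventually_happens'[OF at_neq_bot[of "0 :: real"]] by blast
  moreover have "A0 + e *\<^sub>R B \<in> graph_matrices E"
    using A B subspace_graph_matrices by (intro subspace_add subspace_scale) auto
  ultimately show ?thesis by (intro bexI[OF _ e(2)]) simp
qed

lemma exists_injective_point:
  fixes E :: "('n::finite \<times> 'n) set"
  assumes card: "CARD('n) \<ge> 3" and conn: "graph_connected E" and loops: "\<And>a. (a, a) \<in> E"
  shows "\<exists>\<theta> \<in> dominated_params. fst \<theta> \<in> graph_matrices E \<and>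
    jac_injective E (fst \<theta>) (cumulant2 \<theta>) (cumulant3 \<theta>)"
proof (cases "\<exists>j i. (j, i) \<in> E \<and> (i, j) \<notin> E")
  case True
  then obtain j i where ji: "(j, i) \<in> E" "(i, j) \<notin> E" by blast
  then have "i \<noteq> j" using loops by auto
  then have col: "collider i {j}" by unfold_locales auto
  interpret collider i "{j}" by (rule col)
  show ?thesis
  proof (rule injective_point_from_collider[OF conn loops col])
    show "(p, i) \<in> E" if "p \<in> {j}" for p using that ji by simp
    fix X a b assume X: "X \<in> graph_matrices E" "jac_vanishes A0 S T X" "a \<in> U" "b \<in> U"
    have ji0: "X $ j $ i = 0" using X(1) ji by (simp add: graph_matrices_def)
    show "X $ a $ b = 0" by (rule block_vanishes_single[OF X(2) refl ji0 X(3,4)])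
  qed
next
  case False
  \<comment> \<open>There is no one-way edge, so \<open>E\<close> is symmetric. A node with two
    neighbours arises from an edge between \<open>a\<close> and \<open>b\<close> together with an
    edge that leaves \<open>{a, b}\<close> at \<open>x\<close>.\<close>
  then have sym: "(a, b) \<in> E" if "(a, b) \<in> E \<union> E\<inverse>" for a b using that by blast
  have no_cover: "\<exists>c. c \<notin> V" if "card V < 3" for V :: "'n set"
  proof (rule ccontr)
    assume "\<not> ?thesis"
    then have "V = UNIV" by auto
    then show False using that card by simp
  qed
  define a :: 'n where "a = undefined"
  obtain b where b: "b \<noteq> a" "(a, b) \<in> E"
  proof -
    obtain c where c: "c \<notin> {a}" using no_cover[of "{a}"] by auto
    obtain y where y: "y \<noteq> a" "(a, y) \<in> E \<union> E\<inverse>"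
      using connected_leaves_proper_subset[OF conn _ c, of a] by auto
    show thesis by (rule that[OF y(1) sym[OF y(2)]])
  qed
  obtain x y where xy: "x \<in> {a, b}" "y \<notin> {a, b}" "(x, y) \<in> E"
  proof -
    have "card {a, b} < 3" using b(1) by simp
    then obtain c where c: "c \<notin> {a, b}" using no_cover by metis
    have "\<exists>x\<in>{a, b}. \<exists>y. y \<notin> {a, b} \<and> (x, y) \<in> E \<union> E\<inverse>"
      by (rule connected_leaves_proper_subset[OF conn _ c, of a]) simp
    then obtain x y where y: "x \<in> {a, b}" "y \<notin> {a, b}" "(x, y) \<in> E \<union> E\<inverse>" by blast
    show thesis by (rule that[OF y(1,2) sym[OF y(3)]])
  qed
  define j where "j = (if x = a then b else a)"
  have "(y, x) \<in> E" by (rule sym) (use xy(3) in simp)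
  moreover have "(b, a) \<in> E" by (rule sym) (use b(2) in simp)
  ultimately have e: "(j, x) \<in> E" "(y, x) \<in> E" using xy(1) b unfolding j_def by auto
  have d: "x \<noteq> j" "x \<noteq> y" "j \<noteq> y" using xy b(1) unfolding j_def by auto
  have col: "collider x {j, y}" by unfold_locales (use d in auto)
  interpret collider x "{j, y}" by (rule col)
  show ?thesis
  proof (rule injective_point_from_collider[OF conn loops col])
    show "(p, x) \<in> E" if "p \<in> {j, y}" for p using that e by auto
    fix X a b assume X: "X \<in> graph_matrices E" "jac_vanishes A0 S T X" "a \<in> U" "b \<in> U"
    show "X $ a $ b = 0" by (rule block_vanishes_pair[OF X(2) refl d(3) X(3,4)])
  qed
qed

theorem theorem5p6:
  fixes E :: "('n::{finite,linorder} \<times> 'n) set"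
  assumes "CARD('n) \<ge> 3"
    and "graph_connected E"
    and "\<forall>i. (i, i) \<in> E"
  shows "generically (param_space E)
      (\<lambda>\<theta>. rank (J_off E (cumulant2 \<theta>) (cumulant3 \<theta>) (fst \<theta>)) = card E)
    \<and> locally_identifiable E"
proof -
  obtain \<theta> where "\<theta> \<in> dominated_params" "fst \<theta> \<in> graph_matrices E"
    "jac_injective E (fst \<theta>) (cumulant2 \<theta>) (cumulant3 \<theta>)"
    using exists_injective_point[OF assms(1,2)] assms(3) by blast
  then show ?thesis using generic_conclusions_from_one_point[of \<theta> E] by blast
qed

end
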